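(* Assume SETH. Then for every $\varepsilon>0$, there is no algorithm running in time $O(N^{2-\varepsilon})$ that computes a $2^{(\log N)^{1-o(1)}}$-approximation for the Bichromatic LCS Closest Pair problem on two sets of $N$ permutations of length $m=N^{o(1)}$.
   Context: Bichromatic LCS Closest Pair: given two sets $X,Y\subseteq\Sigma^m$ of strings over an alphabet $\Sigma$, find (the value of) a pair $x\in X$, $y\in Y$ maximizing $LCS(x,y)$, the length of the longest common (not necessarily contiguous) subsequence of $x$ and $y$. In the permutation version every string is a permutation, i.e. a string of length $m$ in which each symbol appears at most once. If the optimum is $OPT$, a $c$-approximation algorithm returns a value $L$ with $OPT/c\le L\le OPT$. SETH: for every $\varepsilon>0$ there exists $k\ge3$ such that $k$-SAT on $n$ variables cannot be solved in time $O(2^{(1-\varepsilon)n})$. *)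

theory Defs
  imports
    Complex_Main
    "HOL-Library.Landau_Symbols"
    "HOL-Library.Sublist"
    "HOL-Library.Discrete_Functions"
begin

section \<open>Model of computation: deterministic RAM programs with logarithmic cost\<close>

text \<open>
  The memory of a program consists of arrays \<open>a = 0, 1, 2, \<dots>\<close> of natural numbers (a given program
  mentions only finitely many array names); scalar variables are the cells with index 0.
  Values are unbounded, and every operation is charged the bit lengths of the values
  involved (addresses included).  Up to factors polylogarithmic in the running time this is the
  unit-cost word RAM with words of logarithmic length, and such factors are irrelevant for time
  bounds of the form \<open>2 powr ((1 - \<epsilon>) * n)\<close> or \<open>N powr (2 - \<epsilon>)\<close> with arbitrary \<open>\<epsilon> > 0\<close>.
\<close>

type_synonym memory = "nat \<Rightarrow> nat \<Rightarrow> nat"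

datatype expr =
    Const nat
  | Cell nat expr
  | Add expr expr
  | Sub expr expr
  | Mul expr expr
  | Div expr expr

datatype prog =
    Store nat expr expr
  | Seq prog prog
  | Cond expr prog prog
  | While expr prog

fun val :: "expr \<Rightarrow> memory \<Rightarrow> nat" where
  "val (Const n) s = n"
| "val (Cell a e) s = s a (val e s)"
| "val (Add e1 e2) s = val e1 s + val e2 s"
| "val (Sub e1 e2) s = val e1 s - val e2 s"
| "val (Mul e1 e2) s = val e1 s * val e2 s"
| "val (Div e1 e2) s = val e1 s div val e2 s"

definition bits :: "nat \<Rightarrow> nat" where
  "bits n = floor_log n + 1"

text \<open>
  Each node of an expression is charged the bit length of its value; the address of a cell and the
  operands of an arithmetic operation are charged through the subexpressions.
\<close>

fun cost :: "expr \<Rightarrow> memory \<Rightarrow> nat" where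
  "cost (Const n) s = bits n"
| "cost (Cell a e) s = cost e s + bits (val (Cell a e) s)"
| "cost (Add e1 e2) s = cost e1 s + cost e2 s + bits (val (Add e1 e2) s)"
| "cost (Sub e1 e2) s = cost e1 s + cost e2 s + bits (val (Sub e1 e2) s)"
| "cost (Mul e1 e2) s = cost e1 s + cost e2 s + bits (val (Mul e1 e2) s)"
| "cost (Div e1 e2) s = cost e1 s + cost e2 s + bits (val (Div e1 e2) s)"

text \<open>\<open>exec p s t s'\<close>: started in memory \<open>s\<close>, \<open>p\<close> halts after time \<open>t\<close> in memory \<open>s'\<close>.\<close>

inductive exec :: "prog \<Rightarrow> memory \<Rightarrow> nat \<Rightarrow> memory \<Rightarrow> bool" where
  Store: "exec (Store a e1 e2) s (cost e1 s + cost e2 s) (s(a := (s a)(val e1 s := val e2 s)))"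
| Seq: "exec p s t s' \<Longrightarrow> exec q s' t' s'' \<Longrightarrow> exec (Seq p q) s (t + t') s''"
| CondTrue: "val e s \<noteq> 0 \<Longrightarrow> exec p s t s' \<Longrightarrow> exec (Cond e p q) s (cost e s + t) s'"
| CondFalse: "val e s = 0 \<Longrightarrow> exec q s t s' \<Longrightarrow> exec (Cond e p q) s (cost e s + t) s'"
| WhileFalse: "val e s = 0 \<Longrightarrow> exec (While e p) s (cost e s) s"
| WhileTrue: "val e s \<noteq> 0 \<Longrightarrow> exec p s t s' \<Longrightarrow> exec (While e p) s' t' s'' \<Longrightarrow>
    exec (While e p) s (cost e s + t + t') s''"

inductive_cases exec_StoreE: "exec (Store a e1 e2) s t s'"
inductive_cases exec_SeqE: "exec (Seq p q) s t s'"
inductive_cases exec_CondE: "exec (Cond e p q) s t s'"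
inductive_cases exec_WhileE: "exec (While e p) s t s'"

lemma exec_deterministic:
  "exec p s t s' \<Longrightarrow> exec p s u r \<Longrightarrow> u = t \<and> r = s'"
proof (induction arbitrary: u r rule: exec.induct)
  case (Store a e1 e2 s)
  from Store.prems show ?case by (rule exec_StoreE) simp
next
  case (Seq p s t s' q t' s'')
  from Seq.prems show ?case by (rule exec_SeqE) (metis Seq.IH)
next
  case (CondTrue e s p t s' q)
  from CondTrue.prems show ?case
    by (rule exec_CondE) (metis CondTrue.IH, simp add: CondTrue.hyps)
next
  case (CondFalse e s q t s' p)
  from CondFalse.prems show ?case
    by (rule exec_CondE) (simp add: CondFalse.hyps, metis CondFalse.IH)
next
  case (WhileFalse e s p)
  from WhileFalse.prems show ?case
    by (rule exec_WhileE) (simp_all add: WhileFalse.hyps)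
next
  case (WhileTrue e s p t s' t' s'')
  from WhileTrue.prems show ?case
    by (rule exec_WhileE) (use WhileTrue.hyps(1) in simp, metis WhileTrue.IH)
qed

text \<open>The input is placed in array 0, the output is read from cell 0 of array 1.\<close>

definition input_memory :: "nat list \<Rightarrow> memory" where
  "input_memory xs = (\<lambda>a i. if a = 0 \<and> i < length xs then xs ! i else 0)"

definition computes :: "prog \<Rightarrow> nat list \<Rightarrow> nat \<Rightarrow> nat \<Rightarrow> bool" where
  "computes p xs y t \<longleftrightarrow> (\<exists>s. exec p (input_memory xs) t s \<and> s 1 0 = y)"


section \<open>\<open>k\<close>-SAT and SETH\<close>

text \<open>The literal \<open>(x, b)\<close> is the variable \<open>x\<close> if \<open>b\<close> holds and its negation otherwise.\<close>

type_synonym literal = "nat \<times> bool"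
type_synonym clause = "literal list"

text \<open>
  Clauses are not repeated, so that the length of a formula is polynomial in \<open>n\<close> for fixed \<open>k\<close> and
  running times may be measured in \<open>n\<close>.
\<close>

definition kcnf :: "nat \<Rightarrow> nat \<Rightarrow> clause list \<Rightarrow> bool" where
  "kcnf k n F \<longleftrightarrow> distinct F \<and> (\<forall>c\<in>set F. length c \<le> k \<and> (\<forall>(x, b)\<in>set c. x < n))"

definition satisfiable :: "clause list \<Rightarrow> bool" where
  "satisfiable F \<longleftrightarrow> (\<exists>v :: nat \<Rightarrow> bool. \<forall>c\<in>set F. \<exists>(x, b)\<in>set c. v x = b)"

definition encode_cnf :: "nat \<Rightarrow> clause list \<Rightarrow> nat list" where
  "encode_cnf n F = n # length F #
     concat (map (\<lambda>c. length c # map (\<lambda>(x, b). 2 * x + of_bool b) c) F)"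

definition solves_kSAT :: "prog \<Rightarrow> nat \<Rightarrow> (nat \<Rightarrow> real) \<Rightarrow> bool" where
  "solves_kSAT p k T \<longleftrightarrow>
     (\<forall>n F. kcnf k n F \<longrightarrow>
        (\<exists>t. computes p (encode_cnf n F) (of_bool (satisfiable F)) t \<and> real t \<le> T n))"

definition SETH :: bool where
  "SETH \<longleftrightarrow>
     (\<forall>\<epsilon>::real. \<epsilon> > 0 \<longrightarrow>
        (\<exists>k\<ge>3. \<not> (\<exists>p T. T \<in> O(\<lambda>n. 2 powr ((1 - \<epsilon>) * real n)) \<and> solves_kSAT p k T)))"


section \<open>Bichromatic LCS Closest Pair on permutations\<close>

definition LCS :: "'a list \<Rightarrow> 'a list \<Rightarrow> nat" where
  "LCS x y = Max {length z | z. subseq z x \<and> subseq z y}"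

definition OPT :: "'a list set \<Rightarrow> 'a list set \<Rightarrow> nat" where
  "OPT X Y = Max {LCS x y | x y. x \<in> X \<and> y \<in> Y}"

definition is_approximation :: "real \<Rightarrow> 'a list set \<Rightarrow> 'a list set \<Rightarrow> real \<Rightarrow> bool" where
  "is_approximation c X Y L \<longleftrightarrow> real (OPT X Y) / c \<le> L \<and> L \<le> real (OPT X Y)"

definition permutation_strings :: "'a set \<Rightarrow> nat \<Rightarrow> 'a list set" where
  "permutation_strings \<Sigma> m = {x. length x = m \<and> set x \<subseteq> \<Sigma> \<and> distinct x}"

text \<open>
  The sets \<open>X\<close> and \<open>Y\<close> are given by enumerations without repetition.  At most \<open>2 * N * m\<close> symbols
  occur in an instance; naming them \<open>0, \<dots>, 2 * N * m - 1\<close> loses no generality and ensures that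
  every symbol is written with \<open>O(log N)\<close> bits.
\<close>

definition LCS_instance :: "nat \<Rightarrow> nat \<Rightarrow> nat list list \<Rightarrow> nat list list \<Rightarrow> bool" where
  "LCS_instance N m xs ys \<longleftrightarrow>
     length xs = N \<and> distinct xs \<and> set xs \<subseteq> permutation_strings {..<2 * N * m} m \<and>
     length ys = N \<and> distinct ys \<and> set ys \<subseteq> permutation_strings {..<2 * N * m} m"

definition encode_LCS :: "nat \<Rightarrow> nat \<Rightarrow> nat list list \<Rightarrow> nat list list \<Rightarrow> nat list" where
  "encode_LCS N m xs ys = N # m # concat xs @ concat ys"

text \<open>
  \<open>approximates_LCS_pair p m c T\<close>: on two sets of \<open>N\<close> permutations of length \<open>m N\<close>, \<open>p\<close> computes
  a \<open>c N\<close>-approximation of the optimum in time \<open>T N\<close>.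
\<close>

definition approximates_LCS_pair ::
    "prog \<Rightarrow> (nat \<Rightarrow> nat) \<Rightarrow> (nat \<Rightarrow> real) \<Rightarrow> (nat \<Rightarrow> real) \<Rightarrow> bool" where
  "approximates_LCS_pair p m c T \<longleftrightarrow>
     (\<forall>N\<ge>1. \<forall>xs ys. LCS_instance N (m N) xs ys \<longrightarrow>
        (\<exists>L t. computes p (encode_LCS N (m N) xs ys) L t \<and> real t \<le> T N \<and>
           is_approximation (c N) (set xs) (set ys) (real L)))"

end

theory Submission
  imports
    Defs
    "HOL-Library.Nat_Bijection"
    "HOL-Computational_Algebra.Primes"
    "HOL-Real_Asymp.Real_Asymp"
begin

text \<open>
  A \<open>k\<close>-SAT instance on \<open>2 v\<close> variables is first sparsified, with the branches taken recorded in
  \<open>o(v)\<close> bits, to almost linearly many clauses.  Writing \<open>a, b\<close> for the vectors of clauses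
  falsified by assignments of the first and of the second half of the variables, satisfiability means
  that some \<open>a\<close> and \<open>b\<close> are orthogonal, which is verified by a Merlin-Arthur protocol: given \<open>o(v)\<close>
  bits of advice and a random string \<open>r\<close>, a message \<open>\<alpha>\<close> computed from \<open>a\<close> has to be accepted by a
  predicate of \<open>b\<close>.  Repetition makes the soundness error as small as \<open>2 ^ - (v / v ^ o(1))\<close>.  Each
  pair of an assignment and an advice becomes a string whose symbols are the triples
  (advice, \<open>r\<close>, \<open>\<alpha>\<close>) that it sends or accepts, in a fixed order.  The longest common subsequence of
  two strings with the same advice consists of the common symbols, whose number is the number of
  accepting \<open>r\<close>, so approximating the optimum decides satisfiability.  As the advice is
  part of the strings, a single instance with \<open>2 ^ (v + o(v))\<close> strings suffices.
\<close>

section \<open>Polynomial-time subprograms\<close>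

text \<open>The exponent and the string length of the theorem are fixed before
  \<open>\<epsilon>\<close>, hence before SETH supplies \<open>k\<close>. Therefore a slack that
  exceeds every power of log v, and not a bound depending on \<open>k\<close>, pays for the clauses
  that survive sparsification. With v variables in each half, everything that a string index records
  besides the assignment may cost only o(v) bits. Arranging the clauses in a grid of
  \<open>UU\<close> by \<open>TT\<close> balances two such costs: the claimed product has about 2 *
  \<open>UU\<close> digits, and a message has \<open>TT\<close> residues, which enter the string
  length once per repetition. With v ^ k clauses one of the two would be too long, whence the
  sparsification. A true claim is accepted for every prime, a false one for at most half of them, so
  \<open>RR\<close> rounds create a gap of 2 ^ \<open>RR\<close>. Here \<open>RR\<close> is v
  divided by v ^ o(1), and log N = v + o(v). SETH speaks about programs. The instance must thus be
  written by a RAM program, in time polynomial in v per symbol; closure properties of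
  polynomial-time functions take the place of explicit programming.\<close>

definition runs :: "prog \<Rightarrow> memory \<Rightarrow> nat \<Rightarrow> memory \<Rightarrow> bool" where
  "runs p s t s' \<longleftrightarrow> (\<exists>u\<le>t. exec p s u s')"

lemma runs_Store:
  "cost e1 s + cost e2 s \<le> t \<Longrightarrow> runs (Store a e1 e2) s t (s(a := (s a)(val e1 s := val e2 s)))"
  unfolding runs_def using exec.Store by blast

lemma runs_Seq: "runs p s t s' \<Longrightarrow> runs q s' u s'' \<Longrightarrow> t + u \<le> w \<Longrightarrow> runs (Seq p q) s w s''"
  unfolding runs_def by (meson exec.Seq add_mono le_trans)

text \<open>\<open>K\<close> bounds the guard and the body separately, so a round costs at most
  \<open>2 * K\<close>; the last summand \<open>K\<close> is the final, failing test of the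
  guard.\<close>

lemma runs_for:
  assumes body: "\<And>j s. j < N \<Longrightarrow> Inv j s \<Longrightarrow> \<exists>s'. runs p s K s' \<and> Inv (Suc j) s'"
    and guard: "\<And>j s. j \<le> N \<Longrightarrow> Inv j s \<Longrightarrow> (val e s \<noteq> 0 \<longleftrightarrow> j < N) \<and> cost e s \<le> K"
    and init: "Inv 0 s"
  shows "\<exists>s'. runs (While e p) s (N * (2 * K) + K) s' \<and> Inv N s'"
proof -
  have "\<exists>s'. runs (While e p) s ((N - j) * (2 * K) + K) s' \<and> Inv N s'" if "j \<le> N" "Inv j s" for j s
    using that
  proof (induction "N - j" arbitrary: j s)
    case 0
    then show ?case
      using guard[of j s] exec.WhileFalse[of e s p] unfolding runs_def
      by (intro exI[of _ s]) (auto intro!: exI[of _ "cost e s"])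
  next
    case (Suc d)
    have "j < N" using Suc.hyps(2) by simp
    then obtain s1 where s1: "runs p s K s1" "Inv (Suc j) s1"
      using body[of j s] Suc.prems by blast
    have "d = N - Suc j" "Suc j \<le> N" using Suc.hyps(2) by simp_all
    from Suc.hyps(1)[OF this s1(2)]
    obtain s2 where s2: "runs (While e p) s1 ((N - Suc j) * (2 * K) + K) s2" "Inv N s2"
      by blast
    have c: "cost e s \<le> K" "val e s \<noteq> 0"
      using guard[of j s] Suc.prems Suc.hyps(2) by auto
    obtain u w where u: "u \<le> K" "exec p s u s1"
      and w: "w \<le> (N - Suc j) * (2 * K) + K" "exec (While e p) s1 w s2"
      using s1 s2 unfolding runs_def by auto
    have e: "exec (While e p) s (cost e s + u + w) s2"
      using exec.WhileTrue[OF c(2) u(2) w(2)] .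
    have "N - j = Suc (N - Suc j)" using Suc.hyps(2) by simp
    then have "cost e s + u + w \<le> (N - j) * (2 * K) + K"
      using u w c by simp
    then show ?case using e s2(2) unfolding runs_def by blast
  qed
  from this[of 0 s] init show ?thesis by simp
qed

lemma less_two_power_bits: "n < 2 ^ bits n"
  using floor_log_exp2_gt[of n] by (simp add: bits_def)

lemma bits_le: "n < 2 ^ t \<Longrightarrow> bits n \<le> t + 1"
  unfolding bits_def using floor_log_le_iff[of n "2 ^ t"] by (simp add: floor_log_power)

section \<open>The frame property of programs\<close>

fun arrays_of_expr :: "expr \<Rightarrow> nat set" where
  "arrays_of_expr (Const n) = {}"
| "arrays_of_expr (Cell a e) = insert a (arrays_of_expr e)"
| "arrays_of_expr (Add e1 e2) = arrays_of_expr e1 \<union> arrays_of_expr e2"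
| "arrays_of_expr (Sub e1 e2) = arrays_of_expr e1 \<union> arrays_of_expr e2"
| "arrays_of_expr (Mul e1 e2) = arrays_of_expr e1 \<union> arrays_of_expr e2"
| "arrays_of_expr (Div e1 e2) = arrays_of_expr e1 \<union> arrays_of_expr e2"

fun arrays_of :: "prog \<Rightarrow> nat set" where
  "arrays_of (Store a e1 e2) = insert a (arrays_of_expr e1 \<union> arrays_of_expr e2)"
| "arrays_of (Seq p q) = arrays_of p \<union> arrays_of q"
| "arrays_of (Cond e p q) = arrays_of_expr e \<union> arrays_of p \<union> arrays_of q"
| "arrays_of (While e p) = arrays_of_expr e \<union> arrays_of p"

lemma finite_arrays_of_expr: "finite (arrays_of_expr e)"
  by (induction e) auto

lemma finite_arrays_of: "finite (arrays_of p)"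
  by (induction p) (auto simp: finite_arrays_of_expr)

lemma val_cong: "\<forall>a\<in>arrays_of_expr e. r a = s a \<Longrightarrow> val e r = val e s"
  by (induction e) auto

lemma cost_cong: "\<forall>a\<in>arrays_of_expr e. r a = s a \<Longrightarrow> cost e r = cost e s"
proof (induction e)
  case (Cell a e)
  then have "val e r = val e s" by (intro val_cong) auto
  then show ?case using Cell by simp
next
  case (Add e1 e2)
  then have "val e1 r = val e1 s" "val e2 r = val e2 s" by (auto intro!: val_cong)
  then show ?case using Add by simp
next
  case (Sub e1 e2)
  then have "val e1 r = val e1 s" "val e2 r = val e2 s" by (auto intro!: val_cong)
  then show ?case using Sub by simp
next
  case (Mul e1 e2)
  then have "val e1 r = val e1 s" "val e2 r = val e2 s" by (auto intro!: val_cong)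
  then show ?case using Mul by simp
next
  case (Div e1 e2)
  then have "val e1 r = val e1 s" "val e2 r = val e2 s" by (auto intro!: val_cong)
  then show ?case using Div by simp
qed simp

text \<open>A program sees only the arrays that it mentions. This allows the hypothetical LCS
  program to run in a memory that still contains the work space of the reduction.\<close>

lemma exec_frame:
  "exec p s t s' \<Longrightarrow> arrays_of p \<subseteq> A \<Longrightarrow> \<forall>a\<in>A. r a = s a \<Longrightarrow>
    \<exists>r'. exec p r t r' \<and> (\<forall>a\<in>A. r' a = s' a) \<and> (\<forall>a. a \<notin> A \<longrightarrow> r' a = r a)"
proof (induction arbitrary: r rule: exec.induct)
  case (Store a e1 e2 s)
  have eq: "val e1 r = val e1 s" "val e2 r = val e2 s" "cost e1 r = cost e1 s" "cost e2 r = cost e2 s"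
    using Store by (auto intro!: val_cong cost_cong)
  have "exec (Store a e1 e2) r (cost e1 s + cost e2 s) (r(a := (r a)(val e1 s := val e2 s)))"
    using exec.Store[of a e1 e2 r] unfolding eq .
  moreover have "\<forall>x\<in>A. (r(a := (r a)(val e1 s := val e2 s))) x = (s(a := (s a)(val e1 s := val e2 s))) x"
    using Store.prems by auto
  moreover have "\<forall>x. x \<notin> A \<longrightarrow> (r(a := (r a)(val e1 s := val e2 s))) x = r x"
    using Store.prems by auto
  ultimately show ?case by blast
next
  case (Seq p s t s' q t' s'')
  have A: "arrays_of p \<subseteq> A" "arrays_of q \<subseteq> A" using Seq.prems by simp_all
  obtain r1 where r1: "exec p r t r1" "\<forall>a\<in>A. r1 a = s' a" "\<forall>a. a \<notin> A \<longrightarrow> r1 a = r a"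
    using Seq.IH(1)[OF A(1) Seq.prems(2)] by blast
  obtain r2 where r2: "exec q r1 t' r2" "\<forall>a\<in>A. r2 a = s'' a" "\<forall>a. a \<notin> A \<longrightarrow> r2 a = r1 a"
    using Seq.IH(2)[OF A(2) r1(2)] by blast
  show ?case using exec.Seq[OF r1(1) r2(1)] r1 r2 by auto
next
  case (CondTrue e s p t s' q)
  obtain r1 where r1: "exec p r t r1" "\<forall>a\<in>A. r1 a = s' a" "\<forall>a. a \<notin> A \<longrightarrow> r1 a = r a"
    using CondTrue.IH[of r] CondTrue.prems by auto
  have "val e r = val e s" "cost e r = cost e s"
    using CondTrue.prems by (auto intro!: val_cong cost_cong)
  then show ?case using r1 exec.CondTrue[of e r p t r1 q] CondTrue.hyps by auto
next
  case (CondFalse e s q t s' p)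
  obtain r1 where r1: "exec q r t r1" "\<forall>a\<in>A. r1 a = s' a" "\<forall>a. a \<notin> A \<longrightarrow> r1 a = r a"
    using CondFalse.IH[of r] CondFalse.prems by auto
  have "val e r = val e s" "cost e r = cost e s"
    using CondFalse.prems by (auto intro!: val_cong cost_cong)
  then show ?case using r1 exec.CondFalse[of e r q t r1 p] CondFalse.hyps by auto
next
  case (WhileFalse e s p)
  have "val e r = val e s" "cost e r = cost e s"
    using WhileFalse.prems by (auto intro!: val_cong cost_cong)
  then show ?case using exec.WhileFalse[of e r p] WhileFalse by auto
next
  case (WhileTrue e s p t s' t' s'')
  obtain r1 where r1: "exec p r t r1" "\<forall>a\<in>A. r1 a = s' a" "\<forall>a. a \<notin> A \<longrightarrow> r1 a = r a"
    using WhileTrue.IH(1)[of r] WhileTrue.prems by auto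
  obtain r2 where r2: "exec (While e p) r1 t' r2" "\<forall>a\<in>A. r2 a = s'' a"
    "\<forall>a. a \<notin> A \<longrightarrow> r2 a = r1 a"
    using WhileTrue.IH(2)[OF WhileTrue.prems(1) r1(2)] by blast
  have "val e r = val e s" "cost e r = cost e s"
    using WhileTrue.prems by (auto intro!: val_cong cost_cong)
  then show ?case using r1 r2 exec.WhileTrue[of e r p t r1 t' r2] WhileTrue.hyps by auto
qed

section \<open>A calculus of polynomial-time functions\<close>

definition drop1 :: "(nat \<Rightarrow> nat) \<Rightarrow> nat \<Rightarrow> nat" where
  "drop1 e = (\<lambda>i. e (Suc i))"

text \<open>Environments follow the de Bruijn convention: \<open>push\<close> binds a new variable
  0, and \<open>f I (drop1 e)\<close> is \<open>f\<close> weakened past one binder.\<close>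

definition push :: "nat \<Rightarrow> (nat \<Rightarrow> nat) \<Rightarrow> nat \<Rightarrow> nat" where
  "push x e = case_nat x e"

lemma push_simps [simp]: "push x e 0 = x" "drop1 (push x e) = e" "push x e (Suc i) = e i"
  by (auto simp: push_def drop1_def)

locale ram =
  fixes V :: "(nat \<Rightarrow> nat) set" and z :: nat and ST :: nat
  assumes ST: "ST \<noteq> 0"
    and z: "2 \<le> z"
    and entries: "\<exists>c. \<forall>I\<in>V. \<forall>i. I i \<le> (I 0 + z) ^ c"
begin

definition sz :: "(nat \<Rightarrow> nat) \<Rightarrow> nat" where
  "sz I = I 0 + z"

lemma sz: "2 \<le> sz I"
  using z by (simp add: sz_def)

definition pol :: "((nat \<Rightarrow> nat) \<Rightarrow> nat) \<Rightarrow> bool" where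
  "pol t \<longleftrightarrow> (\<exists>c. \<forall>I\<in>V. t I \<le> sz I ^ c)"

lemma pol_sz: "pol (\<lambda>I. sz I ^ c)"
  unfolding pol_def by blast

lemma pol_mono: "pol u \<Longrightarrow> (\<And>I. I \<in> V \<Longrightarrow> t I \<le> u I) \<Longrightarrow> pol t"
  unfolding pol_def by (meson le_trans)

lemma pol_const: "pol (\<lambda>I. c)"
  unfolding pol_def
  by (intro exI[of _ c]) (meson less_exp less_imp_le le_trans power_mono sz zero_le)

lemma pol_mult: "pol t \<Longrightarrow> pol u \<Longrightarrow> pol (\<lambda>I. t I * u I)"
  unfolding pol_def by (metis mult_le_mono power_add)

lemma pol_add: assumes "pol t" "pol u" shows "pol (\<lambda>I. t I + u I)"
proof -
  obtain a b where ab: "\<forall>I\<in>V. t I \<le> sz I ^ a" "\<forall>I\<in>V. u I \<le> sz I ^ b"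
    using assms unfolding pol_def by blast
  have "t I + u I \<le> sz I ^ (a + b + 1)" if "I \<in> V" for I
  proof -
    have s: "2 \<le> sz I" by (rule sz)
    have "t I \<le> sz I ^ (a + b)" "u I \<le> sz I ^ (a + b)"
      using ab that s by (meson le_trans power_increasing le_add1 le_add2 one_le_numeral)+
    then have "t I + u I \<le> 2 * sz I ^ (a + b)" by simp
    also have "\<dots> \<le> sz I * sz I ^ (a + b)" using s by simp
    finally show ?thesis by simp
  qed
  then show ?thesis unfolding pol_def by blast
qed

lemma pol_Suc: "pol t \<Longrightarrow> pol (\<lambda>I. Suc (t I))"
  using pol_add[of t "\<lambda>_. 1"] pol_const by simp

lemma pol_power: assumes "pol t" shows "pol (\<lambda>I. t I ^ c)"
proof (induction c)
  case 0 show ?case using pol_const[of 1] by simp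
next
  case (Suc c) then show ?case using pol_mult assms by simp
qed

lemmas pol_intros = pol_const pol_mult pol_add pol_Suc pol_power

text \<open>
  \<open>I\<close> is the content of array 0, which is only read; array \<open>ST\<close> is the work space.  The
  environment \<open>e\<close> consists of the cells \<open>ls 0, ls 1, \<dots>\<close> of \<open>ST\<close> (a repetitive sequence, since all
  of them lie below \<open>d\<close>); the cells from \<open>d\<close> on are free, and the result is left in cell \<open>d\<close>.
\<close>

definition outcome ::
  "((nat \<Rightarrow> nat) \<Rightarrow> (nat \<Rightarrow> nat) \<Rightarrow> nat) \<Rightarrow> prog \<Rightarrow> (nat \<Rightarrow> nat) \<Rightarrow> nat \<Rightarrow> memory \<Rightarrow> nat \<Rightarrow> bool" where
  "outcome f p ls d s t \<longleftrightarrow> f (s 0) (\<lambda>i. s ST (ls i)) < 2 ^ t \<and>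
     (\<exists>s'. runs p s t s' \<and> s' ST d = f (s 0) (\<lambda>i. s ST (ls i)) \<and>
        (\<forall>j<d. s' ST j = s ST j) \<and> (\<forall>a. a \<noteq> ST \<longrightarrow> s' a = s a))"

definition fits :: "(nat \<Rightarrow> nat) \<Rightarrow> ((nat \<Rightarrow> nat) \<Rightarrow> nat) \<Rightarrow> memory \<Rightarrow> bool" where
  "fits ls b s \<longleftrightarrow> s 0 \<in> V \<and> (\<forall>i. s ST (ls i) < 2 ^ b (s 0))"

text \<open>The program is chosen before the bound \<open>b\<close> on the bit lengths in the
  environment; only the time may depend on \<open>b\<close>. Values may thus have polynomially many
  bits. Since \<open>outcome\<close> bounds the bit length of the result as well, results can serve
  as environments again.\<close>

definition PT :: "((nat \<Rightarrow> nat) \<Rightarrow> (nat \<Rightarrow> nat) \<Rightarrow> nat) \<Rightarrow> bool" where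
  "PT f \<longleftrightarrow> (\<forall>ls d. (\<forall>i. ls i < d) \<longrightarrow> (\<exists>p. \<forall>b. pol b \<longrightarrow>
     (\<exists>t. pol t \<and> (\<forall>s. fits ls b s \<longrightarrow> outcome f p ls d s (t (s 0))))))"

lemma PT_I:
  assumes "\<And>ls d. (\<And>i. ls i < d) \<Longrightarrow>
    \<exists>p. \<forall>b. pol b \<longrightarrow> (\<exists>t. pol t \<and> (\<forall>s. fits ls b s \<longrightarrow> outcome f p ls d s (t (s 0))))"
  shows "PT f"
  unfolding PT_def by (intro allI impI assms) simp

lemma PT_E:
  assumes "PT f" "\<And>i. ls i < d"
  obtains p where "\<And>b. pol b \<Longrightarrow> \<exists>t. pol t \<and> (\<forall>s. fits ls b s \<longrightarrow> outcome f p ls d s (t (s 0)))"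
proof -
  have "\<exists>p. \<forall>b. pol b \<longrightarrow> (\<exists>t. pol t \<and> (\<forall>s. fits ls b s \<longrightarrow> outcome f p ls d s (t (s 0))))"
    by (rule assms(1)[unfolded PT_def, rule_format]) (rule assms(2))
  then show thesis using that by metis
qed

lemma outcomeI:
  assumes "runs p s t s'" "s' ST d = f (s 0) (\<lambda>i. s ST (ls i))" "f (s 0) (\<lambda>i. s ST (ls i)) < 2 ^ t"
    "\<And>j. j < d \<Longrightarrow> s' ST j = s ST j" "\<And>a. a \<noteq> ST \<Longrightarrow> s' a = s a"
  shows "outcome f p ls d s t"
  unfolding outcome_def by (intro conjI exI[of _ s'] allI impI assms)

lemma outcomeE:
  assumes "outcome f p ls d s t"
  obtains s' where "runs p s t s'" "s' ST d = f (s 0) (\<lambda>i. s ST (ls i))"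
    "f (s 0) (\<lambda>i. s ST (ls i)) < 2 ^ t"
    "\<And>j. j < d \<Longrightarrow> s' ST j = s ST j" "\<And>a. a \<noteq> ST \<Longrightarrow> s' a = s a" "s' 0 = s 0"
  using assms that ST unfolding outcome_def by auto

lemma less_two_power_mono: "n < 2 ^ t \<Longrightarrow> t \<le> u \<Longrightarrow> n < (2::nat) ^ u"
  by (erule order_less_le_trans) (rule power_increasing, auto)

lemma outcome_Seq_Store:
  assumes "runs p s t s1" "\<And>j. j < d \<Longrightarrow> s1 ST j = s ST j" "\<And>a. a \<noteq> ST \<Longrightarrow> s1 a = s a"
    and "val x s1 = f (s 0) (\<lambda>i. s ST (ls i))" "f (s 0) (\<lambda>i. s ST (ls i)) < 2 ^ w"
    and "t + bits d + cost x s1 \<le> w"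
  shows "outcome f (Seq p (Store ST (Const d) x)) ls d s w"
proof (rule outcomeI)
  show "runs (Seq p (Store ST (Const d) x)) s w (s1(ST := (s1 ST)(val (Const d) s1 := val x s1)))"
    by (rule runs_Seq[OF assms(1) runs_Store[OF order_refl]]) (use assms in simp)
qed (use assms in auto)

lemma PT_Store:
  fixes x :: "(nat \<Rightarrow> nat) \<Rightarrow> nat \<Rightarrow> expr"
  assumes "\<And>ls d b. pol b \<Longrightarrow> \<exists>t. pol t \<and> (\<forall>s. fits ls b s \<longrightarrow>
     f (s 0) (\<lambda>i. s ST (ls i)) < 2 ^ t (s 0) \<and> val (x ls d) s = f (s 0) (\<lambda>i. s ST (ls i)) \<and> cost (x ls d) s \<le> t (s 0))"
  shows "PT f"
proof (rule PT_I)
  fix ls :: "nat \<Rightarrow> nat" and d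
  assume ls: "\<And>i. ls i < d"
  show "\<exists>p. \<forall>b. pol b \<longrightarrow> (\<exists>t. pol t \<and> (\<forall>s. fits ls b s \<longrightarrow> outcome f p ls d s (t (s 0))))"
  proof (intro exI[of _ "Store ST (Const d) (x ls d)"] allI impI)
    fix b assume b: "pol b"
    obtain t where t: "pol t" "\<And>s. fits ls b s \<Longrightarrow>
       f (s 0) (\<lambda>i. s ST (ls i)) < 2 ^ t (s 0) \<and> val (x ls d) s = f (s 0) (\<lambda>i. s ST (ls i)) \<and> cost (x ls d) s \<le> t (s 0)"
      using assms[OF b, of ls d] by blast
    show "\<exists>t. pol t \<and> (\<forall>s. fits ls b s \<longrightarrow> outcome f (Store ST (Const d) (x ls d)) ls d s (t (s 0)))"
    proof (intro exI[of _ "\<lambda>I. bits d + t I"] conjI allI impI)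
      show "pol (\<lambda>I. bits d + t I)" by (intro pol_add pol_const t)
      fix s assume "fits ls b s"
      from t(2)[OF this] show "outcome f (Store ST (Const d) (x ls d)) ls d s (bits d + t (s 0))"
        by (intro outcomeI[where s' = "s(ST := (s ST)(val (Const d) s := val (x ls d) s))"] runs_Store)
          (auto elim: less_two_power_mono)
    qed
  qed
qed

lemma PT_const: "PT (\<lambda>I e. n)"
proof (rule PT_Store[where x = "\<lambda>ls d. Const n"])
  fix ls :: "nat \<Rightarrow> nat" and d :: nat and b
  show "\<exists>t. pol t \<and> (\<forall>s. fits ls b s \<longrightarrow> n < 2 ^ t (s 0) \<and> val (Const n) s = n \<and> cost (Const n) s \<le> t (s 0))"
    by (rule exI[of _ "\<lambda>_. bits n"]) (auto simp: less_two_power_bits intro: pol_const)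
qed

lemma PT_var: "PT (\<lambda>I e. e n)"
proof (rule PT_Store[where x = "\<lambda>ls d. Cell ST (Const (ls n))"])
  fix ls :: "nat \<Rightarrow> nat" and d :: nat and b assume b: "pol b"
  show "\<exists>t. pol t \<and> (\<forall>s. fits ls b s \<longrightarrow> s ST (ls n) < 2 ^ t (s 0) \<and>
    val (Cell ST (Const (ls n))) s = s ST (ls n) \<and> cost (Cell ST (Const (ls n))) s \<le> t (s 0))"
  proof (intro exI[of _ "\<lambda>I. bits (ls n) + (b I + 1)"] conjI allI impI)
    show "pol (\<lambda>I. bits (ls n) + (b I + 1))" by (intro pol_add pol_const b)
    fix s assume "fits ls b s"
    then have *: "s ST (ls n) < 2 ^ b (s 0)" by (simp add: fits_def)
    from bits_le[OF *] show "cost (Cell ST (Const (ls n))) s \<le> bits (ls n) + (b (s 0) + 1)" by simp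
    show "s ST (ls n) < 2 ^ (bits (ls n) + (b (s 0) + 1))" by (rule less_two_power_mono[OF *]) simp
  qed simp
qed

lemma PT_drop1: assumes "PT f" shows "PT (\<lambda>I e. f I (drop1 e))"
proof (rule PT_I)
  fix ls :: "nat \<Rightarrow> nat" and d assume ls: "\<And>i. ls i < d"
  obtain p where p: "\<And>b. pol b \<Longrightarrow> \<exists>t. pol t \<and>
      (\<forall>s. fits (\<lambda>i. ls (Suc i)) b s \<longrightarrow> outcome f p (\<lambda>i. ls (Suc i)) d s (t (s 0)))"
    by (rule PT_E[OF assms, of "\<lambda>i. ls (Suc i)" d, OF ls]) blast
  have o: "outcome (\<lambda>I e. f I (drop1 e)) p ls d s t = outcome f p (\<lambda>i. ls (Suc i)) d s t" for s t
    unfolding outcome_def drop1_def ..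
  have w: "fits ls b s \<Longrightarrow> fits (\<lambda>i. ls (Suc i)) b s" for b s by (simp add: fits_def)
  show "\<exists>p. \<forall>b. pol b \<longrightarrow> (\<exists>t. pol t \<and>
      (\<forall>s. fits ls b s \<longrightarrow> outcome (\<lambda>I e. f I (drop1 e)) p ls d s (t (s 0))))"
  proof (intro exI[of _ p] allI impI)
    fix b assume "pol b"
    from p[OF this] obtain t where "pol t"
      "\<And>s. fits (\<lambda>i. ls (Suc i)) b s \<Longrightarrow> outcome f p (\<lambda>i. ls (Suc i)) d s (t (s 0))" by blast
    then show "\<exists>t. pol t \<and> (\<forall>s. fits ls b s \<longrightarrow> outcome (\<lambda>I e. f I (drop1 e)) p ls d s (t (s 0)))"
      unfolding o by (intro exI[of _ t] conjI allI impI) (simp_all add: w)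
  qed
qed

text \<open>The second program is started with the value of \<open>f\<close> in cell
  \<open>d\<close>, outside its environment \<open>ls\<close>, and overwrites that cell with the
  final result.\<close>

lemma PT_seq:
  assumes f: "PT f" and g: "\<And>ls d. (\<And>i. ls i < d) \<Longrightarrow> \<exists>p. \<forall>b. pol b \<longrightarrow> (\<exists>t. pol t \<and>
     (\<forall>s. fits ls b s \<longrightarrow> s ST d = f (s 0) (\<lambda>i. s ST (ls i)) \<longrightarrow> s ST d < 2 ^ b (s 0) \<longrightarrow>
        outcome h p ls d s (t (s 0))))"
  shows "PT h"
proof (rule PT_I)
  fix ls :: "nat \<Rightarrow> nat" and d assume ls: "\<And>i. ls i < d"
  obtain p where p: "\<And>b. pol b \<Longrightarrow> \<exists>t. pol t \<and> (\<forall>s. fits ls b s \<longrightarrow> outcome f p ls d s (t (s 0)))"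
    by (rule PT_E[OF f, of ls d, OF ls]) blast
  obtain q where q: "\<And>b. pol b \<Longrightarrow> (\<exists>t. pol t \<and>
     (\<forall>s. fits ls b s \<longrightarrow> s ST d = f (s 0) (\<lambda>i. s ST (ls i)) \<longrightarrow> s ST d < 2 ^ b (s 0) \<longrightarrow>
        outcome h q ls d s (t (s 0))))"
    using g[of ls d, OF ls] by blast
  show "\<exists>p. \<forall>b. pol b \<longrightarrow> (\<exists>t. pol t \<and> (\<forall>s. fits ls b s \<longrightarrow> outcome h p ls d s (t (s 0))))"
  proof (intro exI[of _ "Seq p q"] allI impI)
    fix b assume b: "pol b"
    obtain t where t: "pol t" "\<And>s. fits ls b s \<Longrightarrow> outcome f p ls d s (t (s 0))"
      using p[OF b] by blast
    have "pol (\<lambda>I. b I + t I)" by (intro pol_add b t)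
    from q[OF this] obtain u where u: "pol u"
      "\<And>s. fits ls (\<lambda>I. b I + t I) s \<Longrightarrow> s ST d = f (s 0) (\<lambda>i. s ST (ls i)) \<Longrightarrow>
         s ST d < 2 ^ (b (s 0) + t (s 0)) \<Longrightarrow> outcome h q ls d s (u (s 0))" by blast
    show "\<exists>t. pol t \<and> (\<forall>s. fits ls b s \<longrightarrow> outcome h (Seq p q) ls d s (t (s 0)))"
    proof (intro exI[of _ "\<lambda>I. t I + u I"] conjI allI impI)
      show "pol (\<lambda>I. t I + u I)" by (intro pol_add t u)
      fix s assume s: "fits ls b s"
      obtain s1 where s1: "runs p s (t (s 0)) s1" "s1 ST d = f (s 0) (\<lambda>i. s ST (ls i))"
        "f (s 0) (\<lambda>i. s ST (ls i)) < 2 ^ t (s 0)" "\<And>j. j < d \<Longrightarrow> s1 ST j = s ST j"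
        "\<And>a. a \<noteq> ST \<Longrightarrow> s1 a = s a" "s1 0 = s 0"
        using outcomeE[OF t(2)[OF s]] by blast
      have eq: "s1 ST (ls i) = s ST (ls i)" for i using s1(4) ls by auto
      have "fits ls (\<lambda>I. b I + t I) s1"
        using s s1(6) eq by (auto simp: fits_def intro: less_two_power_mono[where t = "b (s 0)"])
      moreover have "s1 ST d < 2 ^ (b (s1 0) + t (s1 0))"
        unfolding s1(2,6) by (rule less_two_power_mono[OF s1(3)]) simp
      ultimately have "outcome h q ls d s1 (u (s 0))"
        using u(2)[of s1] s1(2,6) eq by simp
      then obtain s2 where s2: "runs q s1 (u (s 0)) s2" "s2 ST d = h (s 0) (\<lambda>i. s ST (ls i))"
        "h (s 0) (\<lambda>i. s ST (ls i)) < 2 ^ u (s 0)" "\<And>j. j < d \<Longrightarrow> s2 ST j = s1 ST j"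
        "\<And>a. a \<noteq> ST \<Longrightarrow> s2 a = s1 a"
        by (rule outcomeE) (simp add: s1 eq)
      show "outcome h (Seq p q) ls d s (t (s 0) + u (s 0))"
        by (rule outcomeI[OF runs_Seq[OF s1(1) s2(1)]])
          (use s1 s2 less_two_power_mono[OF s2(3)] in auto)
    qed
  qed
qed

lemma PT_input: assumes "PT f" shows "PT (\<lambda>I e. I (f I e))"
proof (rule PT_seq[OF assms])
  fix ls :: "nat \<Rightarrow> nat" and d assume ls: "\<And>i. ls i < d"
  obtain c where c: "\<And>I i. I\<in>V \<Longrightarrow> I i \<le> sz I ^ c" using entries unfolding sz_def by blast
  let ?x = "Cell 0 (Cell ST (Const d))"
  \<comment> \<open>A store that changes nothing serves as the first program in
    \<open>outcome_Seq_Store\<close>.\<close>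
  have skip: "runs (Store ST (Const d) (Cell ST (Const d))) s (2 * bits d + (b + 1)) s"
    if "s ST d < 2 ^ b" for s :: memory and b
    using runs_Store[of "Const d" s "Cell ST (Const d)" "2 * bits d + (b + 1)" ST] bits_le[OF that] by simp
  show "\<exists>p. \<forall>b. pol b \<longrightarrow> (\<exists>t. pol t \<and>
     (\<forall>s. fits ls b s \<longrightarrow> s ST d = f (s 0) (\<lambda>i. s ST (ls i)) \<longrightarrow> s ST d < 2 ^ b (s 0) \<longrightarrow>
        outcome (\<lambda>I e. I (f I e)) p ls d s (t (s 0))))"
  proof (intro exI[of _ "Seq (Store ST (Const d) (Cell ST (Const d))) (Store ST (Const d) ?x)"] allI impI)
    fix b assume b: "pol b"
    define t where "t = (\<lambda>I. (2 * bits d + (b I + 1)) + bits d + (bits d + (b I + 1) + (sz I ^ c + 1)))"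
    show "\<exists>t. pol t \<and>
     (\<forall>s. fits ls b s \<longrightarrow> s ST d = f (s 0) (\<lambda>i. s ST (ls i)) \<longrightarrow> s ST d < 2 ^ b (s 0) \<longrightarrow>
        outcome (\<lambda>I e. I (f I e)) (Seq (Store ST (Const d) (Cell ST (Const d))) (Store ST (Const d) ?x)) ls d s (t (s 0)))"
    proof (intro exI[of _ t] conjI allI impI)
      show "pol t" unfolding t_def by (intro pol_intros b pol_sz)
      fix s assume s: "fits ls b s" "s ST d = f (s 0) (\<lambda>i. s ST (ls i))" "s ST d < 2 ^ b (s 0)"
      have x: "s 0 i < 2 ^ (sz (s 0) ^ c)" for i using c[of "s 0"] s(1)
        by (metis le_less_trans less_exp fits_def)
      show "outcome (\<lambda>I e. I (f I e)) (Seq (Store ST (Const d) (Cell ST (Const d))) (Store ST (Const d) ?x)) ls d s (t (s 0))"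
      proof (rule outcome_Seq_Store[OF skip[of s "b (s 0)", OF s(3)]])
        show "s 0 (f (s 0) (\<lambda>i. s ST (ls i))) < 2 ^ t (s 0)"
          by (rule less_two_power_mono[OF x]) (simp add: t_def)
        show "2 * bits d + (b (s 0) + 1) + bits d + cost ?x s \<le> t (s 0)"
          using bits_le[OF s(3)] bits_le[OF x[of "s ST d"]] by (simp add: t_def)
      qed (use s in auto)
    qed
  qed
qed

text \<open>
  The environment of the second program is extended by cell \<open>d\<close>; its result arrives in cell \<open>d + 1\<close>.
\<close>

lemma PT_let_gen:
  assumes f: "PT f" and g: "PT (\<lambda>I e. g I (e 0) (drop1 e))"
    and x: "\<And>d s. val (x d) s = F (s ST d) (s ST (Suc d))"
      "\<And>d. \<exists>K. \<forall>s b. s ST d < 2 ^ b \<longrightarrow> s ST (Suc d) < 2 ^ b \<longrightarrow> cost (x d) s \<le> K * (b + 1)"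
    and F: "\<And>a b. F a b \<le> (a + 1) * (b + 1)"
  shows "PT (\<lambda>I e. F (f I e) (g I (f I e) e))"
proof (rule PT_seq[OF f])
  fix ls :: "nat \<Rightarrow> nat" and d assume ls: "\<And>i. ls i < d"
  define ls' where "ls' = push d ls"
  let ?g = "\<lambda>I e. g I (e 0) (drop1 e)"
  have ls': "ls' i < Suc d" for i using ls by (cases i) (auto simp: ls'_def less_Suc_eq)
  obtain p where p: "\<And>b. pol b \<Longrightarrow> \<exists>t. pol t \<and> (\<forall>s. fits ls' b s \<longrightarrow> outcome ?g p ls' (Suc d) s (t (s 0)))"
    by (rule PT_E[OF g, of ls' "Suc d", OF ls']) blast
  obtain K where K: "\<And>s b. s ST d < 2 ^ b \<Longrightarrow> s ST (Suc d) < 2 ^ b \<Longrightarrow> cost (x d) s \<le> K * (b + 1)"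
    using x(2) by blast
  let ?p = "Seq p (Store ST (Const d) (x d))"
  show "\<exists>p. \<forall>b. pol b \<longrightarrow> (\<exists>t. pol t \<and>
     (\<forall>s. fits ls b s \<longrightarrow> s ST d = f (s 0) (\<lambda>i. s ST (ls i)) \<longrightarrow> s ST d < 2 ^ b (s 0) \<longrightarrow>
        outcome (\<lambda>I e. F (f I e) (g I (f I e) e)) p ls d s (t (s 0))))"
  proof (intro exI[of _ ?p] allI impI)
    fix b assume b: "pol b"
    obtain t where t: "pol t" "\<And>s. fits ls' b s \<Longrightarrow> outcome ?g p ls' (Suc d) s (t (s 0))"
      using p[OF b] by blast
    define u where "u = (\<lambda>I. t I + bits d + (K + 2) * (b I + t I + 1))"
    show "\<exists>t. pol t \<and>
     (\<forall>s. fits ls b s \<longrightarrow> s ST d = f (s 0) (\<lambda>i. s ST (ls i)) \<longrightarrow> s ST d < 2 ^ b (s 0) \<longrightarrow>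
        outcome (\<lambda>I e. F (f I e) (g I (f I e) e)) ?p ls d s (t (s 0)))"
    proof (intro exI[of _ u] conjI allI impI)
      show "pol u" unfolding u_def by (intro pol_intros b t)
      fix s assume s: "fits ls b s" "s ST d = f (s 0) (\<lambda>i. s ST (ls i))" "s ST d < 2 ^ b (s 0)"
      have "s ST (ls' i) < 2 ^ b (s 0)" for i using s by (cases i) (auto simp: ls'_def fits_def)
      then have "fits ls' b s" using s(1) by (simp add: fits_def)
      from t(2)[OF this] obtain s1 where s1: "runs p s (t (s 0)) s1"
        "s1 ST (Suc d) = g (s 0) (s ST d) (\<lambda>i. s ST (ls i))"
        "g (s 0) (s ST d) (\<lambda>i. s ST (ls i)) < 2 ^ t (s 0)"
        "\<And>j. j < Suc d \<Longrightarrow> s1 ST j = s ST j" "\<And>a. a \<noteq> ST \<Longrightarrow> s1 a = s a"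
        by (rule outcomeE) (simp add: ls'_def drop1_def)
      let ?v = "F (s ST d) (g (s 0) (s ST d) (\<lambda>i. s ST (ls i)))"
      have "?v \<le> (s ST d + 1) * (g (s 0) (s ST d) (\<lambda>i. s ST (ls i)) + 1)" by (rule F)
      also have "\<dots> \<le> 2 ^ b (s 0) * 2 ^ t (s 0)"
        using s(3) s1(3) by (intro mult_le_mono) auto
      also have "\<dots> < 2 ^ u (s 0)"
        unfolding u_def power_add[symmetric] by (rule power_strict_increasing) auto
      finally have v: "?v < 2 ^ u (s 0)" .
      have "s1 ST d < 2 ^ (b (s 0) + t (s 0))"
        using s1(4)[of d] less_two_power_mono[OF s(3)] by simp
      moreover have "s1 ST (Suc d) < 2 ^ (b (s 0) + t (s 0))"
        unfolding s1(2) by (rule less_two_power_mono[OF s1(3)]) simp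
      ultimately have cs: "cost (x d) s1 \<le> K * (b (s 0) + t (s 0) + 1)" by (rule K)
      show "outcome (\<lambda>I e. F (f I e) (g I (f I e) e)) ?p ls d s (u (s 0))"
      proof (rule outcome_Seq_Store[OF s1(1)])
        show "F (f (s 0) (\<lambda>i. s ST (ls i))) (g (s 0) (f (s 0) (\<lambda>i. s ST (ls i))) (\<lambda>i. s ST (ls i))) < 2 ^ u (s 0)"
          using v s(2) by simp
        show "val (x d) s1 = F (f (s 0) (\<lambda>i. s ST (ls i))) (g (s 0) (f (s 0) (\<lambda>i. s ST (ls i))) (\<lambda>i. s ST (ls i)))"
          using s(2) s1(2) s1(4)[of d] by (simp add: x(1))
        show "t (s 0) + bits d + cost (x d) s1 \<le> u (s 0)" using cs by (simp add: u_def)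
      qed (use s1 in auto)
    qed
  qed
qed

text \<open>All four operations stay below \<open>(a + 1) * (b + 1)\<close>, so that bit lengths at
  most add up, apart from constants.\<close>

lemma PT_binop:
  assumes f: "PT f" and g: "PT g"
    and x: "\<And>e1 e2 s. val (X e1 e2) s = F (val e1 s) (val e2 s)"
      "\<And>e1 e2 s. cost (X e1 e2) s = cost e1 s + cost e2 s + bits (F (val e1 s) (val e2 s))"
    and F: "\<And>a b. F a b \<le> (a + 1) * (b + 1)"
  shows "PT (\<lambda>I e. F (f I e) (g I e))"
proof (rule PT_let_gen[where F = F and g = "\<lambda>I y e. g I e" and x = "\<lambda>d. X (Cell ST (Const d)) (Cell ST (Const (Suc d)))", OF f PT_drop1[OF g]])
  fix d
  show "\<exists>K. \<forall>s b. s ST d < 2 ^ b \<longrightarrow> s ST (Suc d) < 2 ^ b \<longrightarrow>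
    cost (X (Cell ST (Const d)) (Cell ST (Const (Suc d)))) s \<le> K * (b + 1)"
  proof (intro exI[of _ "bits d + bits (Suc d) + 5"] allI impI)
    fix s :: memory and b assume *: "s ST d < 2 ^ b" "s ST (Suc d) < 2 ^ b"
    have "F (s ST d) (s ST (Suc d)) \<le> (s ST d + 1) * (s ST (Suc d) + 1)" by (rule F)
    also have "\<dots> \<le> 2 ^ b * 2 ^ b" using * by (intro mult_le_mono) auto
    also have "\<dots> < 2 ^ (b + b + 1)" by (simp add: power_add)
    finally have "bits (F (s ST d) (s ST (Suc d))) \<le> b + b + 1 + 1" by (rule bits_le)
    then show "cost (X (Cell ST (Const d)) (Cell ST (Const (Suc d)))) s \<le> (bits d + bits (Suc d) + 5) * (b + 1)"
      using *[THEN bits_le] by (simp add: x algebra_simps)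
  qed
qed (use x F in auto)

lemma PT_add: "PT f \<Longrightarrow> PT g \<Longrightarrow> PT (\<lambda>I e. f I e + g I e)"
  by (erule (1) PT_binop[where X = Add]) auto

lemma PT_diff: "PT f \<Longrightarrow> PT g \<Longrightarrow> PT (\<lambda>I e. f I e - g I e)"
  by (erule (1) PT_binop[where X = Sub]) auto

lemma PT_mult: "PT f \<Longrightarrow> PT g \<Longrightarrow> PT (\<lambda>I e. f I e * g I e)"
  by (erule (1) PT_binop[where X = Mul]) auto

lemma PT_div: "PT f \<Longrightarrow> PT g \<Longrightarrow> PT (\<lambda>I e. f I e div g I e)"
proof (erule (1) PT_binop[where X = Div])
  fix a b :: nat
  have "a div b \<le> a" by simp
  also have "a \<le> (a + 1) * (b + 1)" by simp
  finally show "a div b \<le> (a + 1) * (b + 1)" .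
qed auto

lemma PT_Suc: "PT f \<Longrightarrow> PT (\<lambda>I e. Suc (f I e))"
  using PT_add[OF _ PT_const[of 1]] by simp

lemma PT_mod: "PT f \<Longrightarrow> PT g \<Longrightarrow> PT (\<lambda>I e. f I e mod g I e)"
  using PT_diff[of f "\<lambda>I e. f I e div g I e * g I e"] PT_mult PT_div by (simp add: minus_div_mult_eq_mod)

lemma PT_cong: "PT f \<Longrightarrow> (\<And>I e. I \<in> V \<Longrightarrow> f I e = g I e) \<Longrightarrow> PT g"
proof (rule PT_I)
  fix ls :: "nat \<Rightarrow> nat" and d assume f: "PT f" and fg: "\<And>I e. I \<in> V \<Longrightarrow> f I e = g I e" and ls: "\<And>i. ls i < d"
  obtain p where p: "\<And>b. pol b \<Longrightarrow> \<exists>t. pol t \<and> (\<forall>s. fits ls b s \<longrightarrow> outcome f p ls d s (t (s 0)))"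
    by (rule PT_E[OF f, of ls d, OF ls]) blast
  have "fits ls b s \<Longrightarrow> outcome f p ls d s t \<Longrightarrow> outcome g p ls d s t" for b s t
    using fg[of "s 0"] by (simp add: fits_def outcome_def)
  note w = this
  show "\<exists>p. \<forall>b. pol b \<longrightarrow> (\<exists>t. pol t \<and> (\<forall>s. fits ls b s \<longrightarrow> outcome g p ls d s (t (s 0))))"
  proof (intro exI[of _ p] allI impI)
    fix b assume "pol b"
    from p[OF this] obtain t where "pol t" "\<And>s. fits ls b s \<Longrightarrow> outcome f p ls d s (t (s 0))" by blast
    then show "\<exists>t. pol t \<and> (\<forall>s. fits ls b s \<longrightarrow> outcome g p ls d s (t (s 0)))"
      using w by (intro exI[of _ t] conjI allI impI) simp_all
  qed
qed

end

section \<open>Bounded recursion, predicates and powers\<close>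

context ram
begin

lemma PT_bound:
  assumes "PT f" "\<And>i. ls i < d" "pol b"
  shows "\<exists>t. pol t \<and> (\<forall>s. fits ls b s \<longrightarrow> f (s 0) (\<lambda>i. s ST (ls i)) < 2 ^ t (s 0))"
proof -
  obtain p where p: "\<And>b. pol b \<Longrightarrow> \<exists>t. pol t \<and> (\<forall>s. fits ls b s \<longrightarrow> outcome f p ls d s (t (s 0)))"
    by (rule PT_E[OF assms(1), of ls d, OF assms(2)]) blast
  from p[OF assms(3)] show ?thesis unfolding outcome_def by blast
qed

text \<open>Without \<open>bound\<close> the rule would admit repeated squaring, whose values have
  exponentially many bits. The index reaches the body as \<open>min (e 1) (N I)\<close> because an
  environment may hold any number; clamping gives the loop variable a polynomial bound in every
  environment.\<close>

lemma PT_rec: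
  assumes N: "PT (\<lambda>I e. N I)" "pol N" and f: "PT f"
    and g: "PT (\<lambda>I e. g I (min (e 1) (N I)) (e 0) (drop1 (drop1 e)))"
    and bound: "\<And>ls d b. (\<And>i. ls i < d) \<Longrightarrow> pol b \<Longrightarrow> \<exists>u. pol u \<and> (\<forall>s j. fits ls b s \<longrightarrow> j \<le> N (s 0) \<longrightarrow>
      rec_nat (f (s 0) (\<lambda>i. s ST (ls i))) (\<lambda>i a. g (s 0) i a (\<lambda>i. s ST (ls i))) j < 2 ^ u (s 0))"
  shows "PT (\<lambda>I e. rec_nat (f I e) (\<lambda>i a. g I i a e) (N I))" (is "PT ?h")
proof (rule PT_seq[OF f])
  fix ls :: "nat \<Rightarrow> nat" and d assume ls: "\<And>i. ls i < d"
  \<comment> \<open>Cell \<open>d\<close> holds the accumulator, \<open>d + 1\<close> the counter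
    and \<open>d + 2\<close> the number of rounds; \<open>d + 3\<close> receives the value of the
    body.\<close>
  define ls' where "ls' = push d (push (Suc d) ls)"
  let ?g = "\<lambda>I e. g I (min (e 1) (N I)) (e 0) (drop1 (drop1 e))"
  have lsN: "ls i < Suc (Suc d)" for i using less_SucI[OF less_SucI[OF ls]] .
  have ls': "ls' i < Suc (Suc (Suc d))" for i
    using less_SucI[OF lsN] by (auto simp: ls'_def push_def split: nat.split)
  obtain pN where pN: "\<And>b. pol b \<Longrightarrow> \<exists>t. pol t \<and> (\<forall>s. fits ls b s \<longrightarrow> outcome (\<lambda>I e. N I) pN ls (Suc (Suc d)) s (t (s 0)))"
    by (rule PT_E[OF N(1), of ls "Suc (Suc d)", OF lsN]) blast
  obtain pg where pg: "\<And>b. pol b \<Longrightarrow> \<exists>t. pol t \<and> (\<forall>s. fits ls' b s \<longrightarrow> outcome ?g pg ls' (Suc (Suc (Suc d))) s (t (s 0)))"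
    by (rule PT_E[OF g, of ls' "Suc (Suc (Suc d))", OF ls']) blast
  let ?cell = "\<lambda>i. Cell ST (Const i)"
  let ?upd = "Seq (Store ST (Const d) (?cell (Suc (Suc (Suc d))))) (Store ST (Const (Suc d)) (Add (?cell (Suc d)) (Const 1)))"
  let ?guard = "Sub (?cell (Suc (Suc d))) (?cell (Suc d))"
  let ?loop = "While ?guard (Seq pg ?upd)"
  let ?p = "Seq (Store ST (Const (Suc d)) (Const 0)) (Seq pN ?loop)"
  show "\<exists>p. \<forall>b. pol b \<longrightarrow> (\<exists>t. pol t \<and>
     (\<forall>s. fits ls b s \<longrightarrow> s ST d = f (s 0) (\<lambda>i. s ST (ls i)) \<longrightarrow> s ST d < 2 ^ b (s 0) \<longrightarrow>
        outcome ?h p ls d s (t (s 0))))"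
  proof (intro exI[of _ ?p] allI impI)
    fix b assume b: "pol b"
    obtain tN where tN: "pol tN" "\<And>s. fits ls b s \<Longrightarrow> outcome (\<lambda>I e. N I) pN ls (Suc (Suc d)) s (tN (s 0))"
      using pN[OF b] by blast
    obtain u where u: "pol u" "\<And>s j. fits ls b s \<Longrightarrow> j \<le> N (s 0) \<Longrightarrow>
      rec_nat (f (s 0) (\<lambda>i. s ST (ls i))) (\<lambda>i a. g (s 0) i a (\<lambda>i. s ST (ls i))) j < 2 ^ u (s 0)"
      using bound[of ls d, OF ls b] by blast
    have b': "pol (\<lambda>I. b I + u I + N I)" by (intro pol_intros b u N)
    obtain t where t: "pol t" "\<And>s. fits ls' (\<lambda>I. b I + u I + N I) s \<Longrightarrow> outcome ?g pg ls' (Suc (Suc (Suc d))) s (t (s 0))"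
      using pg[OF b'] by blast
    define C where "C = bits d + bits (Suc d) + bits (Suc (Suc d)) + bits (Suc (Suc (Suc d))) + bits 0 + bits 1"
    define K where "K = (\<lambda>I. 10 * (C + t I + N I + 1))"
    define w where "w = (\<lambda>I. C + tN I + (N I * (2 * K I) + K I) + u I)"
    show "\<exists>t. pol t \<and>
     (\<forall>s. fits ls b s \<longrightarrow> s ST d = f (s 0) (\<lambda>i. s ST (ls i)) \<longrightarrow> s ST d < 2 ^ b (s 0) \<longrightarrow>
        outcome ?h ?p ls d s (t (s 0)))"
    proof (intro exI[of _ w] conjI allI impI)
      show "pol w" unfolding w_def K_def by (intro pol_intros N tN t u)
      fix s assume s: "fits ls b s" "s ST d = f (s 0) (\<lambda>i. s ST (ls i))" "s ST d < 2 ^ b (s 0)"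
      define I where "I = s 0"
      define e where "e = (\<lambda>i. s ST (ls i))"
      define acc where "acc = rec_nat (f I e) (\<lambda>i a. g I i a e)"
      define Inv where "Inv = (\<lambda>j r. r ST d = acc j \<and> r ST (Suc d) = j \<and> r ST (Suc (Suc d)) = N I \<and>
        (\<forall>i<d. r ST i = s ST i) \<and> (\<forall>a. a \<noteq> ST \<longrightarrow> r a = s a))"
      have acc: "acc j < 2 ^ u I" if "j \<le> N I" for j
        using u(2)[OF s(1), of j] that by (simp add: acc_def I_def e_def)
      have small: "bits j \<le> N I + 1" if "j \<le> N I" for j
        using bits_le[of j "N I"] that less_exp[of "N I"] by simp
      have bodyI: "\<exists>r'. runs (Seq pg ?upd) r (K I) r' \<and> Inv (Suc j) r'" if j: "j < N I" and r: "Inv j r" for j r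
      proof -
        have rI: "r 0 = I" using r ST by (simp add: Inv_def I_def)
        have re: "r ST (ls i) = e i" for i using r ls by (simp add: Inv_def e_def)
        have rl: "(\<lambda>i. r ST (ls' i)) = push (acc j) (push j e)"
          using r re by (auto simp: ls'_def push_def Inv_def split: nat.split)
        then have rl': "r ST (ls' i) = push (acc j) (push j e) i" for i by (rule fun_cong)
        have "r ST (ls' i) < 2 ^ (b I + u I + N I)" for i
        proof -
          have "e n < 2 ^ (b I + u I + N I)" for n using s(1)
            by (auto simp: fits_def e_def I_def intro: less_two_power_mono[where t = "b (s 0)"])
          moreover have "acc j < 2 ^ (b I + u I + N I)"
            using j by (intro less_two_power_mono[OF acc]) auto
          moreover have "j < 2 ^ (b I + u I + N I)"
            by (rule less_two_power_mono[OF less_trans[OF j less_exp]]) simp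
          ultimately show ?thesis
            unfolding fun_cong[OF rl] by (auto simp: push_def split: nat.split)
        qed
        then have "fits ls' (\<lambda>I. b I + u I + N I) r" using s(1) rI by (simp add: fits_def I_def)
        from t(2)[OF this] obtain r1 where r1: "runs pg r (t I) r1"
          "r1 ST (Suc (Suc (Suc d))) = acc (Suc j)" "acc (Suc j) < 2 ^ t I"
          "\<And>j. j < Suc (Suc (Suc d)) \<Longrightarrow> r1 ST j = r ST j" "\<And>a. a \<noteq> ST \<Longrightarrow> r1 a = r a"
          using j by (elim outcomeE) (simp add: rl' rI acc_def drop1_def)
        define r2 where "r2 = r1(ST := (r1 ST)(d := acc (Suc j)))"
        define r3 where "r3 = r2(ST := (r2 ST)(Suc d := Suc j))"
        have r1d: "r1 ST (Suc d) = j" using r1(4)[of "Suc d"] r by (simp add: Inv_def)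
        have "runs (Store ST (Const d) (?cell (Suc (Suc (Suc d))))) r1 (C + t I + 1) r2"
          using runs_Store[of "Const d" r1 "?cell (Suc (Suc (Suc d)))" "C + t I + 1" ST] bits_le[OF r1(3)]
          by (simp add: r1(2) r2_def C_def)
        moreover have "runs (Store ST (Const (Suc d)) (Add (?cell (Suc d)) (Const 1))) r2 (2 * C + 2 * N I + 2) r3"
          using runs_Store[of "Const (Suc d)" r2 "Add (?cell (Suc d)) (Const 1)" "2 * C + 2 * N I + 2" ST]
            small[of j] small[of "Suc j"] j
          by (simp add: r3_def r2_def C_def r1d)
        ultimately have "runs (Seq pg ?upd) r (K I) r3"
          using r1(1) by (auto intro!: runs_Seq simp: K_def)
        moreover have "Inv (Suc j) r3"
          using r r1(4,5) by (auto simp: Inv_def r3_def r2_def)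
        ultimately show ?thesis by blast
      qed
      have guard: "(val ?guard r \<noteq> 0 \<longleftrightarrow> j < N I) \<and> cost ?guard r \<le> K I" if "j \<le> N I" "Inv j r" for j r
      proof -
        have "bits (N I - j) \<le> N I + 1" "bits j \<le> N I + 1" "bits (N I) \<le> N I + 1"
          using small that(1) by auto
        then show ?thesis using that(2) by (auto simp: Inv_def K_def C_def)
      qed
      define s1 where "s1 = s(ST := (s ST)(Suc d := 0))"
      have r1: "runs (Store ST (Const (Suc d)) (Const 0)) s C s1"
        using runs_Store[of "Const (Suc d)" s "Const 0" C ST] by (simp add: s1_def C_def)
      have "ls i \<noteq> Suc d" for i using ls[of i] by simp
      then have "s1 ST (ls i) = s ST (ls i)" "s1 0 = s 0" for i using ST by (auto simp: s1_def)
      note s1 = this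
      have "fits ls b s1" using s(1) by (simp add: fits_def s1)
      from tN(2)[OF this] obtain s2 where s2: "runs pN s1 (tN I) s2" "s2 ST (Suc (Suc d)) = N I"
        "\<And>j. j < Suc (Suc d) \<Longrightarrow> s2 ST j = s1 ST j" "\<And>a. a \<noteq> ST \<Longrightarrow> s2 a = s1 a"
        by (elim outcomeE) (simp add: s1 I_def)
      have "Inv 0 s2" using s2 s(2) by (auto simp: Inv_def s1_def acc_def e_def I_def)
      from runs_for[of "N I" Inv "Seq pg ?upd" "K I" ?guard, OF bodyI guard this]
      obtain s3 where s3: "runs ?loop s2 (N I * (2 * K I) + K I) s3" "Inv (N I) s3" by blast
      have h: "?h (s 0) (\<lambda>i. s ST (ls i)) = acc (N I)" by (simp add: acc_def e_def I_def)
      show "outcome ?h ?p ls d s (w (s 0))"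
      proof (rule outcomeI[where s' = s3])
        show "runs ?p s (w (s 0)) s3"
          by (rule runs_Seq[OF r1 runs_Seq[OF s2(1) s3(1) order_refl]]) (simp add: w_def I_def)
        show "s3 ST d = ?h (s 0) (\<lambda>i. s ST (ls i))" unfolding h using s3(2) by (simp add: Inv_def)
        show "?h (s 0) (\<lambda>i. s ST (ls i)) < 2 ^ w (s 0)"
          unfolding h by (rule less_two_power_mono[OF acc]) (auto simp: w_def I_def)
      qed (use s3(2) in \<open>auto simp: Inv_def\<close>)
    qed
  qed
qed

lemma sum_rec: "(\<Sum>i<n. h i) = rec_nat 0 (\<lambda>i a. a + h i) (n :: nat)" for h :: "nat \<Rightarrow> nat"
  by (induction n) auto

lemma PT_sum:
  assumes N: "PT (\<lambda>I e. N I)" "pol N" and h: "PT (\<lambda>I e. h I (min (e 0) (N I)) (drop1 e))"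
  shows "PT (\<lambda>I e. \<Sum>i<N I. h I i e)"
  unfolding sum_rec
proof (rule PT_rec[OF N PT_const])
  have "PT (\<lambda>I e. e 0 + h I (min (drop1 e 0) (N I)) (drop1 (drop1 e)))"
    by (intro PT_add PT_var PT_drop1[OF h])
  then show "PT (\<lambda>I e. e 0 + h I (min (e 1) (N I)) (drop1 (drop1 e)))"
    by (simp add: drop1_def)
  fix ls :: "nat \<Rightarrow> nat" and d b assume ls: "\<And>i. ls i < d" and b: "pol b"
  have ls': "push d ls i < Suc d" for i using less_SucI[OF ls] by (auto simp: push_def split: nat.split)
  have "pol (\<lambda>I. b I + N I)" by (intro pol_intros b N)
  from PT_bound[of _ "push d ls" "Suc d", OF h ls' this] obtain t where t: "pol t"
    "\<And>s. fits (push d ls) (\<lambda>I. b I + N I) s \<Longrightarrow> h (s 0) (min (s ST d) (N (s 0))) (\<lambda>i. s ST (ls i)) < 2 ^ t (s 0)"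
    by (auto simp: drop1_def)
  show "\<exists>u. pol u \<and> (\<forall>s j. fits ls b s \<longrightarrow> j \<le> N (s 0) \<longrightarrow>
      rec_nat 0 (\<lambda>i a. a + h (s 0) i (\<lambda>i. s ST (ls i))) j < 2 ^ u (s 0))"
  proof (intro exI[of _ "\<lambda>I. N I + t I"] conjI allI impI)
    show "pol (\<lambda>I. N I + t I)" by (intro pol_intros t N)
    fix s j assume s: "fits ls b s" and j: "j \<le> N (s 0)"
    have hi: "h (s 0) i (\<lambda>i. s ST (ls i)) < 2 ^ t (s 0)" if "i < N (s 0)" for i
    proof -
      let ?s = "s(ST := (s ST)(d := i))"
      have eq: "?s ST (ls n) = s ST (ls n)" for n using ls[of n] by simp
      have "i < 2 ^ (b (s 0) + N (s 0))"
        by (rule less_two_power_mono[OF less_trans[OF that less_exp]]) simp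
      moreover have "s ST (ls n) < 2 ^ (b (s 0) + N (s 0))" for n using s
        by (auto simp: fits_def intro: less_two_power_mono[where t = "b (s 0)"])
      ultimately have "fits (push d ls) (\<lambda>I. b I + N I) ?s"
        using s ST eq by (auto simp: fits_def push_def split: nat.split)
      from t(2)[OF this] show ?thesis using ST that unfolding eq by simp
    qed
    have "(\<Sum>i<j. h (s 0) i (\<lambda>i. s ST (ls i))) \<le> (\<Sum>i<j. 2 ^ t (s 0))"
      using j by (intro sum_mono less_imp_le hi) auto
    also have "\<dots> = j * 2 ^ t (s 0)" by simp
    also have "\<dots> < 2 ^ N (s 0) * 2 ^ t (s 0)"
      by (intro mult_strict_right_mono le_less_trans[OF j less_exp]) simp
    finally show "rec_nat 0 (\<lambda>i a. a + h (s 0) i (\<lambda>i. s ST (ls i))) j < 2 ^ (N (s 0) + t (s 0))"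
      by (simp add: sum_rec power_add)
  qed
qed

definition PB :: "((nat \<Rightarrow> nat) \<Rightarrow> (nat \<Rightarrow> nat) \<Rightarrow> bool) \<Rightarrow> bool" where
  "PB P \<longleftrightarrow> PT (\<lambda>I e. of_bool (P I e))"

text \<open>\<open>PT\<close> bounds the number of bits, \<open>bd\<close> the value itself,
  uniformly in the environment. Exponents have to satisfy the stronger condition.\<close>

definition bd :: "((nat \<Rightarrow> nat) \<Rightarrow> (nat \<Rightarrow> nat) \<Rightarrow> nat) \<Rightarrow> bool" where
  "bd f \<longleftrightarrow> (\<exists>u. pol u \<and> (\<forall>I\<in>V. \<forall>e. f I e \<le> u I))"

lemma PB_cong: "PB P \<Longrightarrow> (\<And>I e. I \<in> V \<Longrightarrow> P I e = Q I e) \<Longrightarrow> PB Q"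
  unfolding PB_def by (erule PT_cong) simp

lemma PB_drop1: "PB P \<Longrightarrow> PB (\<lambda>I e. P I (drop1 e))"
  unfolding PB_def by (rule PT_drop1)

lemma PT_of_bool: "PB P \<Longrightarrow> PT (\<lambda>I e. of_bool (P I e))"
  unfolding PB_def .

lemma PB_conj: "PB P \<Longrightarrow> PB Q \<Longrightarrow> PB (\<lambda>I e. P I e \<and> Q I e)"
  unfolding PB_def by (drule (1) PT_mult) (simp add: of_bool_conj)

lemma PB_not: "PB P \<Longrightarrow> PB (\<lambda>I e. \<not> P I e)"
  unfolding PB_def by (rule PT_cong[OF PT_diff[OF PT_const[of 1]]]) auto

lemma PB_disj: "PB P \<Longrightarrow> PB Q \<Longrightarrow> PB (\<lambda>I e. P I e \<or> Q I e)"
  using PB_not[of "\<lambda>I e. \<not> P I e \<and> \<not> Q I e"] PB_conj[OF PB_not PB_not, of P Q] by simp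

lemma PB_imp: "PB P \<Longrightarrow> PB Q \<Longrightarrow> PB (\<lambda>I e. P I e \<longrightarrow> Q I e)"
  unfolding imp_conv_disj by (intro PB_disj PB_not)

lemma PB_le: assumes "PT f" "PT g" shows "PB (\<lambda>I e. f I e \<le> g I e)"
  unfolding PB_def
proof (rule PT_cong)
  show "PT (\<lambda>I e. 1 - (f I e - g I e))" by (intro PT_diff PT_const assms)
qed auto

lemma PB_less: "PT f \<Longrightarrow> PT g \<Longrightarrow> PB (\<lambda>I e. f I e < g I e)"
  using PB_not[OF PB_le[of g f]] by (simp add: not_le)

lemma PB_eq: "PT f \<Longrightarrow> PT g \<Longrightarrow> PB (\<lambda>I e. f I e = g I e)"
  using PB_conj[OF PB_le[of f g] PB_le[of g f]] by (simp add: eq_iff)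

lemma PB_iff: "PB P \<Longrightarrow> PB Q \<Longrightarrow> PB (\<lambda>I e. P I e = Q I e)"
  using PB_conj[OF PB_imp[of P Q] PB_imp[of Q P]] by (simp add: iff_conv_conj_imp)

lemma PB_dvd: "PT f \<Longrightarrow> PT g \<Longrightarrow> PB (\<lambda>I e. f I e dvd g I e)"
  using PB_eq[OF PT_mod[of g f] PT_const[of 0]] by (simp add: dvd_eq_mod_eq_0)

lemma PB_odd: "PT f \<Longrightarrow> PB (\<lambda>I e. odd (f I e))"
  by (intro PB_not PB_dvd PT_const)

lemma PT_if: assumes "PB P" "PT f" "PT g" shows "PT (\<lambda>I e. if P I e then f I e else g I e)"
proof (rule PT_cong)
  show "PT (\<lambda>I e. of_bool (P I e) * f I e + of_bool (\<not> P I e) * g I e)"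
    by (intro PT_add PT_mult PT_of_bool PB_not assms)
qed auto

lemma PB_if: "PB P \<Longrightarrow> PB Q \<Longrightarrow> PB R \<Longrightarrow> PB (\<lambda>I e. if P I e then Q I e else R I e)"
  by (rule PB_cong[OF PB_conj[OF PB_imp[of P Q] PB_disj[of P R]]]) auto

lemma PT_min: "PT f \<Longrightarrow> PT g \<Longrightarrow> PT (\<lambda>I e. min (f I e) (g I e))"
  unfolding min_def by (intro PT_if PB_le)

lemma PB_ex:
  assumes "PT (\<lambda>I e. N I)" "pol N" "PB (\<lambda>I e. P I (min (e 0) (N I)) (drop1 e))"
  shows "PB (\<lambda>I e. \<exists>i<N I. P I i e)"
proof (rule PB_cong)
  show "PB (\<lambda>I e. 0 < (\<Sum>i<N I. of_bool (P I i e) :: nat))"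
    using assms(3) unfolding PB_def[of "\<lambda>I e. P I (min (e 0) (N I)) (drop1 e)"] by (intro PB_less PT_const PT_sum assms)
  show "(0 < (\<Sum>i<N I. of_bool (P I i e) :: nat)) = (\<exists>i<N I. P I i e)" for I e
    by (simp add: zero_less_iff_neq_zero) blast
qed

lemma PB_all:
  assumes "PT (\<lambda>I e. N I)" "pol N" "PB (\<lambda>I e. P I (min (e 0) (N I)) (drop1 e))"
  shows "PB (\<lambda>I e. \<forall>i<N I. P I i e)"
proof -
  have "PB (\<lambda>I e. \<not> (\<exists>i<N I. \<not> P I i e))" by (intro PB_not PB_ex assms)
  then show ?thesis by simp
qed

lemma bd_pol: "pol N \<Longrightarrow> bd (\<lambda>I e. N I)"
  unfolding bd_def by blast

lemma bd_mono: "bd g \<Longrightarrow> (\<And>I e. I \<in> V \<Longrightarrow> f I e \<le> g I e) \<Longrightarrow> bd f"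
  unfolding bd_def by (meson le_trans)

lemma bd_const: "bd (\<lambda>I e. n)"
  by (intro bd_pol pol_const)

lemma bd_min: "pol N \<Longrightarrow> bd (\<lambda>I e. min (f I e) (N I))"
  by (rule bd_mono[OF bd_pol]) auto

lemma bdE:
  assumes "bd f" obtains u where "pol u" "\<And>I e. I \<in> V \<Longrightarrow> f I e \<le> u I"
  using assms unfolding bd_def by blast

lemma bd_add: assumes "bd f" "bd g" shows "bd (\<lambda>I e. f I e + g I e)"
proof -
  obtain u where u: "pol u" "\<And>I e. I \<in> V \<Longrightarrow> f I e \<le> u I" using bdE[OF assms(1)] by blast
  obtain w where w: "pol w" "\<And>I e. I \<in> V \<Longrightarrow> g I e \<le> w I" using bdE[OF assms(2)] by blast
  show ?thesis by (rule bd_mono[OF bd_pol[OF pol_add[OF u(1) w(1)]]]) (intro add_mono u w)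
qed

lemma bd_mult: assumes "bd f" "bd g" shows "bd (\<lambda>I e. f I e * g I e)"
proof -
  obtain u where u: "pol u" "\<And>I e. I \<in> V \<Longrightarrow> f I e \<le> u I" using bdE[OF assms(1)] by blast
  obtain w where w: "pol w" "\<And>I e. I \<in> V \<Longrightarrow> g I e \<le> w I" using bdE[OF assms(2)] by blast
  show ?thesis by (rule bd_mono[OF bd_pol[OF pol_mult[OF u(1) w(1)]]]) (intro mult_le_mono u w)
qed

lemma bd_Suc: "bd f \<Longrightarrow> bd (\<lambda>I e. Suc (f I e))"
  using bd_add[of f "\<lambda>I e. 1"] bd_const[of 1] by simp

lemma bd_diff: "bd f \<Longrightarrow> bd (\<lambda>I e. f I e - g I e)"
  by (erule bd_mono) simp

lemma bd_div: "bd f \<Longrightarrow> bd (\<lambda>I e. f I e div g I e)"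
  by (erule bd_mono) simp

lemma bd_mod: "bd f \<Longrightarrow> bd (\<lambda>I e. f I e mod g I e)"
  by (erule bd_mono) simp

lemma bd_drop1: "bd f \<Longrightarrow> bd (\<lambda>I e. f I (drop1 e))"
  by (erule bdE, rule bd_mono[OF bd_pol]) auto

lemma PT_power_le:
  assumes f: "PT f" and g: "PT g" and N: "PT (\<lambda>I e. N I)" "pol N" "\<And>I e. I \<in> V \<Longrightarrow> g I e \<le> N I"
  shows "PT (\<lambda>I e. f I e ^ g I e)"
proof (rule PT_cong)
  \<comment> \<open>The number of rounds in \<open>PT_rec\<close> depends on the input only, so the
    loop always makes \<open>N I\<close> rounds and the exponent is enforced inside the
    body.\<close>
  show "PT (\<lambda>I e. rec_nat 1 (\<lambda>i a. if i < g I e then a * f I e else a) (N I))"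
  proof (rule PT_rec[OF N(1,2) PT_const])
    show "PT (\<lambda>I e. if min (e 1) (N I) < g I (drop1 (drop1 e)) then e 0 * f I (drop1 (drop1 e)) else e 0)"
      by (intro PT_if PB_less PT_mult PT_min PT_var N f[THEN PT_drop1, THEN PT_drop1] g[THEN PT_drop1, THEN PT_drop1])
    fix ls :: "nat \<Rightarrow> nat" and d b assume ls: "\<And>i. ls i < d" and b: "pol b"
    from PT_bound[of f ls d b, OF f ls b] obtain t where t: "pol t"
      "\<And>s. fits ls b s \<Longrightarrow> f (s 0) (\<lambda>i. s ST (ls i)) < 2 ^ t (s 0)" by blast
    show "\<exists>u. pol u \<and> (\<forall>s j. fits ls b s \<longrightarrow> j \<le> N (s 0) \<longrightarrow>
      rec_nat 1 (\<lambda>i a. if i < g (s 0) (\<lambda>i. s ST (ls i)) then a * f (s 0) (\<lambda>i. s ST (ls i)) else a) j < 2 ^ u (s 0))"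
    proof (intro exI[of _ "\<lambda>I. Suc (N I * t I)"] conjI allI impI)
      show "pol (\<lambda>I. Suc (N I * t I))" by (intro pol_intros t N)
      fix s j assume s: "fits ls b s" "j \<le> N (s 0)"
      have "rec_nat 1 (\<lambda>i a. if i < g (s 0) (\<lambda>i. s ST (ls i)) then a * f (s 0) (\<lambda>i. s ST (ls i)) else a) j \<le> (2 ^ t (s 0)) ^ j"
      proof (induction j)
        case (Suc j)
        let ?a = "rec_nat 1 (\<lambda>i a. if i < g (s 0) (\<lambda>i. s ST (ls i)) then a * f (s 0) (\<lambda>i. s ST (ls i)) else a) j"
        have "?a * f (s 0) (\<lambda>i. s ST (ls i)) \<le> (2 ^ t (s 0)) ^ j * 2 ^ t (s 0)"
          using Suc t(2)[OF s(1)] by (intro mult_le_mono) auto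
        moreover have "?a * 1 \<le> (2 ^ t (s 0)) ^ j * 2 ^ t (s 0)" using Suc by (intro mult_le_mono) auto
        ultimately show ?case by (simp add: mult.commute)
      qed simp
      also have "\<dots> = 2 ^ (j * t (s 0))" by (simp add: power_mult[symmetric] mult.commute)
      also have "\<dots> < 2 ^ Suc (N (s 0) * t (s 0))" using s(2) by (intro power_strict_increasing) (auto simp: less_Suc_eq_le)
      finally show "rec_nat 1 (\<lambda>i a. if i < g (s 0) (\<lambda>i. s ST (ls i)) then a * f (s 0) (\<lambda>i. s ST (ls i)) else a) j < 2 ^ Suc (N (s 0) * t (s 0))" .
    qed
  qed
  fix I e assume "I \<in> V"
  have *: "rec_nat 1 (\<lambda>i a. if i < g I e then a * f I e else a) n = f I e ^ min n (g I e)" for n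
    by (induction n) (auto simp: min_def not_less_eq_eq le_Suc_eq mult.commute)
  show "rec_nat 1 (\<lambda>i a. if i < g I e then a * f I e else a) (N I) = f I e ^ g I e"
    unfolding * using N(3)[OF \<open>I \<in> V\<close>] by (simp add: min_absorb2)
qed

lemma PT_sz: "PT (\<lambda>I e. sz I ^ c)"
proof (induction c)
  case 0 show ?case using PT_const[of 1] by simp
next
  case (Suc c)
  have "PT (\<lambda>I e. sz I)" unfolding sz_def by (intro PT_add PT_input PT_const)
  then show ?case using PT_mult Suc by simp
qed

lemma PT_power: assumes "PT f" "PT g" "bd g" shows "PT (\<lambda>I e. f I e ^ g I e)"
proof -
  obtain u where u: "pol u" "\<And>I e. I \<in> V \<Longrightarrow> g I e \<le> u I" using bdE[OF assms(3)] by blast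
  then obtain c where c: "\<forall>I\<in>V. u I \<le> sz I ^ c" unfolding pol_def by blast
  show ?thesis
  proof (rule PT_power_le[OF assms(1,2) PT_sz pol_sz])
    show "g I e \<le> sz I ^ c" if "I \<in> V" for I e using u(2)[OF that, of e] c that by fastforce
  qed
qed

end

section \<open>Sparsification\<close>

text \<open>The inclusion-minimal clauses. For finite clauses, a set that meets all minimal ones
  meets all of them, so these are the clauses of the formula that count.\<close>

definition act :: "nat set set \<Rightarrow> nat set set" where
  "act F = {C \<in> F. \<forall>D\<in>F. D \<subseteq> C \<longrightarrow> D = C}"

definition deg :: "nat set set \<Rightarrow> nat \<Rightarrow> nat set \<Rightarrow> nat" where
  "deg F c H = card {C \<in> act F. card C = c \<and> H \<subseteq> C}"

definition petals :: "nat set set \<Rightarrow> nat \<Rightarrow> nat set \<Rightarrow> nat set set" where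
  "petals F c H = (\<lambda>C. C - H) ` {C \<in> act F. card C = c \<and> H \<subseteq> C}"

lemma act_subset: "act F \<subseteq> F"
  by (auto simp: act_def)

lemma finite_below_act:
  assumes "C \<in> F" "finite C"
  shows "\<exists>D\<in>act F. D \<subseteq> C"
  using assms(2,1)
proof (induction C rule: finite_psubset_induct)
  case (psubset C)
  show ?case
  proof (cases "C \<in> act F")
    case False
    then obtain D where "D \<in> F" "D \<subset> C" using psubset.prems by (auto simp: act_def)
    then show ?thesis using psubset.IH[of D] by auto
  qed auto
qed

text \<open>
  This is the sparsification of Impagliazzo, Paturi and Zane: a set \<open>H\<close> (the heart) that is
  contained in many clauses \<open>C\<close> of size \<open>c\<close> is either added as a clause, or all the petals
  \<open>C - H\<close>, of size \<open>s\<close>, are.  At most \<open>L * \<alpha> ^ (3 * s - 2)\<close>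
  clauses of size \<open>s\<close> are ever added, and each choice of petals of size \<open>s\<close> adds at least \<open>thr s\<close>
  of them, so there are at most \<open>L / \<alpha>\<close> such choices.
\<close>

locale sparse_params =
  fixes k L \<alpha> :: nat
begin

definition thr :: "nat \<Rightarrow> nat" where
  "thr s = \<alpha> ^ (3 * s - 1)"

definition flower :: "nat set set \<Rightarrow> nat \<Rightarrow> nat \<Rightarrow> nat set \<Rightarrow> bool" where
  "flower F c s H \<longleftrightarrow> 1 \<le> s \<and> s < c \<and> c \<le> k \<and> H \<subseteq> {..<L} \<and> card H + s = c \<and> thr s \<le> deg F c H"

text \<open>Least clause size comes first, then least petal size. All degrees belonging to earlier
  pairs are then below their thresholds, which keeps the degrees of added clauses under
  control.\<close>

definition first_flower :: "nat set set \<Rightarrow> nat \<Rightarrow> nat \<Rightarrow> nat set \<Rightarrow> bool" where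
  "first_flower F c s H \<longleftrightarrow> flower F c s H \<and>
     (\<forall>c' s' H'. flower F c' s' H' \<longrightarrow> c < c' \<or> (c = c' \<and> s \<le> s'))"

definition kfamily :: "nat set set \<Rightarrow> bool" where
  "kfamily F \<longleftrightarrow> F \<subseteq> {C. C \<subseteq> {..<L} \<and> card C \<le> k}"

text \<open>\<open>F0\<close> is the initial family and \<open>p s\<close> counts the choices of
  petals of size \<open>s\<close>. The third condition is a charging argument: an added clause of
  size \<open>c\<close> is either still minimal or was superseded by a smaller added clause
  \<open>h\<close>, and by the second condition each \<open>h\<close> can supersede only
  \<open>2 * thr (c - card h)\<close> of them.\<close>

definition Inv :: "nat set set \<Rightarrow> nat set set \<Rightarrow> (nat \<Rightarrow> nat) \<Rightarrow> bool" where
  "Inv F0 F p \<longleftrightarrow> kfamily F \<and> F0 \<subseteq> F \<and> {} \<notin> F - F0 \<and>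
     (\<forall>c h. h \<noteq> {} \<longrightarrow> h \<subseteq> {..<L} \<longrightarrow> card h < c \<longrightarrow>
        card {C \<in> act F - F0. card C = c \<and> h \<subseteq> C} \<le> 2 * thr (c - card h)) \<and>
     (\<forall>c. card {C \<in> F - F0. card C = c} \<le>
        card {C \<in> act F - F0. card C = c} + (\<Sum>h\<in>{h \<in> F - F0. card h < c}. 2 * thr (c - card h))) \<and>
     (\<forall>s. thr s * p s \<le> card {C \<in> F - F0. card C = s})"

end

locale sparsification = sparse_params +
  assumes \<alpha>: "2 * k + 2 \<le> \<alpha>"
begin

lemma \<alpha>_pos: "0 < \<alpha>"
  using \<alpha> by simp

lemma thr_pos: "0 < thr s"
  by (simp add: thr_def \<alpha>_pos)

lemma finite_kfamily: "kfamily F \<Longrightarrow> finite F"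
  by (rule finite_subset[of _ "Pow {..<L}"]) (auto simp: kfamily_def)

lemma kfamily_finite: "kfamily F \<Longrightarrow> C \<in> F \<Longrightarrow> finite C"
  unfolding kfamily_def by (auto intro: finite_subset[of _ "{..<L}"])

lemma Inv_init: "kfamily F \<Longrightarrow> Inv F F (\<lambda>_. 0)"
proof -
  assume "kfamily F"
  moreover have e: "act F - F = {}" using act_subset by blast
  ultimately show ?thesis unfolding Inv_def e Diff_cancel by simp
qed

lemma Inv_deg:
  assumes "Inv F0 F p" "h \<noteq> {}" "h \<subseteq> {..<L}" "card h < c"
  shows "card {C \<in> act F - F0. card C = c \<and> h \<subseteq> C} \<le> 2 * thr (c - card h)"
  using assms unfolding Inv_def by blast

lemma Inv_add:
  assumes inv: "Inv F0 F p"
    and P: "\<And>X. X \<in> P \<Longrightarrow> X \<subseteq> {..<L} \<and> card X = d" "1 \<le> d" "d \<le> k"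
    and new: "\<And>X D. X \<in> P \<Longrightarrow> D \<in> F \<Longrightarrow> \<not> D \<subseteq> X"
    and degP: "\<And>h. h \<noteq> {} \<Longrightarrow> h \<subseteq> {..<L} \<Longrightarrow> card h < d \<Longrightarrow>
       deg F d h + card {X \<in> P. h \<subseteq> X} \<le> 2 * thr (d - card h)"
    and p': "\<And>s. thr s * p' s \<le> thr s * p s + (if s = d then card P else 0)"
  shows "Inv F0 (F \<union> P) p'"
proof -
  have kF: "kfamily F" "F0 \<subseteq> F" "{} \<notin> F - F0" using inv by (auto simp: Inv_def)
  have inv2: "card {C \<in> act F - F0. card C = c \<and> h \<subseteq> C} \<le> 2 * thr (c - card h)"
    if "h \<noteq> {}" "h \<subseteq> {..<L}" "card h < c" for c h by (rule Inv_deg[OF inv that])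
  have inv3: "card {C \<in> F - F0. card C = c} \<le>
        card {C \<in> act F - F0. card C = c} + (\<Sum>h\<in>{h \<in> F - F0. card h < c}. 2 * thr (c - card h))" for c
    using inv by (auto simp: Inv_def)
  have inv4: "thr s * p s \<le> card {C \<in> F - F0. card C = s}" for s using inv by (auto simp: Inv_def)
  have finP: "finite P" by (rule finite_subset[of _ "Pow {..<L}"]) (use P in auto)
  have finF: "finite F" using finite_kfamily kF by blast
  have fC: "finite C" if "C \<in> F \<union> P" for C
  proof -
    have "C \<subseteq> {..<L}" using kF(1) P(1) that unfolding kfamily_def by blast
    then show ?thesis using finite_subset by blast
  qed
  have PF: "P \<inter> F = {}" using new by blast
  have a1: "act (F \<union> P) \<subseteq> act F \<union> P" by (auto simp: act_def)
  have a2: "C \<in> act (F \<union> P)" if "C \<in> act F" "\<And>X. X \<in> P \<Longrightarrow> \<not> X \<subseteq> C" for C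
    using that by (auto simp: act_def)
  \<comment> \<open>Sets of equal size cannot contain each other properly, so all new sets are
    minimal.\<close>
  have a3: "P \<subseteq> act (F \<union> P)"
  proof
    fix X assume X: "X \<in> P"
    have "D = X" if "D \<in> F \<union> P" "D \<subseteq> X" for D
    proof -
      have "D \<in> P" using that new X by blast
      then have "card D = card X" using P X by simp
      then show ?thesis using card_subset_eq[of X D] fC X that by blast
    qed
    then show "X \<in> act (F \<union> P)" using X by (auto simp: act_def)
  qed
  have diff: "F \<union> P - F0 = (F - F0) \<union> P" using PF kF by blast
  have fin: "finite {C \<in> A. Q C}" if "A \<subseteq> F \<union> P" for A Q
    by (rule finite_subset[of _ "F \<union> P"]) (use that finF finP in auto)
  have actFP: "act (F \<union> P) - F0 \<subseteq> F \<union> P" "act F - F0 \<subseteq> F \<union> P" using act_subset by blast+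
  have "X \<in> {C. C \<subseteq> {..<L} \<and> card C \<le> k}" if "X \<in> P" for X using P(1)[OF that] P(3) by simp
  then have k': "kfamily (F \<union> P)" using kF(1) unfolding kfamily_def by blast
  have e': "{} \<notin> F \<union> P - F0"
    unfolding diff using kF P by fastforce
  have two: "card {C \<in> act (F \<union> P) - F0. card C = c \<and> h \<subseteq> C} \<le> 2 * thr (c - card h)"
    if h: "h \<noteq> {}" "h \<subseteq> {..<L}" "card h < c" for c h
  proof (cases "c = d")
    case False
    have "{C \<in> act (F \<union> P) - F0. card C = c \<and> h \<subseteq> C} \<subseteq> {C \<in> act F - F0. card C = c \<and> h \<subseteq> C}"
      using a1 P False by blast
    then have "card {C \<in> act (F \<union> P) - F0. card C = c \<and> h \<subseteq> C} \<le> card {C \<in> act F - F0. card C = c \<and> h \<subseteq> C}"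
      by (intro card_mono fin) (use actFP in auto)
    then show ?thesis using inv2[OF h] by linarith
  next
    case True
    have "{C \<in> act (F \<union> P) - F0. card C = c \<and> h \<subseteq> C} \<subseteq> {C \<in> act F. card C = d \<and> h \<subseteq> C} \<union> {X \<in> P. h \<subseteq> X}"
      using a1 True by blast
    then have "card {C \<in> act (F \<union> P) - F0. card C = c \<and> h \<subseteq> C} \<le>
       card ({C \<in> act F. card C = d \<and> h \<subseteq> C} \<union> {X \<in> P. h \<subseteq> X})"
      by (intro card_mono finite_UnI fin) (use act_subset in auto)
    also have "\<dots> \<le> deg F d h + card {X \<in> P. h \<subseteq> X}" unfolding deg_def by (rule card_Un_le)
    also have "\<dots> \<le> 2 * thr (c - card h)" using degP h True by simp
    finally show ?thesis .
  qed
  have three: "card {C \<in> F \<union> P - F0. card C = c} \<le>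
        card {C \<in> act (F \<union> P) - F0. card C = c} + (\<Sum>h\<in>{h \<in> F \<union> P - F0. card h < c}. 2 * thr (c - card h))" for c
  proof -
    let ?S = "\<Sum>h\<in>{h \<in> F - F0. card h < c}. 2 * thr (c - card h)"
    let ?S' = "\<Sum>h\<in>{h \<in> F \<union> P - F0. card h < c}. 2 * thr (c - card h)"
    have SS: "?S \<le> ?S'" by (rule sum_mono2) (use fin[of "F \<union> P - F0"] in auto)
    \<comment> \<open>Below size \<open>d\<close> no clause loses minimality; at size
      \<open>d\<close> exactly the sets of \<open>P\<close> are gained, all of them minimal; above
      it, a clause that loses minimality contains a member of \<open>P\<close> and is charged to
      it.\<close>
    consider "c < d" | "c = d" | "d < c" by linarith
    then show ?thesis
    proof cases
      case 1
      have "{C \<in> F \<union> P - F0. card C = c} = {C \<in> F - F0. card C = c}" using P 1 by fastforce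
      moreover have "{C \<in> act F - F0. card C = c} \<subseteq> {C \<in> act (F \<union> P) - F0. card C = c}"
      proof (intro subsetI, elim CollectE conjE DiffE, intro CollectI conjI DiffI)
        fix C assume C: "C \<in> act F" "card C = c"
        show "C \<in> act (F \<union> P)"
        proof (rule a2[OF C(1)])
          fix X assume "X \<in> P"
          then show "\<not> X \<subseteq> C" using card_mono[of C X] fC C 1 P act_subset
            by (metis UnI1 leD subsetD)
        qed
      qed
      then have "card {C \<in> act F - F0. card C = c} \<le> card {C \<in> act (F \<union> P) - F0. card C = c}"
        by (intro card_mono fin actFP)
      ultimately show ?thesis using inv3[of c] SS by simp
    next
      case 2
      have "{C \<in> F \<union> P - F0. card C = c} = {C \<in> F - F0. card C = c} \<union> P" using P 2 diff by auto
      then have "card {C \<in> F \<union> P - F0. card C = c} \<le> card {C \<in> F - F0. card C = c} + card P"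
        by (metis card_Un_le)
      moreover have "{C \<in> act F - F0. card C = c} \<union> P \<subseteq> {C \<in> act (F \<union> P) - F0. card C = c}"
      proof -
        have "C \<in> act (F \<union> P)" if C: "C \<in> act F" "card C = c" for C
        proof (rule a2[OF C(1)])
          fix X assume X: "X \<in> P"
          have CF: "C \<in> F" using C act_subset by blast
          show "\<not> X \<subseteq> C"
          proof
            assume "X \<subseteq> C"
            then have "X = C" using card_subset_eq[of C X] fC CF X P C 2 by auto
            then show False using X CF PF by blast
          qed
        qed
        then show ?thesis using a3 P 2 PF kF by auto
      qed
      then have "card ({C \<in> act F - F0. card C = c} \<union> P) \<le> card {C \<in> act (F \<union> P) - F0. card C = c}"
        by (intro card_mono fin actFP)
      moreover have "card ({C \<in> act F - F0. card C = c} \<union> P) = card {C \<in> act F - F0. card C = c} + card P"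
      proof (rule card_Un_disjoint)
        show "finite {C \<in> act F - F0. card C = c}" by (rule fin[OF actFP(2)])
        show "{C \<in> act F - F0. card C = c} \<inter> P = {}" using PF act_subset[of F] by blast
      qed (rule finP)
      ultimately show ?thesis using inv3[of c] SS by linarith
    next
      case 3
      have E: "{C \<in> F \<union> P - F0. card C = c} = {C \<in> F - F0. card C = c}" using P 3 by fastforce
      have "{C \<in> act F - F0. card C = c} \<subseteq> {C \<in> act (F \<union> P) - F0. card C = c} \<union>
          (\<Union>X\<in>P. {C \<in> act F - F0. card C = c \<and> X \<subseteq> C})" using a2 by blast
      then have "card {C \<in> act F - F0. card C = c} \<le> card ({C \<in> act (F \<union> P) - F0. card C = c} \<union>
          (\<Union>X\<in>P. {C \<in> act F - F0. card C = c \<and> X \<subseteq> C}))"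
        by (intro card_mono finite_UnI fin finite_UN_I finP actFP)
      also have "\<dots> \<le> card {C \<in> act (F \<union> P) - F0. card C = c} +
          card (\<Union>X\<in>P. {C \<in> act F - F0. card C = c \<and> X \<subseteq> C})" by (rule card_Un_le)
      also have "card (\<Union>X\<in>P. {C \<in> act F - F0. card C = c \<and> X \<subseteq> C}) \<le>
          (\<Sum>X\<in>P. card {C \<in> act F - F0. card C = c \<and> X \<subseteq> C})" by (rule card_UN_le[OF finP])
      also have "\<dots> \<le> (\<Sum>X\<in>P. 2 * thr (c - card X))"
      proof (rule sum_mono)
        fix X assume "X \<in> P"
        from P(1)[OF this] have "X \<noteq> {}" "X \<subseteq> {..<L}" "card X < c" using P(2) 3 by auto
        then show "card {C \<in> act F - F0. card C = c \<and> X \<subseteq> C} \<le> 2 * thr (c - card X)" by (rule inv2)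
      qed
      finally have A: "card {C \<in> act F - F0. card C = c} \<le> card {C \<in> act (F \<union> P) - F0. card C = c} +
          (\<Sum>X\<in>P. 2 * thr (c - card X))" by simp
      have e: "{h \<in> F \<union> P - F0. card h < c} = {h \<in> F - F0. card h < c} \<union> P" using P 3 diff by auto
      have S: "?S' = ?S + (\<Sum>X\<in>P. 2 * thr (c - card X))"
        unfolding e
      proof (rule sum.union_disjoint)
        show "finite {h \<in> F - F0. card h < c}" by (rule fin) auto
        show "{h \<in> F - F0. card h < c} \<inter> P = {}" using PF by blast
      qed (rule finP)
      show ?thesis unfolding E S using inv3[of c] A by linarith
    qed
  qed
  have four: "thr s * p' s \<le> card {C \<in> F \<union> P - F0. card C = s}" for s
  proof (cases "s = d")
    case True
    have "{C \<in> F \<union> P - F0. card C = s} = {C \<in> F - F0. card C = s} \<union> P" using P True diff by auto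
    moreover have "card ({C \<in> F - F0. card C = s} \<union> P) = card {C \<in> F - F0. card C = s} + card P"
    proof (rule card_Un_disjoint)
      show "finite {C \<in> F - F0. card C = s}" by (rule fin) auto
      show "{C \<in> F - F0. card C = s} \<inter> P = {}" using PF by blast
    qed (rule finP)
    ultimately show ?thesis using p'[of s] inv4[of s] True by simp
  next
    case False
    have "card {C \<in> F - F0. card C = s} \<le> card {C \<in> F \<union> P - F0. card C = s}"
      by (intro card_mono fin) auto
    moreover have "thr s * p' s \<le> thr s * p s" using p'[of s] False by simp
    ultimately show ?thesis using inv4[of s] by linarith
  qed
  show ?thesis unfolding Inv_def
    using k' e' two three four kF(2) by auto
qed

lemma flowerD:
  assumes "flower F c s H"
  shows "1 \<le> s" "s < c" "c \<le> k" "H \<subseteq> {..<L}" "card H = c - s" "H \<noteq> {}" "thr s \<le> deg F c H"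
    "\<exists>C\<in>act F. card C = c \<and> H \<subset> C"
proof -
  show *: "1 \<le> s" "s < c" "c \<le> k" "H \<subseteq> {..<L}" "card H = c - s" "thr s \<le> deg F c H"
    using assms by (auto simp: flower_def)
  show "H \<noteq> {}" using * by auto
  have "{C \<in> act F. card C = c \<and> H \<subseteq> C} \<noteq> {}"
    using *(6) thr_pos[of s] unfolding deg_def by (metis card.empty leD)
  then show "\<exists>C\<in>act F. card C = c \<and> H \<subset> C" using * by auto
qed

text \<open>Otherwise \<open>h\<close> would be the heart of an earlier flower.\<close>

lemma deg_less_first:
  assumes "first_flower F c s H" "h \<noteq> {}" "h \<subseteq> {..<L}" "card h < c'"
    and "c' < c \<or> (c' = c \<and> c' - card h < s)"
  shows "deg F c' h < thr (c' - card h)"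
proof (rule ccontr)
  assume "\<not> deg F c' h < thr (c' - card h)"
  moreover have "finite h" using assms(3) finite_subset by blast
  then have "0 < card h" using assms(2) by (simp add: card_gt_0_iff)
  moreover have "c \<le> k" using assms(1) flowerD by (auto simp: first_flower_def)
  ultimately have "flower F c' (c' - card h) h" using assms by (auto simp: flower_def)
  then have "c < c' \<or> (c = c' \<and> s \<le> c' - card h)"
    using assms(1) unfolding first_flower_def by blast
  then show False using assms(5) by auto
qed

text \<open>The heart has size \<open>c - s\<close>, smaller than \<open>c\<close>, so all degrees
  for this size are still below the threshold and one more clause does no harm.\<close>

lemma Inv_heart:
  assumes inv: "Inv F0 F p" and fl: "first_flower F c s H"
  shows "Inv F0 (F \<union> {H}) p" "H \<notin> F"
proof -
  have f: "flower F c s H" using fl by (simp add: first_flower_def)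
  note H = flowerD[OF f]
  obtain C where C: "C \<in> act F" "H \<subset> C" using H(8) by blast
  have new: "\<not> D \<subseteq> H" if "D \<in> F" for D using C that by (auto simp: act_def)
  then show "H \<notin> F" by blast
  show "Inv F0 (F \<union> {H}) p"
  proof (rule Inv_add[OF inv, where d = "c - s"])
    fix h assume h: "h \<noteq> {}" "h \<subseteq> {..<L}" "card h < c - s"
    have "deg F (c - s) h < thr (c - s - card h)"
      by (rule deg_less_first[OF fl h]) (use H in auto)
    moreover have "card {X \<in> {H}. h \<subseteq> X} \<le> card {H}" by (rule card_mono) auto
    ultimately show "deg F (c - s) h + card {X \<in> {H}. h \<subseteq> X} \<le> 2 * thr (c - s - card h)" by simp
  qed (use H new in auto)
qed

text \<open>Petals that contain \<open>h\<close> stem from clauses of size \<open>c\<close>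
  containing \<open>H \<union> h\<close>. As many as \<open>thr (s - card h)\<close> of those would
  form a flower with shorter petals. The clauses of size \<open>s\<close> already present contribute
  less than another threshold, which explains the factor 2 in \<open>Inv\<close>.\<close>

lemma Inv_petals:
  assumes inv: "Inv F0 F p" and fl: "first_flower F c s H"
  shows "Inv F0 (F \<union> petals F c H) (p(s := Suc (p s)))" "petals F c H \<inter> F = {}" "petals F c H \<noteq> {}"
proof -
  have f: "flower F c s H" using fl by (simp add: first_flower_def)
  note H = flowerD[OF f]
  have kF: "kfamily F" using inv by (simp add: Inv_def)
  let ?A = "{C \<in> act F. card C = c \<and> H \<subseteq> C}"
  have inj: "inj_on (\<lambda>C. C - H) ?A" by (auto simp: inj_on_def)
  then have cardP: "card (petals F c H) = deg F c H"
    unfolding petals_def deg_def by (rule card_image)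
  then show "petals F c H \<noteq> {}" using H(7) thr_pos[of s] by auto
  have PX: "X \<subseteq> {..<L} \<and> card X = s" if X: "X \<in> petals F c H" for X
  proof -
    obtain C where C: "C \<in> act F" "card C = c" "H \<subseteq> C" "X = C - H" using X by (auto simp: petals_def)
    have "C \<in> F" using C act_subset by blast
    then have "C \<subseteq> {..<L}" "finite C" using kF kfamily_finite by (auto simp: kfamily_def)
    moreover have "finite H" using H(4) finite_subset by blast
    ultimately show ?thesis using C H card_Diff_subset[of H C] by auto
  qed
  have new: "\<not> D \<subseteq> X" if X: "X \<in> petals F c H" and D: "D \<in> F" for X D
  proof
    assume "D \<subseteq> X"
    moreover obtain C where C: "C \<in> act F" "H \<subseteq> C" "X = C - H" using X by (auto simp: petals_def)
    ultimately have "D = C" using D by (auto simp: act_def)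
    then show False using \<open>D \<subseteq> X\<close> C H(6) by blast
  qed
  then show "petals F c H \<inter> F = {}" by blast
  show "Inv F0 (F \<union> petals F c H) (p(s := Suc (p s)))"
  proof (rule Inv_add[OF inv PX H(1)])
    show "s \<le> k" using H by simp
    show "thr i * (p(s := Suc (p s))) i \<le> thr i * p i + (if i = s then card (petals F c H) else 0)" for i
      using H(7) cardP by simp
    fix h assume h: "h \<noteq> {}" "h \<subseteq> {..<L}" "card h < s"
    have d1: "deg F s h < thr (s - card h)"
      by (rule deg_less_first[OF fl h]) (use H in auto)
    have "card {X \<in> petals F c H. h \<subseteq> X} \<le> thr (s - card h)"
    proof (cases "h \<inter> H = {}")
      case False
      then have e: "{X \<in> petals F c H. h \<subseteq> X} = {}" by (auto simp: petals_def)
      show ?thesis unfolding e by simp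
    next
      case True
      have fin: "finite h" "finite H" using h H finite_subset by blast+
      have hpos: "0 < card h" using fin h by (simp add: card_gt_0_iff)
      have ch: "card (H \<union> h) = card H + card h" using True fin by (intro card_Un_disjoint) auto
      have "{X \<in> petals F c H. h \<subseteq> X} \<subseteq> (\<lambda>C. C - H) ` {C \<in> act F. card C = c \<and> H \<union> h \<subseteq> C}"
        by (auto simp: petals_def)
      then have "card {X \<in> petals F c H. h \<subseteq> X} \<le> deg F c (H \<union> h)"
        unfolding deg_def
        by (rule surj_card_le[rotated]) (rule finite_subset[of _ F], use finite_kfamily[OF kF] act_subset in auto)
      also have "\<dots> < thr (c - card (H \<union> h))"
        by (rule deg_less_first[OF fl]) (use h H ch hpos in auto)
      also have "c - card (H \<union> h) = s - card h" using ch H by simp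
      finally show ?thesis by simp
    qed
    then show "deg F s h + card {X \<in> petals F c H. h \<subseteq> X} \<le> 2 * thr (s - card h)" using d1 by simp
  qed (use new in auto)
qed

lemma card_cover_le:
  assumes "\<And>C. C \<in> A \<Longrightarrow> finite C \<and> C \<noteq> {} \<and> C \<subseteq> {..<L}" "\<And>x. x < L \<Longrightarrow> card {C \<in> A. {x} \<subseteq> C} \<le> b"
    "finite A"
  shows "card A \<le> L * b"
proof -
  have "A \<subseteq> (\<Union>x\<in>{..<L}. {C \<in> A. {x} \<subseteq> C})" using assms(1) by fastforce
  then have "card A \<le> card (\<Union>x\<in>{..<L}. {C \<in> A. {x} \<subseteq> C})"
    by (intro card_mono finite_UN_I) (use assms(3) in auto)
  also have "\<dots> \<le> (\<Sum>x<L. card {C \<in> A. {x} \<subseteq> C})" by (rule card_UN_le) simp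
  also have "\<dots> \<le> (\<Sum>x<L. b)" by (rule sum_mono) (use assms in auto)
  finally show ?thesis by simp
qed

text \<open>The exponents \<open>3 * j - 2\<close>, for the added clauses of size \<open>j\<close>,
  and \<open>3 * (c - j) - 1\<close>, for those that each of them supersedes, sum to
  \<open>3 * c - 3\<close> whatever \<open>j\<close> is. So every size contributes the same amount,
  and \<open>\<alpha> \<ge> 2 * k + 2\<close> absorbs the \<open>k + 1\<close> contributions into
  one further factor \<open>\<alpha>\<close>.\<close>

lemma added_le:
  assumes inv: "Inv F0 F p"
  shows "1 \<le> c \<Longrightarrow> card {C \<in> F - F0. card C = c} \<le> L * \<alpha> ^ (3 * c - 2)"
proof (induction c rule: less_induct)
  case (less c)
  have kF: "kfamily F" "{} \<notin> F - F0" using inv by (auto simp: Inv_def)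
  have finF: "finite F" using finite_kfamily kF by blast
  have finA: "finite {C \<in> A. Q C}" if "A \<subseteq> F" for A Q
    by (rule finite_subset[of _ F]) (use that finF in auto)
  have sub: "C \<subseteq> {..<L}" "finite C" if "C \<in> F" for C using kF kfamily_finite that by (auto simp: kfamily_def)
  show ?case
  proof (cases "c = 1")
    case True
    have "card {C \<in> F - F0. card C = c} \<le> L * 1"
    proof (rule card_cover_le)
      fix x
      have "{C \<in> {C \<in> F - F0. card C = c}. {x} \<subseteq> C} \<subseteq> {{x}}" using True by (auto simp: card_1_singleton_iff)
      then have "card {C \<in> {C \<in> F - F0. card C = c}. {x} \<subseteq> C} \<le> card {{x}}" by (intro card_mono) auto
      then show "card {C \<in> {C \<in> F - F0. card C = c}. {x} \<subseteq> C} \<le> 1" by simp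
    qed (use sub finA True in auto)
    also have "\<dots> \<le> L * \<alpha> ^ (3 * c - 2)" using \<alpha>_pos by (intro mult_le_mono2) simp
    finally show ?thesis .
  next
    case False
    then have c: "2 \<le> c" using less.prems by simp
    show ?thesis
    proof (cases "c \<le> k")
      case False
      then have e: "{C \<in> F - F0. card C = c} = {}" using kF by (auto simp: kfamily_def)
      show ?thesis unfolding e by simp
    next
      case ck: True
    have "card {C \<in> act F - F0. card C = c} \<le> L * (2 * thr (c - 1))"
    proof (rule card_cover_le)
      fix x assume "x < L"
      then have "card {C \<in> act F - F0. card C = c \<and> {x} \<subseteq> C} \<le> 2 * thr (c - card {x})"
        using c by (intro Inv_deg[OF inv]) auto
      moreover have "{C \<in> {C \<in> act F - F0. card C = c}. {x} \<subseteq> C} = {C \<in> act F - F0. card C = c \<and> {x} \<subseteq> C}" by auto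
      ultimately show "card {C \<in> {C \<in> act F - F0. card C = c}. {x} \<subseteq> C} \<le> 2 * thr (c - 1)" by simp
    next
      show "finite {C \<in> act F - F0. card C = c}" by (rule finA) (use act_subset in auto)
      fix C assume C: "C \<in> {C \<in> act F - F0. card C = c}"
      then have "C \<in> F" using act_subset by blast
      then show "finite C \<and> C \<noteq> {} \<and> C \<subseteq> {..<L}" using sub C c by auto
    qed
    also have "\<dots> \<le> L * (2 * \<alpha> ^ (3 * c - 3))"
      unfolding thr_def using \<alpha>_pos by (intro mult_le_mono2 power_increasing) auto
    finally have one: "card {C \<in> act F - F0. card C = c} \<le> L * (2 * \<alpha> ^ (3 * c - 3))" .
    have "{h \<in> F - F0. card h < c} = (\<Union>j\<in>{1..<c}. {h \<in> F - F0. card h = j})"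
    proof -
      have "1 \<le> card h" if "h \<in> F - F0" for h
        using that kF sub[of h] by (metis DiffD1 One_nat_def Suc_leI card_gt_0_iff)
      then show ?thesis by auto
    qed
    then have "(\<Sum>h\<in>{h \<in> F - F0. card h < c}. 2 * thr (c - card h)) =
        (\<Sum>j\<in>{1..<c}. \<Sum>h\<in>{h \<in> F - F0. card h = j}. 2 * thr (c - card h))"
      by (simp only:) (rule sum.UNION_disjoint, use finA in auto)
    also have "\<dots> \<le> (\<Sum>j\<in>{1..<c}. 2 * L * \<alpha> ^ (3 * c - 3))"
    proof (rule sum_mono)
      fix j assume j: "j \<in> {1..<c}"
      have "(\<Sum>h\<in>{h \<in> F - F0. card h = j}. 2 * thr (c - card h)) = (\<Sum>h\<in>{h \<in> F - F0. card h = j}. 2 * thr (c - j))"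
        by (rule sum.cong) auto
      also have "\<dots> = card {h \<in> F - F0. card h = j} * (2 * thr (c - j))" by simp
      also have "\<dots> \<le> (L * \<alpha> ^ (3 * j - 2)) * (2 * thr (c - j))"
        by (rule mult_le_mono1, rule less.IH) (use j in auto)
      also have "\<dots> = 2 * L * \<alpha> ^ ((3 * j - 2) + (3 * (c - j) - 1))"
        by (simp add: thr_def power_add)
      also have "(3 * j - 2) + (3 * (c - j) - 1) = 3 * c - 3" using j by auto
      finally show "(\<Sum>h\<in>{h \<in> F - F0. card h = j}. 2 * thr (c - card h)) \<le> 2 * L * \<alpha> ^ (3 * c - 3)" .
    qed
    also have "\<dots> \<le> k * (2 * L * \<alpha> ^ (3 * c - 3))"
      unfolding sum_constant of_nat_id by (rule mult_le_mono1) (use ck in simp)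
    finally have "card {C \<in> F - F0. card C = c} \<le> L * (2 * \<alpha> ^ (3 * c - 3)) + k * (2 * L * \<alpha> ^ (3 * c - 3))"
      using one inv unfolding Inv_def by (meson add_mono le_trans)
    also have "\<dots> = L * ((2 * k + 2) * \<alpha> ^ (3 * c - 3))" by (simp add: algebra_simps)
    also have "\<dots> \<le> L * (\<alpha> * \<alpha> ^ (3 * c - 3))" using \<alpha> by (intro mult_le_mono2 mult_le_mono1)
    also have "\<alpha> * \<alpha> ^ (3 * c - 3) = \<alpha> ^ (3 * c - 2)"
      unfolding power_Suc[symmetric] by (rule arg_cong[of _ _ "power \<alpha>"]) (use c in simp)
    finally show ?thesis .
    qed
  qed
qed

lemma petal_steps_le:
  assumes inv: "Inv F0 F p" and "1 \<le> s"
  shows "\<alpha> * p s \<le> L"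
proof -
  have "thr s * p s \<le> L * \<alpha> ^ (3 * s - 2)"
    using inv added_le[OF inv assms(2)] unfolding Inv_def by (meson le_trans)
  moreover have "thr s = \<alpha> * \<alpha> ^ (3 * s - 2)"
    using assms(2) unfolding thr_def power_Suc[symmetric] by (intro arg_cong[of _ _ "power \<alpha>"]) simp
  ultimately show ?thesis using \<alpha>_pos by (simp add: mult.assoc mult.commute mult.left_commute)
qed

text \<open>Applied to hearts with a single element, the absence of flowers bounds the number of
  minimal clauses through each of the \<open>L\<close> literals.\<close>

lemma card_act_le:
  assumes kF: "kfamily F" and no: "\<And>c s H. \<not> flower F c s H" and "1 \<le> L"
  shows "card (act F) \<le> (k + 1) * (L * \<alpha> ^ (3 * k))"
proof -
  have finF: "finite F" using finite_kfamily kF by blast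
  have finA: "finite {C \<in> act F. Q C}" for Q
    by (rule finite_subset[of _ F]) (use finF act_subset in auto)
  have sub: "C \<subseteq> {..<L}" "finite C" "card C \<le> k" if "C \<in> act F" for C
  proof -
    have "C \<in> F" using that act_subset by blast
    then show "C \<subseteq> {..<L}" "finite C" "card C \<le> k" using kF kfamily_finite by (auto simp: kfamily_def)
  qed
  have "card {C \<in> act F. card C = c} \<le> L * \<alpha> ^ (3 * k)" if c: "c \<le> k" for c
  proof -
    consider "c = 0" | "c = 1" | "2 \<le> c" by linarith
    then show ?thesis
    proof cases
      case 1
      have "{C \<in> act F. card C = c} \<subseteq> {{}}" using 1 sub by auto
      then have "card {C \<in> act F. card C = c} \<le> card {{}::nat set}" by (intro card_mono) auto
      also have "\<dots> \<le> L * \<alpha> ^ (3 * k)" using \<alpha>_pos assms(3) by (simp add: Suc_leI)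
      finally show ?thesis .
    next
      case 2
      have "card {C \<in> act F. card C = c} \<le> L * 1"
      proof (rule card_cover_le)
        fix x
        have "{C \<in> {C \<in> act F. card C = c}. {x} \<subseteq> C} \<subseteq> {{x}}" using 2 by (auto simp: card_1_singleton_iff)
        then have "card {C \<in> {C \<in> act F. card C = c}. {x} \<subseteq> C} \<le> card {{x}}" by (intro card_mono) auto
        then show "card {C \<in> {C \<in> act F. card C = c}. {x} \<subseteq> C} \<le> 1" by simp
      qed (use sub finA 2 in auto)
      also have "\<dots> \<le> L * \<alpha> ^ (3 * k)" using \<alpha>_pos by (intro mult_le_mono2) simp
      finally show ?thesis .
    next
      case 3
      have "card {C \<in> act F. card C = c} \<le> L * \<alpha> ^ (3 * k)"
      proof (rule card_cover_le)
        fix x assume x: "x < L"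
        have "deg F c {x} < thr (c - 1)"
        proof (rule ccontr)
          assume "\<not> deg F c {x} < thr (c - 1)"
          then have "flower F c (c - 1) {x}" using 3 c x by (auto simp: flower_def)
          then show False using no by blast
        qed
        also have "thr (c - 1) \<le> \<alpha> ^ (3 * k)" unfolding thr_def using \<alpha>_pos c by (intro power_increasing) auto
        also have "deg F c {x} = card {C \<in> {C \<in> act F. card C = c}. {x} \<subseteq> C}" unfolding deg_def by (rule arg_cong[of _ _ card]) auto
        finally show "card {C \<in> {C \<in> act F. card C = c}. {x} \<subseteq> C} \<le> \<alpha> ^ (3 * k)" by simp
      qed (use sub finA 3 in auto)
      then show ?thesis .
    qed
  qed
  then have "(\<Sum>c\<in>{..k}. card {C \<in> act F. card C = c}) \<le> (\<Sum>c\<in>{..k}. L * \<alpha> ^ (3 * k))"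
    by (intro sum_mono) auto
  then have "(\<Sum>c\<in>{..k}. card {C \<in> act F. card C = c}) \<le> (k + 1) * (L * \<alpha> ^ (3 * k))" by simp
  moreover have e: "(\<Union>c\<in>{..k}. {C \<in> act F. card C = c}) = act F" using sub by auto
  have "card (act F) \<le> (\<Sum>c\<in>{..k}. card {C \<in> act F. card C = c})"
    using card_UN_le[of "{..k}" "\<lambda>c. {C \<in> act F. card C = c}"] unfolding e by simp
  ultimately show ?thesis by linarith
qed

end

section \<open>Sequences coded by digits\<close>

definition dg :: "nat \<Rightarrow> nat \<Rightarrow> nat \<Rightarrow> nat" where
  "dg B i x = x div B ^ i mod B"

lemma dg_0: "dg B 0 x = x mod B"
  by (simp add: dg_def)

lemma dg_Suc: "dg B (Suc i) x = dg B i (x div B)"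
  by (simp add: dg_def div_mult2_eq)

lemma dg_less: "0 < B \<Longrightarrow> dg B i x < B"
  by (simp add: dg_def)

lemma dg_exists:
  assumes "\<And>i. i < r \<Longrightarrow> f i < B"
  shows "\<exists>x<B ^ r. \<forall>i<r. dg B i x = f i"
  using assms
proof (induction r arbitrary: f)
  case (Suc r)
  have "\<And>i. i < r \<Longrightarrow> (f \<circ> Suc) i < B" using Suc.prems by simp
  then obtain x where x: "x < B ^ r" "\<forall>i<r. dg B i x = (f \<circ> Suc) i" using Suc.IH[of "f \<circ> Suc"] by blast
  have f0: "f 0 < B" using Suc.prems by simp
  have "f 0 + B * x < B + B * x" using f0 by simp
  also have "\<dots> = B * Suc x" by simp
  also have "\<dots> \<le> B * B ^ r" using x(1) by (intro mult_le_mono2) simp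
  finally have "f 0 + B * x < B ^ Suc r" by simp
  moreover have "dg B i (f 0 + B * x) = f i" if "i < Suc r" for i
    using that f0 x(2) by (cases i) (auto simp: dg_0 dg_Suc)
  ultimately show ?case by blast
qed simp

lemma dg_inj:
  "x < B ^ r \<Longrightarrow> y < B ^ r \<Longrightarrow> (\<And>i. i < r \<Longrightarrow> dg B i x = dg B i y) \<Longrightarrow> x = y"
proof (induction r arbitrary: x y)
  case (Suc r)
  have "x div B < B ^ r" "y div B < B ^ r"
    using Suc.prems(1,2) by (auto intro!: less_mult_imp_div_less simp: mult.commute)
  moreover have "dg B i (x div B) = dg B i (y div B)" if "i < r" for i
    using Suc.prems(3)[of "Suc i"] that by (simp add: dg_Suc)
  ultimately have "x div B = y div B" by (rule Suc.IH)
  moreover have "x mod B = y mod B" using Suc.prems(3)[of 0] by (simp add: dg_0)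
  ultimately show ?case by (metis mult_div_mod_eq)
qed simp

text \<open>The digits range independently over \<open>G\<close>; the repetition of the protocol
  thereby becomes a power of the number of accepted messages of one round.\<close>

lemma card_dg:
  assumes "G \<subseteq> {..<B}"
  shows "card {x. x < B ^ r \<and> (\<forall>i<r. dg B i x \<in> G)} = card G ^ r"
proof (induction r)
  case (Suc r)
  let ?S = "{x. x < B ^ r \<and> (\<forall>i<r. dg B i x \<in> G)}"
  have "bij_betw (\<lambda>(a, x). a + B * x) (G \<times> ?S) {x. x < B ^ Suc r \<and> (\<forall>i<Suc r. dg B i x \<in> G)}"
  proof (rule bij_betw_byWitness[where f' = "\<lambda>x. (x mod B, x div B)"])
    show "\<forall>p\<in>G \<times> ?S. ((case p of (a, x) \<Rightarrow> a + B * x) mod B, (case p of (a, x) \<Rightarrow> a + B * x) div B) = p"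
      using assms by auto
    show "(\<lambda>(a, x). a + B * x) ` (G \<times> ?S) \<subseteq> {x. x < B ^ Suc r \<and> (\<forall>i<Suc r. dg B i x \<in> G)}"
    proof (clarsimp, intro conjI allI impI)
      fix a x assume a: "a \<in> G" and x: "x < B ^ r" "\<forall>i<r. dg B i x \<in> G"
      have aB: "a < B" using a assms by auto
      have "a + B * x < B + B * x" using aB by simp
      also have "\<dots> = B * Suc x" by simp
      also have "\<dots> \<le> B * B ^ r" using x(1) by (intro mult_le_mono2) simp
      finally show "a + B * x < B * B ^ r" .
      fix i assume "i < Suc r"
      then show "dg B i (a + B * x) \<in> G" using aB a x by (cases i) (auto simp: dg_0 dg_Suc)
    qed
    show "(\<lambda>x. (x mod B, x div B)) ` {x. x < B ^ Suc r \<and> (\<forall>i<Suc r. dg B i x \<in> G)} \<subseteq> G \<times> ?S"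
    proof (clarsimp, intro conjI allI impI)
      fix x assume x: "x < B * B ^ r" "\<forall>i<Suc r. dg B i x \<in> G"
      show "x mod B \<in> G" using x(2)[rule_format, of 0] by (simp add: dg_0)
      show "x div B < B ^ r" using x(1) by (intro less_mult_imp_div_less) (simp add: mult.commute)
      fix i assume "i < r"
      then show "dg B i (x div B) \<in> G" using x(2)[rule_format, of "Suc i"] by (simp add: dg_Suc)
    qed
  qed auto
  then have "card {x. x < B ^ Suc r \<and> (\<forall>i<Suc r. dg B i x \<in> G)} = card (G \<times> ?S)"
    by (rule bij_betw_same_card[symmetric])
  also have "\<dots> = card G * card ?S" by (rule card_cartesian_product)
  finally show ?case using Suc.IH by simp
qed simp

text \<open>
  A clause is coded by \<open>k\<close> digits in base \<open>L + 1\<close>, where digit \<open>0\<close> is padding; among all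
  codes of a clause the least one is used.
\<close>

context sparse_params
begin

definition M :: nat where
  "M = (L + 1) ^ k"

definition lits :: "nat \<Rightarrow> nat set" where
  "lits D = {x. x < L \<and> (\<exists>j<k. dg (L + 1) j D = Suc x)}"

definition canon :: "nat \<Rightarrow> bool" where
  "canon D \<longleftrightarrow> D < M \<and> (\<forall>E<M. E < D \<longrightarrow> lits E \<noteq> lits D)"

definition cact :: "nat set \<Rightarrow> nat set" where
  "cact Y = {D \<in> Y. \<forall>E\<in>Y. lits E \<subseteq> lits D \<longrightarrow> lits D \<subseteq> lits E}"

definition cdeg :: "nat set \<Rightarrow> nat \<Rightarrow> nat \<Rightarrow> nat" where
  "cdeg Y c H = card {C \<in> cact Y. card (lits C) = c \<and> lits H \<subseteq> lits C}"

text \<open>The triples of clause size, petal size and heart are numbered lexicographically.\<close>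

definition W :: nat where
  "W = (k + 1) * (k + 1) * M"

definition wc :: "nat \<Rightarrow> nat" where "wc w = w div M div (k + 1)"
definition ws :: "nat \<Rightarrow> nat" where "ws w = w div M mod (k + 1)"
definition wH :: "nat \<Rightarrow> nat" where "wH w = w mod M"

definition cflower :: "nat set \<Rightarrow> nat \<Rightarrow> bool" where
  "cflower Y w \<longleftrightarrow> 1 \<le> ws w \<and> ws w < wc w \<and> wc w \<le> k \<and> canon (wH w) \<and>
     card (lits (wH w)) + ws w = wc w \<and> thr (ws w) \<le> cdeg Y (wc w) (wH w)"

text \<open>The least index of a flower, or \<open>W\<close> if there is none. The indices before
  the first flower form an initial segment, and counting it is a bounded sum, hence easy to
  program.\<close>

definition fw :: "nat set \<Rightarrow> nat" where
  "fw Y = card {w. w < W \<and> (\<forall>u<W. u \<le> w \<longrightarrow> \<not> cflower Y u)}"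

text \<open>\<open>b\<close> selects the branch of the petals. Without a flower nothing happens, so
  the process may be run for longer than it is active.\<close>

definition step :: "nat set \<Rightarrow> bool \<Rightarrow> nat set" where
  "step Y b = {D. D < M \<and> (D \<in> Y \<or> (fw Y < W \<and>
     (if b then canon D \<and> (\<exists>C<M. C \<in> cact Y \<and> card (lits C) = wc (fw Y) \<and> lits (wH (fw Y)) \<subseteq> lits C \<and>
                       lits D = lits C - lits (wH (fw Y)))
      else D = wH (fw Y))))}"

definition run :: "nat set \<Rightarrow> (nat \<Rightarrow> bool) \<Rightarrow> nat \<Rightarrow> nat set" where
  "run Y0 pet t = rec_nat Y0 (\<lambda>t Y. step Y (pet t)) t"

lemma M_pos: "0 < M"
  by (simp add: M_def)

lemma lits_sub: "lits D \<subseteq> {..<L}"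
  by (auto simp: lits_def)

lemma finite_lits [simp]: "finite (lits D)"
  by (rule finite_subset[OF lits_sub]) simp

lemma card_lits: "card (lits D) \<le> k"
proof -
  have "lits D \<subseteq> (\<lambda>j. dg (L + 1) j D - 1) ` {..<k}"
    unfolding lits_def by force
  then show ?thesis using surj_card_le[of "{..<k}"] by (metis card_lessThan finite_lessThan)
qed

lemma canon_less: "canon D \<Longrightarrow> D < M"
  by (simp add: canon_def)

lemma canon_exists:
  assumes "X \<subseteq> {..<L}" "card X \<le> k"
  shows "\<exists>D. canon D \<and> lits D = X"
proof -
  have fin: "finite X" using assms(1) finite_subset by blast
  obtain xs where xs: "set xs = X" "length xs = card X"
    using finite_distinct_list[OF fin] distinct_card by metis
  have "(if i < length xs then Suc (xs ! i) else 0) < L + 1" for i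
    using xs assms(1) nth_mem[of i xs] by auto
  then obtain D where D: "D < (L + 1) ^ k" "\<forall>i<k. dg (L + 1) i D = (if i < length xs then Suc (xs ! i) else 0)"
    using dg_exists[of k "\<lambda>i. if i < length xs then Suc (xs ! i) else 0" "L + 1"] by blast
  have "lits D = X"
  proof (intro set_eqI iffI)
    fix x assume "x \<in> lits D"
    then obtain j where "j < k" "dg (L + 1) j D = Suc x" by (auto simp: lits_def)
    then show "x \<in> X" using D(2) xs(1) by (auto split: if_splits)
  next
    fix x assume x: "x \<in> X"
    then obtain j where "j < length xs" "xs ! j = x" using xs(1) by (auto simp: in_set_conv_nth)
    then show "x \<in> lits D" using D(2) xs(2) assms x by (auto simp: lits_def intro!: exI[of _ j])
  qed
  then have ex: "D < M \<and> lits D = X" using D(1) by (simp add: M_def)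
  define E where "E = (LEAST E. E < M \<and> lits E = X)"
  have "E < M \<and> lits E = X" unfolding E_def by (rule LeastI[of _ D]) (rule ex)
  moreover have "lits E' \<noteq> X" if "E' < E" "E' < M" for E'
    using not_less_Least[of E' "\<lambda>E. E < M \<and> lits E = X"] that unfolding E_def by blast
  ultimately show ?thesis unfolding canon_def by blast
qed

lemma canon_inj: "canon D \<Longrightarrow> canon E \<Longrightarrow> lits D = lits E \<Longrightarrow> D = E"
  unfolding canon_def by (metis linorder_neqE_nat)

lemma inj_lits: "Y \<subseteq> {D. canon D} \<Longrightarrow> inj_on lits Y"
  unfolding inj_on_def using canon_inj by blast

lemma act_lits: "act (lits ` Y) = lits ` cact Y"
  unfolding act_def cact_def by auto

lemma cact_sub: "cact Y \<subseteq> Y"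
  by (auto simp: cact_def)

lemma cdeg_eq:
  assumes "Y \<subseteq> {D. canon D}"
  shows "cdeg Y c H = deg (lits ` Y) c (lits H)"
proof -
  have "{C \<in> act (lits ` Y). card C = c \<and> lits H \<subseteq> C} = lits ` {C \<in> cact Y. card (lits C) = c \<and> lits H \<subseteq> lits C}"
    unfolding act_lits by auto
  moreover have "inj_on lits {C \<in> cact Y. card (lits C) = c \<and> lits H \<subseteq> lits C}"
    by (rule inj_on_subset[OF inj_lits[OF assms]]) (use cact_sub in auto)
  ultimately show ?thesis unfolding cdeg_def deg_def by (simp add: card_image)
qed

lemma cflower_iff:
  assumes "Y \<subseteq> {D. canon D}"
  shows "cflower Y w \<longleftrightarrow> canon (wH w) \<and> flower (lits ` Y) (wc w) (ws w) (lits (wH w))"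
  unfolding cflower_def flower_def cdeg_eq[OF assms] using lits_sub by auto

lemma fw_less:
  assumes "\<exists>w<W. cflower Y w"
  shows "fw Y < W" "cflower Y (fw Y)" "\<And>u. u < fw Y \<Longrightarrow> \<not> cflower Y u"
proof -
  define w where "w = (LEAST w. w < W \<and> cflower Y w)"
  have w: "w < W \<and> cflower Y w" unfolding w_def by (rule LeastI_ex) (rule assms)
  have least: "\<not> cflower Y u" if "u < w" for u
    using not_less_Least[of u "\<lambda>w. w < W \<and> cflower Y w"] that w unfolding w_def by auto
  have "{i. i < W \<and> (\<forall>u<W. u \<le> i \<longrightarrow> \<not> cflower Y u)} = {..<w}"
  proof (intro set_eqI iffI)
    fix i assume "i \<in> {i. i < W \<and> (\<forall>u<W. u \<le> i \<longrightarrow> \<not> cflower Y u)}"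
    then show "i \<in> {..<w}" using w not_le by blast
  next
    fix i assume "i \<in> {..<w}"
    then show "i \<in> {i. i < W \<and> (\<forall>u<W. u \<le> i \<longrightarrow> \<not> cflower Y u)}" using w least by auto
  qed
  then have "fw Y = w" by (simp add: fw_def)
  then show "fw Y < W" "cflower Y (fw Y)" "\<And>u. u < fw Y \<Longrightarrow> \<not> cflower Y u" using w least by auto
qed

lemma fw_ge: "\<not> fw Y < W \<Longrightarrow> w < W \<Longrightarrow> \<not> cflower Y w"
  using fw_less by blast

lemma flower_code:
  assumes Y: "Y \<subseteq> {D. canon D}" and f: "flower (lits ` Y) c s H"
  shows "\<exists>w<W. cflower Y w \<and> wc w = c \<and> ws w = s"
proof -
  have f': "1 \<le> s" "s < c" "c \<le> k" "H \<subseteq> {..<L}" "card H + s = c" using f by (auto simp: flower_def)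
  then obtain h where h: "canon h" "lits h = H" using canon_exists[of H] by auto
  define w where "w = (c * (k + 1) + s) * M + h"
  have hM: "h < M" using h canon_less by blast
  have wM: "w div M = c * (k + 1) + s" "w mod M = h" using hM M_pos by (auto simp: w_def)
  have "s < k + 1" using f' by simp
  then have cs: "wc w = c" "ws w = s" "wH w = h" unfolding wc_def ws_def wH_def wM
    by (simp_all only: div_mult_self3 mod_mult_self3 mod_less div_less)
  have "c * (k + 1) + s < (k + 1) * (k + 1)"
  proof -
    have "c * (k + 1) \<le> k * (k + 1)" using f' by (intro mult_le_mono1)
    then show ?thesis using f' by simp
  qed
  then have "(c * (k + 1) + s + 1) * M \<le> (k + 1) * (k + 1) * M" by (intro mult_le_mono1) simp
  then have "w < W" using hM unfolding w_def W_def by (simp add: algebra_simps)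
  then show ?thesis using cflower_iff[OF Y, of w] cs h f by auto
qed

lemma fw_first:
  assumes Y: "Y \<subseteq> {D. canon D}" and w: "fw Y < W"
  shows "canon (wH (fw Y))" "first_flower (lits ` Y) (wc (fw Y)) (ws (fw Y)) (lits (wH (fw Y)))"
proof -
  have ex: "\<exists>w<W. cflower Y w"
  proof (rule ccontr)
    assume "\<not> ?thesis"
    then have "{i. i < W \<and> (\<forall>u<W. u \<le> i \<longrightarrow> \<not> cflower Y u)} = {..<W}" by auto
    then have "fw Y = W" by (simp add: fw_def)
    then show False using w by simp
  qed
  note f = fw_less[OF ex]
  show "canon (wH (fw Y))" using f(2) cflower_iff[OF Y] by blast
  show "first_flower (lits ` Y) (wc (fw Y)) (ws (fw Y)) (lits (wH (fw Y)))"
    unfolding first_flower_def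
  proof (intro conjI allI impI)
    show "flower (lits ` Y) (wc (fw Y)) (ws (fw Y)) (lits (wH (fw Y)))" using f(2) cflower_iff[OF Y] by blast
    fix c s H assume "flower (lits ` Y) c s H"
    then obtain u where u: "u < W" "cflower Y u" "wc u = c" "ws u = s" using flower_code[OF Y] by blast
    have "fw Y \<le> u" using f(3) u(2) not_le by blast
    then have le: "fw Y div M \<le> u div M" by (rule div_le_mono)
    then have "wc (fw Y) \<le> c" unfolding u(3)[symmetric] wc_def by (rule div_le_mono)
    moreover have "ws (fw Y) \<le> s" if "wc (fw Y) = c"
    proof -
      have "fw Y div M = wc (fw Y) * (k + 1) + ws (fw Y)" "u div M = wc u * (k + 1) + ws u"
        unfolding wc_def ws_def by (simp_all only: div_mult_mod_eq)
      then show ?thesis using le that u by simp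
    qed
    ultimately show "wc (fw Y) < c \<or> wc (fw Y) = c \<and> ws (fw Y) \<le> s" by auto
  qed
qed

lemma run_0: "run Y0 pet 0 = Y0"
  by (simp add: run_def)

lemma run_Suc: "run Y0 pet (Suc t) = step (run Y0 pet t) (pet t)"
  by (simp add: run_def)

lemma step_canon:
  assumes Y: "Y \<subseteq> {D. canon D}"
  shows "step Y b \<subseteq> {D. canon D}" "Y \<subseteq> step Y b"
  using fw_first(1)[OF Y] Y canon_less by (auto simp: step_def split: if_splits)

lemma step_id: "Y \<subseteq> {D. canon D} \<Longrightarrow> \<not> fw Y < W \<Longrightarrow> step Y b = Y"
  using canon_less by (auto simp: step_def)

lemma lits_step_heart:
  assumes Y: "Y \<subseteq> {D. canon D}" and w: "fw Y < W"
  shows "lits ` step Y False = lits ` Y \<union> {lits (wH (fw Y))}"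
proof -
  have "step Y False = Y \<union> {wH (fw Y)}"
    using Y w canon_less fw_first(1)[OF Y w] by (auto simp: step_def)
  then show ?thesis by auto
qed

lemma lits_step_petals:
  assumes Y: "Y \<subseteq> {D. canon D}" and w: "fw Y < W"
  shows "lits ` step Y True = lits ` Y \<union> petals (lits ` Y) (wc (fw Y)) (lits (wH (fw Y)))" (is "?l = ?r")
proof
  have cY: "C < M" if "C \<in> cact Y" for C using that cact_sub Y canon_less by blast
  show "?l \<subseteq> ?r" unfolding step_def petals_def act_lits by auto
  show "?r \<subseteq> ?l"
  proof
    fix X assume "X \<in> ?r"
    then consider "X \<in> lits ` Y" | "X \<in> petals (lits ` Y) (wc (fw Y)) (lits (wH (fw Y)))" by blast
    then show "X \<in> ?l"
    proof cases
      case 1 then show ?thesis using step_canon(2)[OF Y] by blast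
    next
      case 2
      then obtain C where C: "C \<in> cact Y" "card (lits C) = wc (fw Y)" "lits (wH (fw Y)) \<subseteq> lits C"
        "X = lits C - lits (wH (fw Y))" unfolding petals_def act_lits by auto
      have "X \<subseteq> {..<L}" using C lits_sub by blast
      moreover have "card X \<le> card (lits C)" unfolding C(4) by (rule card_mono) auto
      then have "card X \<le> k" using card_lits le_trans by blast
      ultimately obtain D where D: "canon D" "lits D = X" using canon_exists by blast
      have "\<exists>C'<M. C' \<in> cact Y \<and> card (lits C') = wc (fw Y) \<and> lits (wH (fw Y)) \<subseteq> lits C' \<and>
          lits D = lits C' - lits (wH (fw Y))"
        using C cY D(2) by (intro exI[of _ C]) simp
      then have "D \<in> step Y True" using D(1) w canon_less[OF D(1)] unfolding step_def by simp
      then show ?thesis using D by blast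
    qed
  qed
qed

end

section \<open>Correctness of the coded sparsification\<close>

context sparsification
begin

text \<open>The sum of \<open>p\<close> over the petal sizes counts the effective choices of petals,
  which turns the bounds for single sizes into one on the length of a recorded path.\<close>

lemma run_Inv:
  assumes Y0: "Y0 \<subseteq> {D. canon D}"
  shows "run Y0 pet t \<subseteq> {D. canon D} \<and> Y0 \<subseteq> run Y0 pet t \<and>
    (\<exists>p. Inv (lits ` Y0) (lits ` run Y0 pet t) p \<and>
       (\<Sum>s\<in>{1..k}. p s) = card {i. i < t \<and> pet i \<and> fw (run Y0 pet i) < W})"
proof (induction t)
  case 0
  have "kfamily (lits ` Y0)" using lits_sub card_lits by (auto simp: kfamily_def)
  from Inv_init[OF this] show ?case
    using Y0 by (auto simp: run_0 intro!: exI[of _ "\<lambda>_. 0"])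
next
  case (Suc t)
  let ?Y = "run Y0 pet t"
  have Y: "?Y \<subseteq> {D. canon D}" "Y0 \<subseteq> ?Y" using Suc by auto
  obtain p where p: "Inv (lits ` Y0) (lits ` ?Y) p"
    "(\<Sum>s\<in>{1..k}. p s) = card {i. i < t \<and> pet i \<and> fw (run Y0 pet i) < W}" using Suc by blast
  have S: "step ?Y b \<subseteq> {D. canon D}" "Y0 \<subseteq> step ?Y b" for b using step_canon[OF Y(1)] Y(2) by blast+
  have *: "{i. i < Suc t \<and> pet i \<and> fw (run Y0 pet i) < W} = {i. i < t \<and> pet i \<and> fw (run Y0 pet i) < W}"
    if "\<not> (pet t \<and> fw ?Y < W)" using that by (auto simp: less_Suc_eq)
  show ?case
  proof (cases "fw ?Y < W")
    case False
    then show ?thesis unfolding run_Suc using * step_id[OF Y(1) False] Y p by auto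
  next
    case w: True
    note ff = fw_first[OF Y(1) w]
    show ?thesis
    proof (cases "pet t")
      case False
      then show ?thesis unfolding run_Suc using * S[of False] lits_step_heart[OF Y(1) w] Inv_heart(1)[OF p(1) ff(2)] p(2)
        by auto
    next
      case True
      let ?s = "ws (fw ?Y)"
      have s: "1 \<le> ?s" "?s \<le> k" using ff(2) by (auto simp: first_flower_def flower_def)
      have "{i. i < Suc t \<and> pet i \<and> fw (run Y0 pet i) < W} = insert t {i. i < t \<and> pet i \<and> fw (run Y0 pet i) < W}"
        using True w by (auto simp: less_Suc_eq)
      then have c: "card {i. i < Suc t \<and> pet i \<and> fw (run Y0 pet i) < W} = Suc (\<Sum>s\<in>{1..k}. p s)"
        using p(2) by simp
      have "(\<Sum>i\<in>{1..k}. (p(?s := Suc (p ?s))) i) = Suc (\<Sum>i\<in>{1..k}. p i)"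
        using s by (subst (1 2) sum.remove[of _ ?s]) (auto intro: sum.cong)
      then show ?thesis unfolding run_Suc using True S[of True] lits_step_petals[OF Y(1) w] Inv_petals(1)[OF p(1) ff(2)] c
        by (auto intro!: exI[of _ "p(?s := Suc (p ?s))"])
    qed
  qed
qed

text \<open>As long as a flower exists, every step adds a new code, and there are only
  \<open>M\<close> codes.\<close>

lemma run_no_flower:
  assumes Y0: "Y0 \<subseteq> {D. canon D}"
  shows "\<not> flower (lits ` run Y0 pet M) c s H"
proof -
  have Y: "run Y0 pet t \<subseteq> {D. canon D}" for t using run_Inv[OF Y0] by blast
  have fin: "finite (run Y0 pet t)" "card (run Y0 pet t) \<le> M" for t
  proof -
    have "run Y0 pet t \<subseteq> {..<M}" using Y canon_less by blast
    then show "finite (run Y0 pet t)" "card (run Y0 pet t) \<le> M"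
      using finite_subset card_mono[of "{..<M}"] by auto
  qed
  have grow: "card (run Y0 pet t) < card (run Y0 pet (Suc t))" if w: "fw (run Y0 pet t) < W" for t
  proof (rule psubset_card_mono[OF fin(1)], rule psubsetI)
    show "run Y0 pet t \<subseteq> run Y0 pet (Suc t)" unfolding run_Suc by (rule step_canon(2)[OF Y])
    obtain p where p: "Inv (lits ` Y0) (lits ` run Y0 pet t) p" using run_Inv[OF Y0] by blast
    note ff = fw_first[OF Y w]
    have "F \<noteq> F \<union> P" if "P \<inter> F = {}" "P \<noteq> {}" for F P :: "nat set set" using that by blast
    note ne = this[OF Inv_petals(2,3)[OF p ff(2)]]
    have "lits ` run Y0 pet t \<noteq> lits ` run Y0 pet (Suc t)"
    proof (cases "pet t")
      case True
      then have e: "lits ` step (run Y0 pet t) (pet t) = lits ` run Y0 pet t \<union>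
          petals (lits ` run Y0 pet t) (wc (fw (run Y0 pet t))) (lits (wH (fw (run Y0 pet t))))"
        using lits_step_petals[OF Y w] by simp
      show ?thesis unfolding run_Suc e by (rule ne)
    next
      case False
      then have e: "lits ` step (run Y0 pet t) (pet t) = lits ` run Y0 pet t \<union> {lits (wH (fw (run Y0 pet t)))}"
        using lits_step_heart[OF Y w] by simp
      show ?thesis unfolding run_Suc e using Inv_heart(2)[OF p ff(2)] by blast
    qed
    then show "run Y0 pet t \<noteq> run Y0 pet (Suc t)" by auto
  qed
  have "\<not> fw (run Y0 pet t) < W \<or> t \<le> card (run Y0 pet t)" for t
  proof (induction t)
    case (Suc t)
    show ?case
    proof (cases "fw (run Y0 pet t) < W")
      case True then show ?thesis using Suc grow[OF True] by simp
    next
      case False then show ?thesis unfolding run_Suc step_id[OF Y False] by simp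
    qed
  qed simp
  then have "\<not> fw (run Y0 pet M) < W"
    using grow[of M] fin(2)[of "Suc M"] by (meson le_less_trans leD)
  then show ?thesis using flower_code[OF Y] fw_ge by blast
qed

definition hits :: "nat set \<Rightarrow> nat set set \<Rightarrow> bool" where
  "hits Tr F \<longleftrightarrow> (\<forall>C\<in>F. C \<inter> Tr \<noteq> {})"

text \<open>The branch is dictated by \<open>Tr\<close>, the set of true literals: if
  \<open>Tr\<close> meets the heart, the heart is added. Otherwise each clause through the heart is
  met outside the heart, that is, in its petal, and the petals are added. \<open>P\<close> collects
  the steps of the latter kind.\<close>

lemma run_complete:
  assumes Y0: "Y0 \<subseteq> {D. canon D}" and Tr: "hits Tr (lits ` Y0)"
  shows "\<exists>P. finite P \<and> P \<subseteq> {..<M} \<and> card P \<le> k * L div \<alpha> \<and> hits Tr (lits ` run Y0 (\<lambda>t. t \<in> P) M)"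
proof -
  define b where "b = (\<lambda>Y. lits (wH (fw Y)) \<inter> Tr = {})"
  define Yt where "Yt = rec_nat Y0 (\<lambda>t Y. step Y (b Y))"
  define P where "P = {t. t < M \<and> fw (Yt t) < W \<and> b (Yt t)}"
  have Yt: "Yt 0 = Y0" "Yt (Suc t) = step (Yt t) (b (Yt t))" for t by (auto simp: Yt_def)
  have eq: "run Y0 (\<lambda>t. t \<in> P) t = Yt t \<and> Yt t \<subseteq> {D. canon D} \<and> hits Tr (lits ` Yt t)" if "t \<le> M" for t
    using that
  proof (induction t)
    case 0 then show ?case using Y0 Tr by (simp add: Yt run_0)
  next
    case (Suc t)
    let ?Y = "Yt t"
    have Y: "?Y \<subseteq> {D. canon D}" "hits Tr (lits ` ?Y)" "run Y0 (\<lambda>t. t \<in> P) t = ?Y" using Suc by auto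
    show ?case
    proof (cases "fw ?Y < W")
      case False
      then show ?thesis unfolding run_Suc Yt(2) Y(3) step_id[OF Y(1) False] using Y by simp
    next
      case w: True
      have "(t \<in> P) = b ?Y" using w Suc.prems by (simp add: P_def)
      moreover have "hits Tr (lits ` step ?Y (b ?Y))"
      proof (cases "b ?Y")
        case False
        then have "lits ` step ?Y (b ?Y) = lits ` ?Y \<union> {lits (wH (fw ?Y))}" using lits_step_heart[OF Y(1) w] by simp
        then show ?thesis using Y(2) False by (auto simp: hits_def b_def)
      next
        case True
        then have e: "lits ` step ?Y (b ?Y) = lits ` ?Y \<union> petals (lits ` ?Y) (wc (fw ?Y)) (lits (wH (fw ?Y)))"
          using lits_step_petals[OF Y(1) w] by simp
        have "X \<inter> Tr \<noteq> {}" if X: "X \<in> petals (lits ` ?Y) (wc (fw ?Y)) (lits (wH (fw ?Y)))" for X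
        proof -
          obtain C where C: "C \<in> act (lits ` ?Y)" "X = C - lits (wH (fw ?Y))" using X by (auto simp: petals_def)
          have "C \<inter> Tr \<noteq> {}" by (rule bspec[OF Y(2)[unfolded hits_def] subsetD[OF act_subset C(1)]])
          then show ?thesis using C(2) True by (auto simp: b_def)
        qed
        then show ?thesis unfolding e using Y(2) by (auto simp: hits_def)
      qed
      ultimately show ?thesis unfolding run_Suc Yt(2) Y(3) using step_canon(1)[OF Y(1)] by simp
    qed
  qed
  have PM: "{i. i < M \<and> i \<in> P \<and> fw (run Y0 (\<lambda>t. t \<in> P) i) < W} = P"
    using eq by (auto simp: P_def)
  obtain p where p: "Inv (lits ` Y0) (lits ` run Y0 (\<lambda>t. t \<in> P) M) p" "(\<Sum>s\<in>{1..k}. p s) = card P"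
    using run_Inv[OF Y0, of "\<lambda>t. t \<in> P" M] unfolding PM by blast
  have "\<alpha> * card P = (\<Sum>s\<in>{1..k}. \<alpha> * p s)" unfolding p(2)[symmetric] by (rule sum_distrib_left)
  also have "\<dots> \<le> (\<Sum>s\<in>{1..k}. L)" by (rule sum_mono) (use petal_steps_le[OF p(1)] in auto)
  also have "\<dots> = k * L" by simp
  finally have "card P \<le> k * L div \<alpha>" using \<alpha>_pos by (simp add: less_eq_div_iff_mult_less_eq mult.commute)
  moreover have "finite P" "P \<subseteq> {..<M}" by (auto simp: P_def)
  ultimately show ?thesis using eq[of M] by auto
qed

end

section \<open>A lower bound on the number of primes\<close>

text \<open>
  The entries \<open>1 / (Suc n * (n choose k))\<close> of Leibniz' harmonic triangle are differences of
  entries further up or to the left, so \<open>Lcm {1..Suc n}\<close> is a common denominator.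
\<close>

lemma Leibniz_dvd_Lcm: "k \<le> n \<Longrightarrow> Suc n * (n choose k) dvd Lcm {1..Suc n}"
proof (induction k arbitrary: n)
  case 0
  show ?case by (simp only: binomial_n_0 mult_1_right) (rule dvd_Lcm, simp)
next
  case (Suc k)
  then obtain m where n: "n = Suc m" by (cases n) auto
  have km: "k \<le> m" using Suc.prems n by simp
  define D where "D = Lcm {1..Suc n}"
  define X where "X = Suc m * (m choose k)"
  define Y where "Y = Suc n * (n choose k)"
  define Z where "Z = Suc n * (n choose Suc k)"
  have "X dvd Lcm {1..Suc m}" unfolding X_def by (rule Suc.IH[OF km])
  also have "\<dots> dvd D" unfolding D_def n by (rule Lcm_subset) auto
  finally obtain a where a: "D = X * a" by (rule dvdE)
  have "Y dvd D" unfolding Y_def D_def by (rule Suc.IH) (use Suc.prems in simp)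
  then obtain b where b: "D = Y * b" by (rule dvdE)
  have 1: "Suc k * Z = Suc n * X"
    unfolding Z_def X_def n mult.left_commute[of "Suc k" "Suc (Suc m)"] by (simp only: Suc_times_binomial)
  have 2: "(Suc m - k) * Y = Suc n * X"
    unfolding Y_def X_def n mult.left_commute[of "Suc m - k" "Suc (Suc m)"]
    by (simp only: binomial_absorb_comp diff_Suc_1)
  have Ypos: "0 < Y" using Suc.prems by (simp add: Y_def)
  have "Y * ((Suc m - k) * a) = Suc n * (X * a)" using 2 by (metis mult.assoc mult.commute)
  also have "X * a = Y * b" using a b by (simp only:)
  also have "Suc n * (Y * b) = Y * (Suc n * b)" by (rule mult.left_commute)
  finally have ab: "(Suc m - k) * a = Suc n * b" using Ypos by simp
  have "int (Suc k) * a = int (Suc n) * a - int (Suc m - k) * a"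
    using km n by (simp add: of_nat_diff algebra_simps)
  also have "\<dots> = int (Suc n) * (int a - int b)"
    using arg_cong[OF ab, of int] by (simp only: of_nat_mult right_diff_distrib)
  finally have c: "int (Suc k) * a = int (Suc n) * (int a - int b)" .
  have "int (Suc n) * int D = int (Suc n * X) * a" using a by (simp add: algebra_simps)
  also have "\<dots> = int Z * (int (Suc k) * a)" unfolding 1[symmetric] by (simp add: algebra_simps)
  also have "\<dots> = int (Suc n) * (int Z * (int a - int b))" unfolding c by (simp add: algebra_simps)
  finally have "int D = int Z * (int a - int b)" by (simp only: mult_cancel_left) simp
  then have "int Z dvd int D" by simp
  then show ?case unfolding Z_def D_def by (simp only: int_dvd_int_iff)
qed

text \<open>All \<open>n + 1\<close> multiples of binomial coefficients in one row divide the
  \<open>Lcm\<close>, hence are at most the \<open>Lcm\<close>, and they add up to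
  \<open>Suc n * 2 ^ n\<close>.\<close>

lemma Lcm_ge: "2 ^ n \<le> Lcm {1..Suc n}"
proof -
  have "Suc n * 2 ^ n = (\<Sum>k\<le>n. Suc n * (n choose k))"
    by (simp only: choose_row_sum[symmetric] sum_distrib_left)
  also have "\<dots> \<le> (\<Sum>k\<le>n. Lcm {1..Suc n})"
  proof (rule sum_mono)
    fix k assume "k \<in> {..n}"
    then have "Suc n * (n choose k) dvd Lcm {1..Suc n}" by (intro Leibniz_dvd_Lcm) simp
    moreover have "Lcm {1..Suc n} \<noteq> 0" using Lcm_0_iff[of "{1..Suc n}"] by simp
    then have "0 < Lcm {1..Suc n}" by (simp only: neq0_conv)
    ultimately show "Suc n * (n choose k) \<le> Lcm {1..Suc n}" by (rule dvd_imp_le)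
  qed
  also have "\<dots> = Suc n * Lcm {1..Suc n}" by simp
  finally show ?thesis by (simp only: Suc_mult_le_cancel1)
qed

text \<open>For each prime, the highest power occurring in the \<open>Lcm\<close> divides some
  number up to \<open>N\<close> and is therefore itself at most \<open>N\<close>.\<close>

lemma Lcm_le: "Lcm {1..N} \<le> N ^ card {p. prime p \<and> p \<le> (N::nat)}"
proof -
  let ?P = "{p. prime p \<and> p \<le> N}"
  define f where "f = (\<lambda>p. Max (insert 0 (multiplicity p ` {1..N})))"
  define Q where "Q = (\<Prod>p\<in>?P. p ^ f p)"
  have finP: "finite ?P" by simp
  have Q0: "Q \<noteq> 0" unfolding Q_def using finP by (auto simp: prod_zero_iff prime_gt_0_nat)
  have "Lcm {1..N} dvd Q"
  proof (rule Lcm_least)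
    fix j assume j: "j \<in> {1..N}"
    show "j dvd Q"
    proof (rule multiplicity_le_imp_dvd)
      fix p :: nat assume p: "prime p"
      show "multiplicity p j \<le> multiplicity p Q"
      proof (cases "p \<le> N")
        case True
        then have "multiplicity p Q = f p"
          unfolding Q_def using multiplicity_prod_prime_powers[OF finP _ p, of f] p by auto
        then show ?thesis unfolding f_def using j by (auto intro!: Max_ge)
      next
        case False
        then have "\<not> p dvd j" using j by (meson atLeastAtMost_iff dvd_imp_le le_trans less_le_trans zero_less_one)
        then show ?thesis by (simp add: not_dvd_imp_multiplicity_0)
      qed
    qed (use j in auto)
  qed
  then have "Lcm {1..N} \<le> Q" using Q0 by (intro dvd_imp_le) auto
  also have "Q \<le> (\<Prod>p\<in>?P. N)"
    unfolding Q_def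
  proof (rule prod_mono, intro conjI)
    fix p assume p: "p \<in> ?P"
    have "f p \<in> insert 0 (multiplicity p ` {1..N})" unfolding f_def by (rule Max_in) auto
    then consider "f p = 0" | j where "j \<in> {1..N}" "f p = multiplicity p j" by auto
    then show "p ^ f p \<le> N"
    proof cases
      case 1 then show ?thesis using p prime_gt_0_nat[of p] by auto
    next
      case 2
      then have "p ^ f p \<le> j" using multiplicity_dvd[of p j] by (intro dvd_imp_le) auto
      then show ?thesis using 2 by simp
    qed
  qed simp
  finally show ?thesis by simp
qed

text \<open>Comparison of the two bounds on \<open>Lcm {1..v ^ 2 - 1}\<close>. The resulting weak
  form of Chebyshev's theorem supplies far more primes below \<open>v ^ 2\<close> than the protocol
  can lose to coincidences.\<close>

lemma many_primes:
  assumes "v < 2 ^ l" "2 \<le> v"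
  shows "v ^ 2 - 2 \<le> 2 * l * card {q. q < v ^ 2 \<and> prime q}"
proof -
  let ?N = "v ^ 2 - 1"
  have N: "?N = Suc (v ^ 2 - 2)" "?N < v ^ 2" using power_mono[OF assms(2), of 2] by simp_all
  have "2 ^ (v ^ 2 - 2) \<le> Lcm {1..?N}" unfolding N(1) by (rule Lcm_ge)
  also have "\<dots> \<le> ?N ^ card {p. prime p \<and> p \<le> ?N}" by (rule Lcm_le)
  also have "{p. prime p \<and> p \<le> ?N} = {q. q < v ^ 2 \<and> prime q}" using N(2) by auto
  also have "?N ^ card {q. q < v ^ 2 \<and> prime q} \<le> (2 ^ (2 * l)) ^ card {q. q < v ^ 2 \<and> prime q}"
  proof (rule power_mono)
    have "v ^ 2 \<le> (2 ^ l) ^ 2" using assms(1) by (intro power_mono) auto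
    then show "?N \<le> 2 ^ (2 * l)" by (simp add: power_mult[symmetric] mult.commute)
  qed simp
  also have "\<dots> = 2 ^ (2 * l * card {q. q < v ^ 2 \<and> prime q})" by (simp add: power_mult)
  finally show ?thesis by (rule power_le_imp_le_exp[rotated]) simp
qed

lemma card_prime_divisors_le:
  fixes w :: nat
  assumes "w \<noteq> 0" "w < 2 ^ n"
  shows "finite {p. prime p \<and> p dvd w}" "card {p. prime p \<and> p dvd w} \<le> n"
proof -
  let ?S = "{p. prime p \<and> p dvd w}"
  show fin: "finite ?S" using assms(1) by (auto intro: finite_subset[OF _ finite_divisors_nat[of w]])
  have "(\<Prod>p\<in>?S. p ^ 1) dvd w"
  proof (rule multiplicity_le_imp_dvd)
    fix p :: nat assume p: "prime p"
    have "multiplicity p (\<Prod>p\<in>?S. p ^ 1) = (if p \<in> ?S then 1 else 0)"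
      using multiplicity_prod_prime_powers[OF fin _ p, of "\<lambda>_. 1"] by auto
    moreover have "1 \<le> multiplicity p w" if "p dvd w"
      using that p assms(1) by (intro multiplicity_geI) auto
    ultimately show "multiplicity p (\<Prod>p\<in>?S. p ^ 1) \<le> multiplicity p w" by auto
  qed (use assms in \<open>auto simp: prod_zero_iff fin\<close>)
  then have le: "(\<Prod>p\<in>?S. p) \<le> w" using assms(1) by (intro dvd_imp_le) auto
  have "(2::nat) ^ card ?S = (\<Prod>p\<in>?S. 2)" by simp
  also have "\<dots> \<le> (\<Prod>p\<in>?S. p)" by (rule prod_mono) (auto dest: prime_ge_2_nat)
  finally have "(2::nat) ^ card ?S < 2 ^ n" using le assms(2) by linarith
  then show "card ?S \<le> n" by simp
qed

lemma card_agreeing_primes_le: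
  fixes x y :: nat
  assumes "x \<noteq> y" "x < 2 ^ n" "y < 2 ^ n"
  shows "card {q. q < Q \<and> prime q \<and> x mod q = y mod q} \<le> n"
proof -
  \<comment> \<open>One of the two truncated differences is 0, so \<open>w\<close> is the distance
    of \<open>x\<close> and \<open>y\<close>.\<close>
  define w where "w = (x - y) + (y - x)"
  have w: "w \<noteq> 0" "w < 2 ^ n" using assms by (auto simp: w_def)
  have "q dvd w" if "x mod q = y mod q" for q
  proof (cases "x \<le> y")
    case True
    then have "w = y - x" by (simp add: w_def)
    then show ?thesis using that mod_eq_dvd_iff_nat[OF True, of q] by simp
  next
    case False
    then have "w = x - y" by (simp add: w_def)
    then show ?thesis using that mod_eq_dvd_iff_nat[of y x q] False by simp
  qed
  then have "card {q. q < Q \<and> prime q \<and> x mod q = y mod q} \<le> card {p. prime p \<and> p dvd w}"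
    by (intro card_mono card_prime_divisors_le(1)[OF w]) auto
  then show ?thesis using card_prime_divisors_le(2)[OF w] by linarith
qed

section \<open>The protocol for disjointness\<close>

text \<open>
  This is the Merlin-Arthur protocol of Aaronson and Wigderson with the polynomials
  replaced by integers: their values at a large \<open>Z\<close> are used, so that the inner product of \<open>a\<close> and
  \<open>b\<close> appears as a digit in base \<open>Z\<close>, and random evaluation points become random primes.
\<close>

definition encA :: "nat \<Rightarrow> nat \<Rightarrow> nat \<Rightarrow> (nat \<Rightarrow> nat) \<Rightarrow> nat \<Rightarrow> nat" where
  "encA U T Z a t = (\<Sum>u<U. a (u * T + t) * Z ^ u)"

text \<open>The exponents are reversed in comparison with \<open>encA\<close>, so that the products
  of entries with the same \<open>u\<close> all meet at exponent \<open>U - 1\<close>.\<close>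

definition encB :: "nat \<Rightarrow> nat \<Rightarrow> nat \<Rightarrow> (nat \<Rightarrow> nat) \<Rightarrow> nat \<Rightarrow> nat" where
  "encB U T Z b t = (\<Sum>u<U. b (u * T + t) * Z ^ (U - 1 - u))"

lemma geometric_less: "(2::nat) \<le> Z \<Longrightarrow> (Z - 1) * (\<Sum>e<n. Z ^ e) < Z ^ n"
proof (induction n)
  case (Suc n)
  have "(Z - 1) * (\<Sum>e<Suc n. Z ^ e) = (Z - 1) * (\<Sum>e<n. Z ^ e) + (Z - 1) * Z ^ n" by (simp add: algebra_simps)
  also have "\<dots> < Z ^ n + (Z - 1) * Z ^ n" using Suc by simp
  also have "\<dots> = (1 + (Z - 1)) * Z ^ n" by (simp only: distrib_right mult_1)
  finally show ?case using Suc.prems by simp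
qed simp

lemma sum_less_power: "(2::nat) \<le> Z \<Longrightarrow> (\<Sum>e<n. Z ^ e) < Z ^ n"
proof -
  assume "2 \<le> Z"
  then have "1 * (\<Sum>e<n. Z ^ e) \<le> (Z - 1) * (\<Sum>e<n. Z ^ e)" by (intro mult_le_mono1) simp
  then show ?thesis using geometric_less[OF \<open>2 \<le> Z\<close>, of n] by linarith
qed

lemma encA_less: "2 \<le> Z \<Longrightarrow> (\<And>c. a c \<le> 1) \<Longrightarrow> encA U T Z a t < Z ^ U"
proof -
  assume *: "2 \<le> Z" "\<And>c. a c \<le> 1"
  have "encA U T Z a t \<le> (\<Sum>u<U. Z ^ u)"
    unfolding encA_def
  proof (rule sum_mono)
    show "a (u * T + t) * Z ^ u \<le> Z ^ u" for u using mult_le_mono1[OF *(2)] by (simp only: mult_1)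
  qed
  then show ?thesis using sum_less_power[OF *(1), of U] by simp
qed

lemma encB_less: "2 \<le> Z \<Longrightarrow> (\<And>c. b c \<le> 1) \<Longrightarrow> encB U T Z b t < Z ^ U"
proof -
  assume *: "2 \<le> Z" "\<And>c. b c \<le> 1"
  have "encB U T Z b t \<le> (\<Sum>u<U. Z ^ (U - 1 - u))"
    unfolding encB_def
  proof (rule sum_mono)
    show "b (u * T + t) * Z ^ (U - 1 - u) \<le> Z ^ (U - 1 - u)" for u
      using mult_le_mono1[OF *(2)] by (simp only: mult_1)
  qed
  also have "\<dots> = (\<Sum>u<U. Z ^ u)"
    using sum.nat_diff_reindex[of "\<lambda>u. Z ^ u" U] by simp
  finally show ?thesis using sum_less_power[OF *(1), of U] by simp
qed

lemma enc_product_less: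
  assumes "2 \<le> Z" "T < Z" "\<And>c. a c \<le> 1" "\<And>c. b c \<le> 1"
  shows "(\<Sum>t<T. encA U T Z a t * encB U T Z b t) < Z ^ (2 * U + 1)"
proof -
  have "(\<Sum>t<T. encA U T Z a t * encB U T Z b t) \<le> (\<Sum>t<T. Z ^ U * Z ^ U)"
    by (intro sum_mono mult_le_mono less_imp_le encA_less encB_less assms)
  also have "\<dots> = T * Z ^ (2 * U)" by (simp add: power_add[symmetric] mult_2)
  also have "\<dots> < Z * Z ^ (2 * U)" using assms by simp
  finally show ?thesis by simp
qed

text \<open>The pair \<open>(u, w)\<close> contributes to exponent \<open>u + (U - 1 - w)\<close>:
  the diagonal yields the inner product at \<open>U - 1\<close>, pairs with \<open>u < w\<close> lie
  below and pairs with \<open>w < u\<close> above. Each exponent receives at most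
  \<open>U * T < Z\<close> products of bits, so no carry reaches digit \<open>U - 1\<close> and this
  digit does not overflow.\<close>

lemma enc_product_digit:
  assumes "2 \<le> Z" "U * T < Z" "1 \<le> U" "\<And>c. a c \<le> 1" "\<And>c. b c \<le> 1"
  shows "dg Z (U - 1) (\<Sum>t<T. encA U T Z a t * encB U T Z b t) = (\<Sum>c<U * T. a c * b c)"
proof -
  define s where "s = (\<lambda>u w. \<Sum>t<T. a (u * T + t) * b (w * T + t))"
  define g where "g = (\<lambda>u w. s u w * Z ^ (u + (U - 1 - w)))"
  have ab: "a c * b d \<le> 1" for c d using mult_le_mono[OF assms(4)[of c] assms(5)[of d]] by simp
  have sT: "s u w \<le> T" for u w
  proof -
    have "s u w \<le> (\<Sum>t<T. 1)" unfolding s_def by (intro sum_mono ab)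
    then show ?thesis by simp
  qed
  have "(\<Sum>t<T. encA U T Z a t * encB U T Z b t) =
      (\<Sum>t<T. \<Sum>u<U. \<Sum>w<U. a (u * T + t) * b (w * T + t) * Z ^ (u + (U - 1 - w)))"
    unfolding encA_def encB_def sum_product
    by (intro sum.cong refl) (simp only: power_add mult.assoc mult.left_commute mult.commute)
  also have "\<dots> = (\<Sum>u<U. \<Sum>t<T. \<Sum>w<U. a (u * T + t) * b (w * T + t) * Z ^ (u + (U - 1 - w)))"
    by (rule sum.swap)
  also have "\<dots> = (\<Sum>u<U. \<Sum>w<U. g u w)"
    unfolding g_def s_def sum_distrib_right by (rule sum.cong[OF refl], rule sum.swap)
  finally have P: "(\<Sum>t<T. encA U T Z a t * encB U T Z b t) = (\<Sum>u<U. \<Sum>w<U. g u w)" .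
  have split: "(\<Sum>w<U. g u w) = (\<Sum>w\<in>{Suc u..<U}. g u w) + (g u u + (\<Sum>w<u. g u w))" if "u < U" for u
  proof -
    have "{..<U} = {Suc u..<U} \<union> insert u {..<u}" using that by auto
    moreover have "(\<Sum>w\<in>{Suc u..<U} \<union> insert u {..<u}. g u w) = (\<Sum>w\<in>{Suc u..<U}. g u w) + (\<Sum>w\<in>insert u {..<u}. g u w)"
      by (rule sum.union_disjoint) auto
    ultimately show ?thesis by simp
  qed
  define low where "low = (\<Sum>u<U. \<Sum>w\<in>{Suc u..<U}. g u w)"
  define high where "high = (\<Sum>u<U. \<Sum>w<u. s u w * Z ^ (u - Suc w))"
  have mid: "(\<Sum>u<U. g u u) = (\<Sum>c<U * T. a c * b c) * Z ^ (U - 1)"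
  proof -
    have "(\<Sum>u<U. g u u) = (\<Sum>u<U. s u u * Z ^ (U - 1))" unfolding g_def by (rule sum.cong) auto
    also have "\<dots> = (\<Sum>u<U. s u u) * Z ^ (U - 1)" by (simp add: sum_distrib_right)
    also have "(\<Sum>u<U. s u u) = (\<Sum>u<U. \<Sum>c\<in>{u * T..<u * T + T}. a c * b c)"
    proof (rule sum.cong[OF refl])
      fix u
      show "s u u = (\<Sum>c\<in>{u * T..<u * T + T}. a c * b c)"
        unfolding s_def using sum.shift_bounds_nat_ivl[of "\<lambda>c. a c * b c" 0 "u * T" T]
        by (simp add: atLeast0LessThan add.commute)
    qed
    also have "\<dots> = (\<Sum>c<U * T. a c * b c)" by (rule sum.nat_group)
    finally show ?thesis .
  qed
  have hi: "(\<Sum>u<U. \<Sum>w<u. g u w) = Z ^ U * high"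
    unfolding high_def sum_distrib_left
  proof (intro sum.cong refl)
    fix u w assume uw: "u \<in> {..<U}" "w \<in> {..<u}"
    then have "u + (U - 1 - w) = U + (u - Suc w)" by auto
    then show "g u w = Z ^ U * (s u w * Z ^ (u - Suc w))" unfolding g_def by (simp add: power_add)
  qed
  have "low \<le> (\<Sum>u<U. T * (\<Sum>e<U - 1. Z ^ e))"
    unfolding low_def
  proof (rule sum_mono)
    fix u assume u: "u \<in> {..<U}"
    have "(\<Sum>w\<in>{Suc u..<U}. g u w) \<le> (\<Sum>w\<in>{Suc u..<U}. T * Z ^ (u + (U - 1 - w)))"
      unfolding g_def by (intro sum_mono mult_le_mono1 sT)
    also have "\<dots> = T * (\<Sum>w\<in>{Suc u..<U}. Z ^ (u + (U - 1 - w)))" by (simp add: sum_distrib_left)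
    also have "(\<Sum>w\<in>{Suc u..<U}. Z ^ (u + (U - 1 - w))) = (\<Sum>e\<in>(\<lambda>w. u + (U - 1 - w)) ` {Suc u..<U}. Z ^ e)"
      by (subst sum.reindex) (auto simp: inj_on_def)
    also have "\<dots> \<le> (\<Sum>e<U - 1. Z ^ e)" by (rule sum_mono2) auto
    finally show "(\<Sum>w\<in>{Suc u..<U}. g u w) \<le> T * (\<Sum>e<U - 1. Z ^ e)" by simp
  qed
  also have "\<dots> = U * T * (\<Sum>e<U - 1. Z ^ e)" by simp
  also have "\<dots> \<le> (Z - 1) * (\<Sum>e<U - 1. Z ^ e)" using assms(2) by (intro mult_le_mono1) simp
  also have "\<dots> < Z ^ (U - 1)" by (rule geometric_less[OF assms(1)])
  finally have low: "low < Z ^ (U - 1)" .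
  have ZU: "Z ^ U = Z ^ (U - 1) * Z" using assms(3) by (metis Suc_diff_1 Suc_le_eq One_nat_def power_Suc2)
  have "(\<Sum>u<U. \<Sum>w<U. g u w) = (\<Sum>u<U. (\<Sum>w\<in>{Suc u..<U}. g u w) + (g u u + (\<Sum>w<u. g u w)))"
    by (rule sum.cong[OF refl]) (simp add: split)
  also have "\<dots> = low + ((\<Sum>u<U. g u u) + (\<Sum>u<U. \<Sum>w<u. g u w))"
    unfolding low_def by (simp add: sum.distrib)
  also have "\<dots> = Z ^ (U - 1) * ((\<Sum>c<U * T. a c * b c) + Z * high) + low"
    unfolding mid hi ZU by (simp add: algebra_simps)
  finally have "(\<Sum>t<T. encA U T Z a t * encB U T Z b t) div Z ^ (U - 1) = (\<Sum>c<U * T. a c * b c) + Z * high"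
    unfolding P by (simp only:) (rule div_nat_eqI, use low in simp_all)
  moreover have "(\<Sum>c<U * T. a c * b c) \<le> (\<Sum>c<U * T. 1)" by (intro sum_mono ab)
  then have "(\<Sum>c<U * T. a c * b c) < Z" using assms(2) by simp
  ultimately show ?thesis unfolding dg_def by simp
qed

text \<open>Digit 0 of \<open>J\<close> is the modulus, which plays the part of the random string;
  digit \<open>t + 1\<close> is the residue sent for \<open>A t\<close>. The other party,
  \<open>checkB\<close>, tests primality and uses these residues in place of
  \<open>A\<close>.\<close>

definition checkA :: "nat \<Rightarrow> nat \<Rightarrow> (nat \<Rightarrow> nat) \<Rightarrow> nat \<Rightarrow> bool" where
  "checkA Q T A J \<longleftrightarrow> (\<forall>t<T. dg Q (Suc t) J = A t mod dg Q 0 J)"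

definition checkB :: "nat \<Rightarrow> nat \<Rightarrow> (nat \<Rightarrow> nat) \<Rightarrow> nat \<Rightarrow> nat \<Rightarrow> bool" where
  "checkB Q T B \<mu> J \<longleftrightarrow> prime (dg Q 0 J) \<and>
     (\<Sum>t<T. dg Q (Suc t) J * B t) mod dg Q 0 J = \<mu> mod dg Q 0 J"

text \<open>Once the modulus is fixed, \<open>checkA\<close> leaves exactly one message, so accepted
  messages correspond to accepting primes by way of digit 0. A residue is smaller than its modulus
  and thus fits into a digit.\<close>

lemma card_checks:
  "card {J. J < Q ^ Suc T \<and> checkA Q T A J \<and> checkB Q T B \<mu> J} =
   card {q. q < Q \<and> prime q \<and> (\<Sum>t<T. A t * B t) mod q = \<mu> mod q}"
proof (rule bij_betw_same_card[of "dg Q 0"], rule bij_betw_imageI)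
  let ?J = "{J. J < Q ^ Suc T \<and> checkA Q T A J \<and> checkB Q T B \<mu> J}"
  have msg: "(\<Sum>t<T. dg Q (Suc t) J * B t) mod dg Q 0 J = (\<Sum>t<T. A t * B t) mod dg Q 0 J"
    if "checkA Q T A J" for J
  proof -
    have "(\<Sum>t<T. dg Q (Suc t) J * B t) = (\<Sum>t<T. (A t mod dg Q 0 J) * B t)"
      by (rule sum.cong) (use that in \<open>auto simp: checkA_def\<close>)
    also have "\<dots> mod dg Q 0 J = (\<Sum>t<T. A t * B t) mod dg Q 0 J"
      by (subst (1 2) mod_sum_eq[symmetric]) (simp add: mod_mult_left_eq)
    finally show ?thesis .
  qed
  show "inj_on (dg Q 0) ?J"
  proof (rule inj_onI)
    fix J J' assume *: "J \<in> ?J" "J' \<in> ?J" "dg Q 0 J = dg Q 0 J'"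
    show "J = J'"
    proof (rule dg_inj[of _ Q "Suc T"])
      fix i assume "i < Suc T"
      then show "dg Q i J = dg Q i J'" using * by (cases i) (auto simp: checkA_def)
    qed (use * in auto)
  qed
  show "dg Q 0 ` ?J = {q. q < Q \<and> prime q \<and> (\<Sum>t<T. A t * B t) mod q = \<mu> mod q}"
  proof (intro set_eqI iffI)
    fix q assume "q \<in> dg Q 0 ` ?J"
    then obtain J where J: "J < Q ^ Suc T" "checkA Q T A J" "checkB Q T B \<mu> J" "q = dg Q 0 J" by auto
    have "0 < Q" using J(1) by (cases Q) auto
    then show "q \<in> {q. q < Q \<and> prime q \<and> (\<Sum>t<T. A t * B t) mod q = \<mu> mod q}"
      using J msg[OF J(2)] dg_less[of Q 0 J] by (simp add: checkB_def)
  next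
    fix q assume q: "q \<in> {q. q < Q \<and> prime q \<and> (\<Sum>t<T. A t * B t) mod q = \<mu> mod q}"
    then have q0: "0 < q" "q < Q" using prime_gt_0_nat by auto
    have "(case i of 0 \<Rightarrow> q | Suc t \<Rightarrow> A t mod q) < Q" for i
    proof (cases i)
      case (Suc t)
      have "A t mod q < q" using q0 by simp
      then show ?thesis unfolding Suc nat.case using q0(2) by (rule less_trans)
    qed (use q0 in simp)
    then obtain J where J: "J < Q ^ Suc T" "\<forall>i<Suc T. dg Q i J = (case i of 0 \<Rightarrow> q | Suc t \<Rightarrow> A t mod q)"
      using dg_exists[of "Suc T" "\<lambda>i. case i of 0 \<Rightarrow> q | Suc t \<Rightarrow> A t mod q" Q] by blast
    have J0: "dg Q 0 J = q" using J(2)[rule_format, of 0] by simp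
    have "dg Q (Suc t) J = A t mod q" if "t < T" for t using J(2)[rule_format, of "Suc t"] that by simp
    then have A: "checkA Q T A J" by (simp add: checkA_def J0)
    have "checkB Q T B \<mu> J" unfolding checkB_def J0 msg[OF A, unfolded J0] using q by simp
    then show "q \<in> dg Q 0 ` ?J" using J(1) A J0 by auto
  qed
qed

lemma card_rounds:
  "card {j. j < (Q ^ Suc T) ^ R \<and> (\<forall>r<R. checkA Q T A (dg (Q ^ Suc T) r j)) \<and> (\<forall>r<R. checkB Q T B \<mu> (dg (Q ^ Suc T) r j))} =
   card {q. q < Q \<and> prime q \<and> (\<Sum>t<T. A t * B t) mod q = \<mu> mod q} ^ R"
proof -
  let ?G = "{J. J < Q ^ Suc T \<and> checkA Q T A J \<and> checkB Q T B \<mu> J}"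
  have "{j. j < (Q ^ Suc T) ^ R \<and> (\<forall>r<R. checkA Q T A (dg (Q ^ Suc T) r j)) \<and> (\<forall>r<R. checkB Q T B \<mu> (dg (Q ^ Suc T) r j))} =
     {j. j < (Q ^ Suc T) ^ R \<and> (\<forall>r<R. dg (Q ^ Suc T) r j \<in> ?G)}"
  proof (intro Collect_cong conj_cong refl)
    fix j assume j: "j < (Q ^ Suc T) ^ R"
    show "(\<forall>r<R. checkA Q T A (dg (Q ^ Suc T) r j)) \<and> (\<forall>r<R. checkB Q T B \<mu> (dg (Q ^ Suc T) r j)) \<longleftrightarrow>
       (\<forall>r<R. dg (Q ^ Suc T) r j \<in> ?G)"
    proof (cases "Q ^ Suc T = 0")
      case True
      then have "R = 0" using j by (cases R) auto
      then show ?thesis by simp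
    next
      case False
      then have "dg (Q ^ Suc T) r j < Q ^ Suc T" for r by (intro dg_less) simp
      then show ?thesis by blast
    qed
  qed
  moreover have "card {j. j < (Q ^ Suc T) ^ R \<and> (\<forall>r<R. dg (Q ^ Suc T) r j \<in> ?G)} = card ?G ^ R"
    by (rule card_dg) auto
  ultimately show ?thesis unfolding card_checks by simp
qed

section \<open>Longest common subsequences of aligned strings\<close>

lemma LCS_le: "(\<And>z. subseq z x \<Longrightarrow> subseq z y \<Longrightarrow> length z \<le> b) \<Longrightarrow> LCS x y \<le> b"
  and LCS_ge: "subseq z x \<Longrightarrow> subseq z y \<Longrightarrow> length z \<le> LCS x y"
proof -
  have fin: "finite {length z |z. subseq z x \<and> subseq z y}"
    by (rule finite_subset[of _ "{..length x}"]) (auto dest: list_emb_length)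
  have ne: "{length z |z. subseq z x \<and> subseq z y} \<noteq> {}" using list_emb_Nil by blast
  show "(\<And>z. subseq z x \<Longrightarrow> subseq z y \<Longrightarrow> length z \<le> b) \<Longrightarrow> LCS x y \<le> b"
    unfolding LCS_def using fin ne by (subst Max_le_iff) auto
  show "subseq z x \<Longrightarrow> subseq z y \<Longrightarrow> length z \<le> LCS x y"
    unfolding LCS_def using fin by (intro Max_ge) auto
qed

lemma LCS_aligned:
  assumes "length x = m" "length y = m" "distinct x"
    and al: "\<And>i j. i < m \<Longrightarrow> j < m \<Longrightarrow> x ! i = y ! j \<Longrightarrow> i = j"
  shows "LCS x y = card {i. i < m \<and> x ! i = y ! i}"
proof (rule antisym)
  let ?I = "{i. i < m \<and> x ! i = y ! i}"
  show "LCS x y \<le> card ?I"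
  proof (rule LCS_le)
    fix z assume z: "subseq z x" "subseq z y"
    have "set z \<subseteq> (!) x ` ?I"
    proof
      fix c assume c: "c \<in> set z"
      have "c \<in> set x" by (rule list_emb_set[OF z(1) c]) simp
      moreover have "c \<in> set y" by (rule list_emb_set[OF z(2) c]) simp
      ultimately obtain i j where "i < m" "x ! i = c" "j < m" "y ! j = c" using assms(1,2) by (auto simp: in_set_conv_nth)
      note ij = this
      then have "i = j" by (intro al) simp_all
      then show "c \<in> (!) x ` ?I" using ij by (intro image_eqI[of _ _ i]) simp_all
    qed
    then have "card (set z) \<le> card ?I" using surj_card_le[of ?I] by simp
    moreover have "distinct z" using z(1) assms(3) unfolding subseq_conv_nths by (auto intro: distinct_nthsI)
    ultimately show "length z \<le> card ?I" by (simp add: distinct_card)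
  qed
  let ?J = "filter (\<lambda>i. x ! i = y ! i) [0..<m]"
  have "subseq (map ((!) x) ?J) (map ((!) x) [0..<m])" by (intro subseq_map subseq_filter_left)
  moreover have "map ((!) x) [0..<m] = x" using assms(1) map_nth by blast
  moreover have "subseq (map ((!) y) ?J) (map ((!) y) [0..<m])" by (intro subseq_map subseq_filter_left)
  moreover have "map ((!) y) [0..<m] = y" using assms(2) map_nth by blast
  moreover have "map ((!) x) ?J = map ((!) y) ?J" by (rule map_cong) auto
  ultimately have "length (map ((!) x) ?J) \<le> LCS x y" by (metis LCS_ge)
  moreover have "length ?J = card ?I"
    by (subst distinct_card[symmetric]) (auto intro: arg_cong[of _ _ card])
  ultimately show "card ?I \<le> LCS x y" by simp
qed

lemma OPT_le:
  assumes "finite X" "finite Y" "X \<noteq> {}" "Y \<noteq> {}" "\<And>x y. x \<in> X \<Longrightarrow> y \<in> Y \<Longrightarrow> LCS x y \<le> b"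
  shows "OPT X Y \<le> b"
proof -
  have e: "{LCS x y |x y. x \<in> X \<and> y \<in> Y} = (\<lambda>(x, y). LCS x y) ` (X \<times> Y)" by auto
  show ?thesis unfolding OPT_def e using assms by (subst Max_le_iff) auto
qed

lemma OPT_ge:
  assumes "finite X" "finite Y" "x \<in> X" "y \<in> Y"
  shows "LCS x y \<le> OPT X Y"
proof -
  have e: "{LCS x y |x y. x \<in> X \<and> y \<in> Y} = (\<lambda>(x, y). LCS x y) ` (X \<times> Y)" by auto
  show ?thesis unfolding OPT_def e using assms by (intro Max_ge) auto
qed

text \<open>
  String \<open>i\<close> carries the advice \<open>adv i < w\<close>.  At position \<open>j\<close> it has the symbol
  \<open>adv i * m + j\<close>, which it shares with the other strings with this advice, or a padding symbol,
  which occurs on one side only.  Position \<open>0\<close> holds a symbol that identifies the string.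
\<close>

definition symX :: "nat \<Rightarrow> nat \<Rightarrow> nat \<Rightarrow> nat \<Rightarrow> bool \<Rightarrow> nat \<Rightarrow> nat \<Rightarrow> nat" where
  "symX N m w adv R i j = (if j = 0 then w * m + 2 * m + i else if R then adv * m + j else w * m + j)"

definition symY :: "nat \<Rightarrow> nat \<Rightarrow> nat \<Rightarrow> nat \<Rightarrow> bool \<Rightarrow> nat \<Rightarrow> nat \<Rightarrow> nat" where
  "symY N m w adv R i j = (if j = 0 then w * m + 2 * m + N + i else if R then adv * m + j else w * m + m + j)"

text \<open>The alphabet is divided into consecutive ranges: \<open>w * m\<close> shared symbols,
  \<open>m\<close> padding symbols for each side and \<open>N\<close> identifiers for each side. The
  assumption \<open>room\<close> fits all of them into the alphabet of an instance. The identifiers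
  keep the strings distinct and are never shared.\<close>

locale gadget =
  fixes N m w :: nat and adv :: "nat \<Rightarrow> nat" and RX RY :: "nat \<Rightarrow> nat \<Rightarrow> bool"
  assumes N: "1 \<le> N" and m: "1 \<le> m" and adv: "\<And>i. i < N \<Longrightarrow> adv i < w"
    and room: "w * m + 2 * m + 2 * N \<le> 2 * N * m"
begin

definition xs :: "nat list list" where
  "xs = map (\<lambda>i. map (\<lambda>j. symX N m w (adv i) (RX i j) i j) [0..<m]) [0..<N]"

definition ys :: "nat list list" where
  "ys = map (\<lambda>i. map (\<lambda>j. symY N m w (adv i) (RY i j) i j) [0..<m]) [0..<N]"

lemma real_less: "i < N \<Longrightarrow> j < m \<Longrightarrow> adv i * m + j < w * m"
proof -
  assume *: "i < N" "j < m"
  have "adv i * m + j < (adv i + 1) * m" using * by simp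
  also have "\<dots> \<le> w * m" using adv[OF *(1)] by (intro mult_le_mono1) simp
  finally show ?thesis .
qed

lemma sym_less:
  assumes "i < N" "j < m"
  shows "symX N m w (adv i) R i j < 2 * N * m" "symY N m w (adv i) R i j < 2 * N * m"
  using real_less[OF assms] room assms by (auto simp: symX_def symY_def)

lemma sym_inj:
  assumes "i < N" "j < m" "j' < m"
  shows "symX N m w (adv i) R i j = symX N m w (adv i) R' i j' \<Longrightarrow> j = j'"
    "symY N m w (adv i) R i j = symY N m w (adv i) R' i j' \<Longrightarrow> j = j'"
  using real_less[OF assms(1,2)] real_less[OF assms(1,3)] assms
  by (auto simp: symX_def symY_def split: if_splits)

lemma mult_add_eqD:
  fixes a b c d n :: nat
  assumes "a * n + b = c * n + d" "b < n" "d < n"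
  shows "a = c \<and> b = d"
proof -
  have "(a * n + b) div n = a" "(c * n + d) div n = c" using assms(2,3) by simp_all
  then have "a = c" using assms(1) by metis
  then show ?thesis using assms(1) by simp
qed

lemma sym_eq_iff:
  assumes "i < N" "i' < N" "j < m" "j' < m"
  shows "symX N m w (adv i) R i j = symY N m w (adv i') R' i' j' \<longleftrightarrow> 0 < j \<and> j = j' \<and> R \<and> R' \<and> adv i = adv i'"
  using real_less[OF assms(1,3)] real_less[OF assms(2,4)] assms mult_add_eqD[of "adv i" m j "adv i'" j']
  by (auto simp: symX_def symY_def split: if_splits)

lemma instance_gadget: "LCS_instance N m xs ys"
proof -
  have "distinct xs"
    unfolding xs_def distinct_map
  proof (intro conjI inj_onI)
    fix i i' assume i: "i \<in> set [0..<N]" "i' \<in> set [0..<N]"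
      "map (\<lambda>j. symX N m w (adv i) (RX i j) i j) [0..<m] = map (\<lambda>j. symX N m w (adv i') (RX i' j) i' j) [0..<m]"
    then have "symX N m w (adv i) (RX i 0) i 0 = symX N m w (adv i') (RX i' 0) i' 0" using m by simp
    then show "i = i'" by (simp add: symX_def)
  qed simp
  moreover have "distinct ys"
    unfolding ys_def distinct_map
  proof (intro conjI inj_onI)
    fix i i' assume i: "i \<in> set [0..<N]" "i' \<in> set [0..<N]"
      "map (\<lambda>j. symY N m w (adv i) (RY i j) i j) [0..<m] = map (\<lambda>j. symY N m w (adv i') (RY i' j) i' j) [0..<m]"
    then have "symY N m w (adv i) (RY i 0) i 0 = symY N m w (adv i') (RY i' 0) i' 0" using m by simp
    then show "i = i'" by (simp add: symY_def)
  qed simp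
  moreover have "set xs \<subseteq> permutation_strings {..<2 * N * m} m"
  proof
    fix x assume "x \<in> set xs"
    then obtain i where i: "i < N" and x: "x = map (\<lambda>j. symX N m w (adv i) (RX i j) i j) [0..<m]"
      by (auto simp: xs_def)
    have "distinct x" unfolding x distinct_map
      by (intro conjI inj_onI distinct_upt) (rule sym_inj(1)[OF i], auto)
    moreover have "set x \<subseteq> {..<2 * N * m}" unfolding x using sym_less(1)[OF i] by auto
    ultimately show "x \<in> permutation_strings {..<2 * N * m} m" by (simp add: permutation_strings_def x)
  qed
  moreover have "set ys \<subseteq> permutation_strings {..<2 * N * m} m"
  proof
    fix x assume "x \<in> set ys"
    then obtain i where i: "i < N" and x: "x = map (\<lambda>j. symY N m w (adv i) (RY i j) i j) [0..<m]"
      by (auto simp: ys_def)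
    have "distinct x" unfolding x distinct_map
      by (intro conjI inj_onI distinct_upt) (rule sym_inj(2)[OF i], auto)
    moreover have "set x \<subseteq> {..<2 * N * m}" unfolding x using sym_less(2)[OF i] by auto
    ultimately show "x \<in> permutation_strings {..<2 * N * m} m" by (simp add: permutation_strings_def x)
  qed
  ultimately show ?thesis unfolding LCS_instance_def by (simp add: xs_def ys_def)
qed

lemma LCS_gadget:
  assumes "i < N" "i' < N"
  shows "LCS (xs ! i) (ys ! i') = (if adv i = adv i' then card {j. 0 < j \<and> j < m \<and> RX i j \<and> RY i' j} else 0)"
proof -
  have nth: "xs ! i = map (\<lambda>j. symX N m w (adv i) (RX i j) i j) [0..<m]"
    "ys ! i' = map (\<lambda>j. symY N m w (adv i') (RY i' j) i' j) [0..<m]"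
    using assms by (simp_all add: xs_def ys_def)
  have "LCS (xs ! i) (ys ! i') = card {j. j < m \<and> xs ! i ! j = ys ! i' ! j}"
  proof (rule LCS_aligned)
    show "distinct (xs ! i)" unfolding nth distinct_map
      by (intro conjI inj_onI distinct_upt) (rule sym_inj(1)[OF assms(1)], auto)
    show "j = j'" if "j < m" "j' < m" "xs ! i ! j = ys ! i' ! j'" for j j'
      using that sym_eq_iff[OF assms that(1,2)] unfolding nth by simp
  qed (simp_all add: nth)
  also have "{j. j < m \<and> xs ! i ! j = ys ! i' ! j} =
      {j. j < m \<and> 0 < j \<and> RX i j \<and> RY i' j \<and> adv i = adv i'}"
    using sym_eq_iff[OF assms] by (auto simp: nth)
  finally show ?thesis by (auto intro: arg_cong[of _ _ card])
qed

lemma OPT_gadget_le: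
  assumes "\<And>i i'. i < N \<Longrightarrow> i' < N \<Longrightarrow> adv i = adv i' \<Longrightarrow> card {j. 0 < j \<and> j < m \<and> RX i j \<and> RY i' j} \<le> b"
  shows "OPT (set xs) (set ys) \<le> b"
proof (rule OPT_le)
  show "set xs \<noteq> {}" "set ys \<noteq> {}" using N by (auto simp: xs_def ys_def)
  fix x y assume "x \<in> set xs" "y \<in> set ys"
  then obtain i i' where "i < N" "i' < N" "x = xs ! i" "y = ys ! i'"
    by (auto simp: in_set_conv_nth xs_def ys_def)
  then show "LCS x y \<le> b" using LCS_gadget assms by simp
qed auto

lemma OPT_gadget_ge:
  assumes "i < N" "i' < N" "adv i = adv i'"
  shows "card {j. 0 < j \<and> j < m \<and> RX i j \<and> RY i' j} \<le> OPT (set xs) (set ys)"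
proof -
  have "LCS (xs ! i) (ys ! i') \<le> OPT (set xs) (set ys)"
    by (rule OPT_ge[OF _ _ nth_mem nth_mem]) (use assms in \<open>simp_all add: xs_def ys_def\<close>)
  then show ?thesis using LCS_gadget[OF assms(1,2)] assms(3) by simp
qed

end

section \<open>The encoded instance, symbol by symbol\<close>

lemma concat_map_map:
  "concat (map (\<lambda>i. map (f i) [0..<m]) [0..<N]) = map (\<lambda>q. f (q div m) (q mod m)) [0..<N * m]"
proof (induction N)
  case (Suc N)
  have "[0..<Suc N * m] = [0..<N * m] @ map (\<lambda>j. N * m + j) [0..<m]"
    using upt_add_eq_append[of 0 "N * m" m] map_add_upt[of "N * m" m] by (simp add: add.commute)
  then show ?case using Suc by (simp add: o_def)
qed simp

text \<open>A closed form for each entry of the encoded instance, so that a program can compute the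
  entries independently of each other.\<close>

definition symbol :: "nat \<Rightarrow> nat \<Rightarrow> nat \<Rightarrow> (nat \<Rightarrow> nat) \<Rightarrow> (nat \<Rightarrow> nat \<Rightarrow> bool) \<Rightarrow> (nat \<Rightarrow> nat \<Rightarrow> bool) \<Rightarrow> nat \<Rightarrow> nat" where
  "symbol N m w adv RX RY q = (if q = 0 then N else if q = 1 then m
     else if q - 2 < N * m then symX N m w (adv ((q - 2) div m)) (RX ((q - 2) div m) ((q - 2) mod m)) ((q - 2) div m) ((q - 2) mod m)
     else symY N m w (adv ((q - 2 - N * m) div m)) (RY ((q - 2 - N * m) div m) ((q - 2 - N * m) mod m))
            ((q - 2 - N * m) div m) ((q - 2 - N * m) mod m))"

lemma (in gadget) encode_gadget:
  "encode_LCS N m xs ys = map (symbol N m w adv RX RY) [0..<2 + 2 * N * m]"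
proof (rule nth_equalityI)
  show len: "length (encode_LCS N m xs ys) = length (map (symbol N m w adv RX RY) [0..<2 + 2 * N * m])"
    unfolding encode_LCS_def xs_def ys_def concat_map_map by simp
  fix q assume "q < length (encode_LCS N m xs ys)"
  then have q: "q < 2 + 2 * N * m" using len by simp
  let ?f = "\<lambda>q. symX N m w (adv (q div m)) (RX (q div m) (q mod m)) (q div m) (q mod m)"
  let ?g = "\<lambda>q. symY N m w (adv (q div m)) (RY (q div m) (q mod m)) (q div m) (q mod m)"
  have e: "encode_LCS N m xs ys = N # m # map ?f [0..<N * m] @ map ?g [0..<N * m]"
    unfolding encode_LCS_def xs_def ys_def concat_map_map ..
  consider "q = 0" | "q = 1" | r where "q = Suc (Suc r)" "r < N * m"
    | r where "q = Suc (Suc r)" "\<not> r < N * m" "r - N * m < N * m"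
  proof -
    have "q < 2 + (N * m + N * m)" using q by simp
    then show thesis using that(1,2) that(3,4)[of "q - 2"] by (cases "q < 2 + N * m") force+
  qed
  then have "encode_LCS N m xs ys ! q = symbol N m w adv RX RY q"
  proof cases
    case 3
    then show ?thesis unfolding e by (simp add: nth_append symbol_def)
  next
    case 4
    then show ?thesis unfolding e by (simp add: nth_append symbol_def)
  qed (simp_all add: e symbol_def)
  then show "encode_LCS N m xs ys ! q = map (symbol N m w adv RX RY) [0..<2 + 2 * N * m] ! q"
    using q by (simp del: upt_Suc)
qed

section \<open>The reduction\<close>

definition litcode :: "literal \<Rightarrow> nat" where
  "litcode l = (case l of (x, b) \<Rightarrow> 2 * x + of_bool b)"

definition block :: "clause \<Rightarrow> nat list" where
  "block c = length c # map litcode c"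

lemma encode_cnf_blocks: "encode_cnf n F = n # length F # concat (map block F)"
  unfolding encode_cnf_def block_def litcode_def ..

text \<open>The address of the length entry of clause \<open>j\<close>. The recursion starts at 2,
  behind the two header entries.\<close>

definition clause_pos :: "(nat \<Rightarrow> nat) \<Rightarrow> nat \<Rightarrow> nat" where
  "clause_pos I j = rec_nat 2 (\<lambda>i p. p + 1 + I p) j"

definition input :: "nat \<Rightarrow> clause list \<Rightarrow> nat \<Rightarrow> nat" where
  "input n F = input_memory (encode_cnf n F) 0"

lemma input_simps: "input n F 0 = n" "input n F 1 = length F" "input n F (Suc 0) = length F"
  by (auto simp: input_def input_memory_def encode_cnf_blocks)

lemma input_clause:
  assumes "j < length F"
  shows "i < length (block (F ! j)) \<Longrightarrow> input n F (clause_pos (input n F) j + i) = block (F ! j) ! i"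
    and "clause_pos (input n F) j = 2 + length (concat (map block (take j F)))"
proof -
  have split: "concat (map block F) = concat (map block (take j F)) @ block (F ! j) @ concat (map block (drop (Suc j) F))"
    if "j < length F" for j
  proof -
    have "concat (map block F) = concat (map block (take j F @ F ! j # drop (Suc j) F))"
      using id_take_nth_drop[OF that] by simp
    then show ?thesis by simp
  qed
  have at: "input n F (2 + length (concat (map block (take j F))) + i) = block (F ! j) ! i"
    if "j < length F" "i < length (block (F ! j))" for i j
    using that unfolding input_def input_memory_def encode_cnf_blocks split[OF that(1)]
    by (simp add: nth_append)
  show pos: "clause_pos (input n F) j = 2 + length (concat (map block (take j F)))"
    using assms
  proof (induction j)
    case 0 show ?case by (simp add: clause_pos_def)
  next
    case (Suc j)
    then have j: "j < length F" by simp
    have "clause_pos (input n F) (Suc j) = clause_pos (input n F) j + 1 + input n F (clause_pos (input n F) j)"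
      by (simp add: clause_pos_def)
    also have "clause_pos (input n F) j = 2 + length (concat (map block (take j F)))" using Suc j by simp
    also have "input n F (2 + length (concat (map block (take j F)))) = length (F ! j)"
      using at[OF j, of 0] by (simp add: block_def)
    finally show ?case using j by (simp add: take_Suc_conv_app_nth block_def)
  qed
  show "i < length (block (F ! j)) \<Longrightarrow> input n F (clause_pos (input n F) j + i) = block (F ! j) ! i"
    unfolding pos using at[OF assms] by simp
qed

locale reduction =
  fixes k n0 :: nat
begin

text \<open>
  The formula is regarded as one over \<open>2 * vv\<close> variables, and \<open>n0\<close> makes all parameters sufficiently
  large.  With \<open>v = vv\<close> and \<open>l = log v\<close>: \<open>al\<close> is the parameter \<open>\<alpha>\<close> of the sparsification and
  \<open>sd\<close> its number of petal branches; the at most \<open>UU * TT\<close> remaining clauses are arranged in \<open>TT\<close>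
  integers of \<open>UU\<close> digits in base \<open>ZZ\<close>, the moduli are the primes below \<open>ZZ\<close>, and the protocol
  is repeated \<open>RR\<close> times.  A path of the sparsification and a claimed inner product take \<open>nn\<close>
  bits each.  The factor \<open>bb = l ^ log l\<close> exceeds every fixed power of \<open>l\<close>, so that \<open>NN\<close> and \<open>mm\<close>
  do not depend on \<open>k\<close>.
\<close>

definition vv :: "(nat \<Rightarrow> nat) \<Rightarrow> nat" where "vv I = I 0 div 2 + n0"
definition el :: "(nat \<Rightarrow> nat) \<Rightarrow> nat" where "el I = floor_log (vv I)"
definition LL :: "(nat \<Rightarrow> nat) \<Rightarrow> nat" where "LL I = 4 * vv I"
definition al :: "(nat \<Rightarrow> nat) \<Rightarrow> nat" where "al I = el I ^ 3"
definition bb :: "(nat \<Rightarrow> nat) \<Rightarrow> nat" where "bb I = el I ^ floor_log (el I)"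
definition TT :: "(nat \<Rightarrow> nat) \<Rightarrow> nat" where "TT I = bb I * el I ^ 5"
definition UU :: "(nat \<Rightarrow> nat) \<Rightarrow> nat" where "UU I = vv I div el I ^ 3 + 1"
definition ZZ :: "(nat \<Rightarrow> nat) \<Rightarrow> nat" where "ZZ I = vv I ^ 2"
definition RR :: "(nat \<Rightarrow> nat) \<Rightarrow> nat" where "RR I = vv I div (bb I * el I ^ 8)"
definition nn :: "(nat \<Rightarrow> nat) \<Rightarrow> nat" where "nn I = vv I div el I"
definition hh :: "(nat \<Rightarrow> nat) \<Rightarrow> nat" where "hh I = vv I + 2 * nn I"
definition NN :: "(nat \<Rightarrow> nat) \<Rightarrow> nat" where "NN I = 2 ^ hh I"
definition mm :: "(nat \<Rightarrow> nat) \<Rightarrow> nat" where "mm I = 2 ^ (hh I div floor_log (hh I))"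
definition sd :: "(nat \<Rightarrow> nat) \<Rightarrow> nat" where "sd I = k * LL I div al I"
definition MM :: "(nat \<Rightarrow> nat) \<Rightarrow> nat" where "MM I = sparse_params.M k (LL I)"

definition lit :: "(nat \<Rightarrow> nat) \<Rightarrow> nat \<Rightarrow> nat set" where
  "lit I D = sparse_params.lits k (LL I) D"

definition mins :: "(nat \<Rightarrow> nat) \<Rightarrow> nat set \<Rightarrow> nat set" where
  "mins I Y = sparse_params.cact k (LL I) Y"

definition clit :: "(nat \<Rightarrow> nat) \<Rightarrow> nat \<Rightarrow> nat set" where
  "clit I j = {x. x < LL I \<and> (\<exists>e<k. e < I (clause_pos I j) \<and> I (clause_pos I j + Suc e) = x)}"

definition Y0 :: "(nat \<Rightarrow> nat) \<Rightarrow> nat set" where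
  "Y0 I = {D. D < MM I \<and> sparse_params.canon k (LL I) D \<and> (\<exists>j<I 1. lit I D = clit I j)}"

text \<open>A path is stored as the list of the at most \<open>sd I\<close> steps that choose
  petals, increased by one since digit 0 is padding. A bit for each of the \<open>MM I\<close> steps
  would be too expensive, as \<open>MM I\<close> is of order \<open>vv I ^ k\<close>.\<close>

definition pet :: "(nat \<Rightarrow> nat) \<Rightarrow> nat \<Rightarrow> nat \<Rightarrow> bool" where
  "pet I \<sigma> t \<longleftrightarrow> (\<exists>i<sd I. dg (Suc (MM I)) i \<sigma> = Suc t)"

definition YY :: "(nat \<Rightarrow> nat) \<Rightarrow> nat \<Rightarrow> nat set" where
  "YY I \<sigma> = sparse_params.run k (LL I) (al I) (Y0 I) (pet I \<sigma>) (MM I)"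

text \<open>
  The offset is \<open>0\<close> for the literals of the first half of the variables and \<open>2 * vv I\<close> for those of
  the second half.
\<close>

definition falsified :: "(nat \<Rightarrow> nat) \<Rightarrow> nat \<Rightarrow> nat \<Rightarrow> nat \<Rightarrow> bool" where
  "falsified I off z D \<longleftrightarrow> (\<forall>l<2 * vv I. l + off \<in> lit I D \<longrightarrow> odd (z div 2 ^ (l div 2)) \<noteq> odd l)"

definition rank :: "(nat \<Rightarrow> nat) \<Rightarrow> nat set \<Rightarrow> nat \<Rightarrow> nat" where
  "rank I Y D = card {E. E < MM I \<and> E \<in> mins I Y \<and> E < D}"

text \<open>Coordinate \<open>c\<close> of the vector of a half assignment: whether the minimal
  clause with number \<open>c\<close> has no true literal in this half. Coordinates beyond the last
  clause are 0.\<close>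

definition viol :: "(nat \<Rightarrow> nat) \<Rightarrow> nat set \<Rightarrow> nat \<Rightarrow> nat \<Rightarrow> nat \<Rightarrow> nat" where
  "viol I Y off z c = of_bool (\<exists>D<MM I. D \<in> mins I Y \<and> rank I Y D = c \<and> falsified I off z D)"

text \<open>A string index has three blocks of bits: the lowest \<open>vv I\<close> are the
  assignment, the next \<open>nn I\<close> the path, and the highest \<open>nn I\<close> the claimed
  product. All combinations occur.\<close>

definition adv :: "(nat \<Rightarrow> nat) \<Rightarrow> nat \<Rightarrow> nat" where "adv I i = i div 2 ^ vv I"
definition asg :: "(nat \<Rightarrow> nat) \<Rightarrow> nat \<Rightarrow> nat" where "asg I i = i mod 2 ^ vv I"
definition path :: "(nat \<Rightarrow> nat) \<Rightarrow> nat \<Rightarrow> nat" where "path I i = adv I i mod 2 ^ nn I"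
definition claim :: "(nat \<Rightarrow> nat) \<Rightarrow> nat \<Rightarrow> nat" where "claim I i = adv I i div 2 ^ nn I"

definition msgA :: "(nat \<Rightarrow> nat) \<Rightarrow> nat \<Rightarrow> nat \<Rightarrow> nat" where
  "msgA I i = encA (UU I) (TT I) (ZZ I) (viol I (YY I (path I i)) 0 (asg I i))"

definition msgB :: "(nat \<Rightarrow> nat) \<Rightarrow> nat \<Rightarrow> nat \<Rightarrow> nat" where
  "msgB I i = encB (UU I) (TT I) (ZZ I) (viol I (YY I (path I i)) (2 * vv I) (asg I i))"

text \<open>\<open>j - 1\<close> appears because position 0 is taken by the identifier; its digits
  in base \<open>ZZ I ^ Suc (TT I)\<close> are the messages of the \<open>RR I\<close>
  rounds.\<close>

definition RX :: "(nat \<Rightarrow> nat) \<Rightarrow> nat \<Rightarrow> nat \<Rightarrow> bool" where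
  "RX I i j \<longleftrightarrow> j - 1 < (ZZ I ^ Suc (TT I)) ^ RR I \<and>
     (\<forall>r<RR I. checkA (ZZ I) (TT I) (msgA I i) (dg (ZZ I ^ Suc (TT I)) r (j - 1)))"

text \<open>Orthogonality is read off the claim, whose digit \<open>UU I - 1\<close> purports to be
  the inner product; the rounds only test the claim against the true product.\<close>

definition RY :: "(nat \<Rightarrow> nat) \<Rightarrow> nat \<Rightarrow> nat \<Rightarrow> bool" where
  "RY I i j \<longleftrightarrow> j - 1 < (ZZ I ^ Suc (TT I)) ^ RR I \<and> dg (ZZ I) (UU I - 1) (claim I i) = 0 \<and>
     (\<forall>r<RR I. checkB (ZZ I) (TT I) (msgB I i) (claim I i) (dg (ZZ I ^ Suc (TT I)) r (j - 1)))"

definition out :: "(nat \<Rightarrow> nat) \<Rightarrow> nat \<Rightarrow> nat" where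
  "out I q = symbol (NN I) (mm I) (2 ^ (2 * nn I)) (adv I) (RX I) (RY I) q"

definition gg :: "(nat \<Rightarrow> nat) \<Rightarrow> nat" where
  "gg I = card {q. q < ZZ I \<and> prime q}"

text \<open>The requirements serve, in this order, the counting in the sparsification, the code of a
  path, the room for all clauses in the grid, the absence of carries, the code of the claim, the
  soundness error, the number of positions in a string, and the size of the alphabet.\<close>

definition roomy :: "(nat \<Rightarrow> nat) \<Rightarrow> bool" where
  "roomy I \<longleftrightarrow> 1 \<le> n0 \<and> 2 * k + 2 \<le> al I \<and> Suc (MM I) ^ sd I \<le> 2 ^ nn I \<and>
     (k + 1) * (LL I * al I ^ (3 * k)) \<le> UU I * TT I \<and> UU I * TT I < ZZ I \<and> 2 \<le> ZZ I \<and>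
     ZZ I ^ (2 * UU I + 1) \<le> 2 ^ nn I \<and> 2 * nn I \<le> gg I \<and>
     (ZZ I ^ Suc (TT I)) ^ RR I + 1 \<le> mm I \<and>
     2 ^ (2 * nn I) * mm I + 2 * mm I + 2 * NN I \<le> 2 * NN I * mm I"

end

section \<open>Correctness of the reduction\<close>

locale roomy_reduction = reduction +
  fixes n :: nat and F :: "clause list" and I
  assumes kcnf: "kcnf k n F" and I: "I = input n F" and roomy: "roomy I"
begin

sublocale sparsification k "LL I" "al I"
  by unfold_locales (use roomy in \<open>simp add: roomy_def\<close>)

sublocale gadget "NN I" "mm I" "2 ^ (2 * nn I)" "adv I" "RX I" "RY I"
proof
  fix i assume "i < NN I"
  then show "adv I i < 2 ^ (2 * nn I)"
    unfolding adv_def NN_def hh_def by (intro less_mult_imp_div_less) (simp add: power_add mult.commute)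
qed (use roomy in \<open>auto simp: NN_def mm_def roomy_def\<close>)

lemma rf:
  "2 * k + 2 \<le> al I" "Suc M ^ sd I \<le> 2 ^ nn I" "(k + 1) * (LL I * al I ^ (3 * k)) \<le> UU I * TT I"
  "UU I * TT I < ZZ I" "2 \<le> ZZ I" "ZZ I ^ (2 * UU I + 1) \<le> 2 ^ nn I" "2 * nn I \<le> gg I"
  "(ZZ I ^ Suc (TT I)) ^ RR I + 1 \<le> mm I" "1 \<le> n0"
  using roomy unfolding roomy_def MM_def by blast+

lemma n_le: "2 * n \<le> LL I"
  using rf(9) by (simp add: LL_def vv_def I input_simps)

lemma clit_eq:
  assumes "j < length F"
  shows "clit I j = litcode ` set (F ! j)"
proof -
  let ?c = "F ! j"
  have c: "?c \<in> set F" using assms by simp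
  then have len: "length ?c \<le> k" and vars: "\<And>x b. (x, b) \<in> set ?c \<Longrightarrow> x < n"
    using kcnf by (auto simp: kcnf_def)
  have I0: "I (clause_pos I j) = length ?c"
    using input_clause(1)[OF assms, of 0 n] by (simp add: I block_def)
  have Ie: "I (clause_pos I j + Suc e) = litcode (?c ! e)" if "e < length ?c" for e
    using input_clause(1)[OF assms, of "Suc e" n] that by (simp add: I block_def)
  have less: "litcode l < LL I" if "l \<in> set ?c" for l
    using vars[of "fst l" "snd l"] that n_le by (cases l) (auto simp: litcode_def of_bool_def)
  show ?thesis
  proof (intro set_eqI iffI)
    fix x assume "x \<in> clit I j"
    then obtain e where "e < length ?c" "I (clause_pos I j + Suc e) = x" unfolding clit_def I0 by blast
    then show "x \<in> litcode ` set ?c" using Ie by auto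
  next
    fix x assume "x \<in> litcode ` set ?c"
    then obtain e where e: "e < length ?c" "x = litcode (?c ! e)" by (auto simp: in_set_conv_nth)
    then show "x \<in> clit I j" unfolding clit_def I0 using Ie[OF e(1)] less[of "?c ! e"] len
      by (auto intro!: exI[of _ e])
  qed
qed

lemma Y0_canon: "Y0 I \<subseteq> {D. canon D}"
  by (auto simp: Y0_def)

lemma lits_Y0: "lits ` Y0 I = (\<lambda>c. litcode ` set c) ` set F"
proof (intro set_eqI iffI)
  fix X assume "X \<in> lits ` Y0 I"
  then obtain j where "j < length F" "X = clit I j" by (auto simp: Y0_def lit_def I input_simps)
  then show "X \<in> (\<lambda>c. litcode ` set c) ` set F" using clit_eq by auto
next
  fix X assume "X \<in> (\<lambda>c. litcode ` set c) ` set F"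
  then obtain j where j: "j < length F" "X = litcode ` set (F ! j)" by (auto simp: in_set_conv_nth)
  then have X: "X = clit I j" using clit_eq by simp
  then have "X \<subseteq> {..<LL I}" by (auto simp: clit_def)
  moreover have "card X \<le> length (F ! j)" unfolding j(2) using card_image_le card_length le_trans by blast
  then have "card X \<le> k" using kcnf j(1) by (auto simp: kcnf_def dest!: nth_mem)
  ultimately obtain D where "canon D" "lits D = X" using canon_exists by blast
  then have "D \<in> Y0 I" using X j(1) canon_less by (auto simp: Y0_def lit_def MM_def I input_simps)
  then show "X \<in> lits ` Y0 I" using \<open>lits D = X\<close> by blast
qed

definition Tr :: "(nat \<Rightarrow> bool) \<Rightarrow> nat set" where
  "Tr va = {l. va (l div 2) = odd l}"

lemma satisfiable_iff: "satisfiable F \<longleftrightarrow> (\<exists>va. hits (Tr va) (lits ` Y0 I))"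
proof -
  have e: "litcode l \<in> Tr va \<longleftrightarrow> (case l of (x, b) \<Rightarrow> va x = b)" for l va
    by (cases l; cases "snd l") (auto simp: Tr_def litcode_def)
  have "hits (Tr va) (lits ` Y0 I) \<longleftrightarrow> (\<forall>c\<in>set F. \<exists>l\<in>set c. litcode l \<in> Tr va)" for va
    unfolding hits_def lits_Y0 by blast
  then show ?thesis unfolding satisfiable_def e by simp
qed

lemma YY_canon: "YY I \<sigma> \<subseteq> {D. canon D}" "Y0 I \<subseteq> YY I \<sigma>"
  unfolding YY_def using run_Inv[OF Y0_canon] by blast+

lemma finite_mins: "finite (mins I Y)" if "Y \<subseteq> {D. canon D}"
proof (rule finite_subset[of _ "{..<M}"])
  show "mins I Y \<subseteq> {..<M}" using that canon_less cact_sub unfolding mins_def by blast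
qed simp

lemma mins_less: "D \<in> mins I (YY I \<sigma>) \<Longrightarrow> D < MM I"
  using YY_canon canon_less cact_sub unfolding mins_def MM_def by blast

lemma card_mins: "card (mins I (YY I \<sigma>)) \<le> UU I * TT I"
proof -
  have "kfamily (lits ` YY I \<sigma>)" using lits_sub card_lits by (auto simp: kfamily_def)
  moreover have "\<not> flower (lits ` YY I \<sigma>) c s H" for c s H
    unfolding YY_def MM_def by (rule run_no_flower[OF Y0_canon])
  moreover have "1 \<le> LL I" using rf(9) by (simp add: LL_def vv_def)
  ultimately have "card (act (lits ` YY I \<sigma>)) \<le> (k + 1) * (LL I * al I ^ (3 * k))" by (rule card_act_le)
  moreover have "card (act (lits ` YY I \<sigma>)) = card (mins I (YY I \<sigma>))"
    unfolding act_lits mins_def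
    by (rule card_image) (rule inj_on_subset[OF inj_lits[OF YY_canon(1)] cact_sub])
  ultimately show ?thesis using rf(3) by linarith
qed

lemma rank_eq: "rank I (YY I \<sigma>) D = card {E \<in> mins I (YY I \<sigma>). E < D}"
  unfolding rank_def using mins_less by (intro arg_cong[of _ _ card]) auto

lemma rank_inj:
  assumes "D \<in> mins I (YY I \<sigma>)" "D' \<in> mins I (YY I \<sigma>)" "D < D'"
  shows "rank I (YY I \<sigma>) D < rank I (YY I \<sigma>) D'"
  unfolding rank_eq by (rule psubset_card_mono) (use finite_mins[OF YY_canon(1)] assms in auto)

lemma rank_less: "D \<in> mins I (YY I \<sigma>) \<Longrightarrow> rank I (YY I \<sigma>) D < UU I * TT I"
proof -
  assume D: "D \<in> mins I (YY I \<sigma>)"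
  have "rank I (YY I \<sigma>) D < card (mins I (YY I \<sigma>))"
    unfolding rank_eq by (rule psubset_card_mono) (use finite_mins[OF YY_canon(1)] D in auto)
  then show ?thesis using card_mins by (meson less_le_trans)
qed

lemma falsified_iff:
  assumes D: "D \<in> mins I (YY I \<sigma>)" and va: "\<And>u. u < 2 * vv I \<Longrightarrow>
    va u = (if u < vv I then odd (x div 2 ^ u) else odd (y div 2 ^ (u - vv I)))"
  shows "falsified I 0 x D \<and> falsified I (2 * vv I) y D \<longleftrightarrow> lits D \<inter> Tr va = {}"
proof
  assume f: "falsified I 0 x D \<and> falsified I (2 * vv I) y D"
  have "l \<notin> Tr va" if l: "l \<in> lits D" for l
  proof (cases "l < 2 * vv I")
    case True
    then have "odd (x div 2 ^ (l div 2)) \<noteq> odd l" using f l by (simp add: falsified_def lit_def)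
    then show ?thesis using True va[of "l div 2"] by (auto simp: Tr_def)
  next
    case False
    define l' where "l' = l - 2 * vv I"
    have l': "l = l' + 2 * vv I" "l' < 2 * vv I" using False l lits_sub[of D] by (auto simp: l'_def LL_def)
    then have "odd (y div 2 ^ (l' div 2)) \<noteq> odd l'" using f l by (simp add: falsified_def lit_def)
    then show ?thesis using l' va[of "l div 2"] by (auto simp: Tr_def)
  qed
  then show "lits D \<inter> Tr va = {}" by blast
next
  assume dis: "lits D \<inter> Tr va = {}"
  show "falsified I 0 x D \<and> falsified I (2 * vv I) y D"
    unfolding falsified_def lit_def
  proof (intro conjI allI impI)
    fix l assume l: "l < 2 * vv I" "l + 0 \<in> lits D"
    then have "l \<notin> Tr va" using dis by auto
    moreover have "l div 2 < vv I" using l(1) by simp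
    ultimately show "odd (x div 2 ^ (l div 2)) \<noteq> odd l" using va[of "l div 2"] by (auto simp: Tr_def)
  next
    fix l assume l: "l < 2 * vv I" "l + 2 * vv I \<in> lits D"
    then have "l + 2 * vv I \<notin> Tr va" using dis by auto
    moreover have "l div 2 < vv I" using l(1) by simp
    ultimately show "odd (y div 2 ^ (l div 2)) \<noteq> odd l" using va[of "l div 2 + vv I"] by (auto simp: Tr_def add.commute)
  qed
qed

lemma viol_le: "viol I Y off z c \<le> 1"
  by (simp add: viol_def)

lemma card_shared:
  assumes "adv I i = adv I i'"
  shows "card {j. 0 < j \<and> j < mm I \<and> RX I i j \<and> RY I i' j} =
    (if dg (ZZ I) (UU I - 1) (claim I i) = 0
     then card {q. q < ZZ I \<and> prime q \<and> (\<Sum>t<TT I. msgA I i t * msgB I i' t) mod q = claim I i mod q} ^ RR I else 0)"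
proof (cases "dg (ZZ I) (UU I - 1) (claim I i) = 0")
  case True
  have c: "claim I i' = claim I i" using assms by (simp add: claim_def)
  let ?S = "{j. j < (ZZ I ^ Suc (TT I)) ^ RR I \<and>
      (\<forall>r<RR I. checkA (ZZ I) (TT I) (msgA I i) (dg (ZZ I ^ Suc (TT I)) r j)) \<and>
      (\<forall>r<RR I. checkB (ZZ I) (TT I) (msgB I i') (claim I i) (dg (ZZ I ^ Suc (TT I)) r j))}"
  have "{j. 0 < j \<and> j < mm I \<and> RX I i j \<and> RY I i' j} = Suc ` ?S"
  proof (intro set_eqI iffI)
    fix j assume "j \<in> {j. 0 < j \<and> j < mm I \<and> RX I i j \<and> RY I i' j}"
    then show "j \<in> Suc ` ?S" by (intro image_eqI[of _ _ "j - 1"]) (auto simp: RX_def RY_def c)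
  next
    fix j assume "j \<in> Suc ` ?S"
    then show "j \<in> {j. 0 < j \<and> j < mm I \<and> RX I i j \<and> RY I i' j}"
      using rf(8) True by (auto simp: RX_def RY_def c)
  qed
  then have "card {j. 0 < j \<and> j < mm I \<and> RX I i j \<and> RY I i' j} = card ?S" by (simp add: card_image)
  then show ?thesis using True unfolding card_rounds by simp
next
  case False
  have "claim I i' = claim I i" using assms by (simp add: claim_def)
  then have "{j. 0 < j \<and> j < mm I \<and> RX I i j \<and> RY I i' j} = {}" using False by (auto simp: RY_def)
  then show ?thesis using False by simp
qed

lemma product_digit:
  assumes "adv I i = adv I i'"
  shows "dg (ZZ I) (UU I - 1) (\<Sum>t<TT I. msgA I i t * msgB I i' t) =
    (\<Sum>c<UU I * TT I. viol I (YY I (path I i)) 0 (asg I i) c * viol I (YY I (path I i)) (2 * vv I) (asg I i') c)"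
proof -
  have p: "path I i' = path I i" using assms by (simp add: path_def)
  show ?thesis unfolding msgA_def msgB_def p
    by (rule enc_product_digit) (use rf viol_le in \<open>auto simp: UU_def\<close>)
qed

lemma product_less: "(\<Sum>t<TT I. msgA I i t * msgB I i' t) < 2 ^ nn I"
proof -
  have "TT I \<le> UU I * TT I" by (simp add: UU_def)
  then have "TT I < ZZ I" using rf(4) by linarith
  then have "(\<Sum>t<TT I. msgA I i t * msgB I i' t) < ZZ I ^ (2 * UU I + 1)"
    unfolding msgA_def msgB_def by (intro enc_product_less) (use rf viol_le in auto)
  then show ?thesis using rf(6) by linarith
qed

text \<open>The honest advice consists of the path that a satisfying assignment takes through the
  branching and of the true product. All primes then accept in all rounds.\<close>

lemma completeness:
  assumes "satisfiable F"
  shows "gg I ^ RR I \<le> OPT (set xs) (set ys)"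
proof -
  obtain va where va: "hits (Tr va) (lits ` Y0 I)" using assms satisfiable_iff by blast
  obtain P where P: "finite P" "P \<subseteq> {..<M}" "card P \<le> sd I" "hits (Tr va) (lits ` run (Y0 I) (\<lambda>t. t \<in> P) M)"
    using run_complete[OF Y0_canon va] unfolding sd_def by blast
  obtain ps where ps: "set ps = P" "length ps = card P"
    using finite_distinct_list[OF P(1)] distinct_card by metis
  have "(if i < length ps then Suc (ps ! i) else 0) < Suc M" for i
    using P(2) ps(1) nth_mem[of i ps] by auto
  then obtain \<sigma> where \<sigma>: "\<sigma> < Suc M ^ sd I" "\<forall>i<sd I. dg (Suc M) i \<sigma> = (if i < length ps then Suc (ps ! i) else 0)"
    using dg_exists[of "sd I" "\<lambda>i. if i < length ps then Suc (ps ! i) else 0" "Suc M"] by blast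
  have "pet I \<sigma> t \<longleftrightarrow> t \<in> P" for t
  proof
    assume "pet I \<sigma> t"
    then obtain i where "i < sd I" "dg (Suc M) i \<sigma> = Suc t" by (auto simp: pet_def MM_def)
    then show "t \<in> P" using \<sigma>(2) ps(1) by (auto split: if_splits)
  next
    assume "t \<in> P"
    then obtain i where "i < length ps" "ps ! i = t" using ps(1) by (auto simp: in_set_conv_nth)
    then show "pet I \<sigma> t" unfolding pet_def MM_def using \<sigma>(2) P(3) ps(2) by (intro exI[of _ i]) auto
  qed
  then have pet: "pet I \<sigma> = (\<lambda>t. t \<in> P)" by blast
  have hit: "hits (Tr va) (lits ` YY I \<sigma>)" unfolding YY_def pet MM_def by (rule P(4))
  have \<sigma>n: "\<sigma> < 2 ^ nn I" using \<sigma>(1) rf(2) by linarith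
  have bits: "\<exists>x. x < (2::nat) ^ vv I \<and> (\<forall>i<vv I. odd (x div 2 ^ i) = f i)" for f :: "nat \<Rightarrow> bool"
  proof -
    have "(of_bool (f i) :: nat) < 2" for i by simp
    then obtain x :: nat where "x < 2 ^ vv I" "\<forall>i<vv I. dg 2 i x = of_bool (f i)"
      using dg_exists[of "vv I" "\<lambda>i. of_bool (f i)" 2] by blast
    then show ?thesis by (intro exI[of _ x]) (auto simp: dg_def odd_iff_mod_2_eq_one of_bool_def)
  qed
  obtain x :: nat where x: "x < 2 ^ vv I" "\<forall>i<vv I. odd (x div 2 ^ i) = va i" using bits by blast
  obtain y :: nat where y: "y < 2 ^ vv I" "\<forall>i<vv I. odd (y div 2 ^ i) = va (vv I + i)" using bits[of "\<lambda>i. va (vv I + i)"] by blast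
  define \<mu> where "\<mu> = (\<Sum>t<TT I. encA (UU I) (TT I) (ZZ I) (viol I (YY I \<sigma>) 0 x) t *
      encB (UU I) (TT I) (ZZ I) (viol I (YY I \<sigma>) (2 * vv I) y) t)"
  define a where "a = \<mu> * 2 ^ nn I + \<sigma>"
  define i where "i = a * 2 ^ vv I + x"
  define i' where "i' = a * 2 ^ vv I + y"
  have ai: "adv I i = a" "adv I i' = a" "asg I i = x" "asg I i' = y" using x y by (auto simp: adv_def asg_def i_def i'_def)
  then have pi: "path I i = \<sigma>" "path I i' = \<sigma>" "claim I i = \<mu>" using \<sigma>n by (auto simp: path_def claim_def a_def)
  have \<mu>: "\<mu> = (\<Sum>t<TT I. msgA I i t * msgB I i' t)" unfolding \<mu>_def msgA_def msgB_def ai pi ..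
  have "\<mu> < 2 ^ nn I" unfolding \<mu> by (rule product_less)
  then have "(\<mu> + 1) * 2 ^ nn I \<le> 2 ^ nn I * 2 ^ nn I" by (intro mult_le_mono1) simp
  then have "a < 2 ^ nn I * 2 ^ nn I" using \<sigma>n by (simp add: a_def)
  then have "(a + 1) * 2 ^ vv I \<le> (2 ^ nn I * 2 ^ nn I) * 2 ^ vv I" by (intro mult_le_mono1) simp
  also have "\<dots> = NN I" by (simp add: NN_def hh_def power_add mult_2)
  finally have iN: "i < NN I" "i' < NN I" using x(1) y(1) by (auto simp: i_def i'_def)
  \<comment> \<open>A coordinate at which both vectors are 1 belongs to a single clause, by
    injectivity of the rank, and that clause would be false under \<open>va\<close>.\<close>
  have zero: "viol I (YY I \<sigma>) 0 x c * viol I (YY I \<sigma>) (2 * vv I) y c = 0" for c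
  proof (rule ccontr)
    assume "\<not> ?thesis"
    then obtain D D' where D: "D \<in> mins I (YY I \<sigma>)" "rank I (YY I \<sigma>) D = c" "falsified I 0 x D"
      and D': "D' \<in> mins I (YY I \<sigma>)" "rank I (YY I \<sigma>) D' = c" "falsified I (2 * vv I) y D'"
      by (auto simp: viol_def)
    have "D = D'" using rank_inj[OF D(1) D'(1)] rank_inj[OF D'(1) D(1)] D(2) D'(2)
      by (metis less_irrefl linorder_neqE_nat)
    moreover have "va u = (if u < vv I then odd (x div 2 ^ u) else odd (y div 2 ^ (u - vv I)))" if "u < 2 * vv I" for u
      using x(2) y(2)[rule_format, of "u - vv I"] that by (auto simp: not_less)
    ultimately have "lits D \<inter> Tr va = {}" using falsified_iff[OF D(1)] D(3) D'(3) by blast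
    moreover have "D \<in> YY I \<sigma>" using D(1) cact_sub unfolding mins_def by blast
    ultimately show False using hit by (auto simp: hits_def)
  qed
  have adv: "adv I i = adv I i'" using ai by simp
  have "dg (ZZ I) (UU I - 1) (claim I i) = 0"
    unfolding pi(3) unfolding \<mu> product_digit[OF adv] unfolding pi ai zero by simp
  then have "card {j. 0 < j \<and> j < mm I \<and> RX I i j \<and> RY I i' j} = gg I ^ RR I"
    unfolding card_shared[OF adv] gg_def by (simp add: pi(3) \<mu>)
  then show ?thesis using OPT_gadget_ge[OF iN adv] by simp
qed

text \<open>Sparsification only adds clauses, so whatever path is claimed, the combined assignment
  falsifies some minimal clause. The true product hence has a nonzero digit where an accepted claim
  has 0. Two different numbers below \<open>2 ^ nn I\<close> agree modulo at most
  \<open>nn I\<close> primes.\<close>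

lemma soundness:
  assumes "\<not> satisfiable F"
  shows "OPT (set xs) (set ys) \<le> nn I ^ RR I"
proof (rule OPT_gadget_le)
  fix i i' assume i: "i < NN I" "i' < NN I" and adv: "adv I i = adv I i'"
  let ?Y = "YY I (path I i)"
  let ?P = "\<Sum>t<TT I. msgA I i t * msgB I i' t"
  define va where "va = (\<lambda>u. if u < vv I then odd (asg I i div 2 ^ u) else odd (asg I i' div 2 ^ (u - vv I)))"
  have "\<not> hits (Tr va) (lits ` Y0 I)" using assms satisfiable_iff by blast
  then obtain C where C: "C \<in> lits ` Y0 I" "C \<inter> Tr va = {}" by (auto simp: hits_def)
  then have "C \<in> lits ` ?Y" "finite C" using YY_canon(2) by auto
  then obtain D0 where D0: "D0 \<in> act (lits ` ?Y)" "D0 \<subseteq> C" using finite_below_act by blast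
  then obtain D where D: "D \<in> mins I ?Y" "lits D = D0" unfolding act_lits mins_def by blast
  then have "lits D \<inter> Tr va = {}" using D0 C by blast
  then have f: "falsified I 0 (asg I i) D" "falsified I (2 * vv I) (asg I i') D"
    using falsified_iff[OF D(1), of va "asg I i" "asg I i'"] by (auto simp: va_def)
  have one: "viol I ?Y 0 (asg I i) (rank I ?Y D) * viol I ?Y (2 * vv I) (asg I i') (rank I ?Y D) = 1"
    using f D(1) mins_less unfolding viol_def by auto
  have "1 \<le> (\<Sum>c<UU I * TT I. viol I ?Y 0 (asg I i) c * viol I ?Y (2 * vv I) (asg I i') c)"
    unfolding one[symmetric] by (rule member_le_sum) (use rank_less[OF D(1)] in auto)
  then have digit: "dg (ZZ I) (UU I - 1) ?P \<noteq> 0" using product_digit[OF adv] by linarith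
  show "card {j. 0 < j \<and> j < mm I \<and> RX I i j \<and> RY I i' j} \<le> nn I ^ RR I"
  proof (cases "dg (ZZ I) (UU I - 1) (claim I i) = 0")
    case True
    have "claim I i < 2 ^ nn I"
      unfolding claim_def adv_def using i(1)
      by (intro less_mult_imp_div_less) (simp add: NN_def hh_def power_add[symmetric] mult_2 add_ac)
    moreover have "?P \<noteq> claim I i" using digit True by metis
    ultimately have "card {q. q < ZZ I \<and> prime q \<and> ?P mod q = claim I i mod q} \<le> nn I"
      using product_less by (intro card_agreeing_primes_le) auto
    then show ?thesis unfolding card_shared[OF adv] using True by (simp add: power_mono)
  qed (simp add: card_shared[OF adv])
qed

lemma encode_out: "encode_LCS (NN I) (mm I) xs ys = map (out I) [0..<2 + 2 * NN I * mm I]"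
  unfolding encode_gadget out_def ..

end

section \<open>The reduction in polynomial time per symbol\<close>

lemma card_eq_sum: "card {x. x < n \<and> P x} = (\<Sum>x<n. of_bool (P x))" for n :: nat
proof -
  have "{x. x < n \<and> P x} = {..<n} \<inter> {x. P x}" by auto
  then show ?thesis by simp
qed

text \<open>The sum is the binary code of the set of all \<open>D < m\<close> with
  \<open>P D\<close>; in this form a program handles sets of clause codes.\<close>

lemma odd_sum_power_div:
  "odd ((\<Sum>D<m. of_bool (P D) * 2 ^ D :: nat) div 2 ^ i) \<longleftrightarrow> i < m \<and> P i" for m :: nat
proof -
  have e: "(\<Sum>D<m. of_bool (P D) * 2 ^ D) = set_encode {D. D < m \<and> P D}"
  proof -
    have "{D. D < m \<and> P D} = {D \<in> {..<m}. P D}" by auto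
    then show ?thesis unfolding set_encode_def by (simp only: sum.inter_filter[OF finite_lessThan])
      (rule sum.cong, auto)
  qed
  have "odd ((\<Sum>D<m. of_bool (P D) * 2 ^ D :: nat) div 2 ^ i) \<longleftrightarrow> i \<in> set_decode (set_encode {D. D < m \<and> P D})"
    unfolding e set_decode_def by simp
  also have "\<dots> \<longleftrightarrow> i \<in> {D. D < m \<and> P D}" by (subst set_encode_inverse) auto
  finally show ?thesis by simp
qed

text \<open>Counting powers of two brings the logarithm within reach of the rule for bounded
  sums.\<close>

lemma floor_log_eq_sum: "floor_log n = (\<Sum>i<n. of_bool (2 ^ Suc i \<le> n))"
proof (cases "n = 0")
  case False
  have "2 ^ Suc i \<le> n \<longleftrightarrow> i < floor_log n" for i
  proof
    assume "2 ^ Suc i \<le> n"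
    then have "Suc i \<le> floor_log n" using floor_log_le_iff[of "2 ^ Suc i" n] by (simp del: power_Suc)
    then show "i < floor_log n" by simp
  next
    assume "i < floor_log n"
    then have "(2::nat) ^ Suc i \<le> 2 ^ floor_log n" by (intro power_increasing) auto
    also have "\<dots> \<le> n" using False by (intro floor_log_exp2_le) simp
    finally show "2 ^ Suc i \<le> n" .
  qed
  then have "{i. i < n \<and> 2 ^ Suc i \<le> n} = {i. i < n \<and> i < floor_log n}" by auto
  also have "\<dots> = {..<floor_log n}"
  proof -
    have "floor_log n < 2 ^ floor_log n" by (rule less_exp)
    also have "\<dots> \<le> n" using False by (intro floor_log_exp2_le) simp
    finally show ?thesis by auto
  qed
  finally show ?thesis unfolding card_eq_sum[symmetric] by simp
qed simp

lemma prime_iff_bounded: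
  assumes "q < (b::nat)"
  shows "prime q \<longleftrightarrow> 1 < q \<and> (\<forall>d<b. d dvd q \<longrightarrow> d = 1 \<or> d = q)"
proof -
  have "d < b" if "d dvd q" "1 < q" for d using that assms dvd_imp_le[of d q] by simp
  then show ?thesis unfolding prime_nat_iff by blast
qed

locale reduction_ram = reduction k n0 + ram V z ST for k n0 V z ST +
  assumes n0: "1 \<le> n0" and bb_le: "\<And>I. I \<in> V \<Longrightarrow> bb I \<le> vv I"
begin

lemmas PT_rules = PT_var PT_const PT_add PT_diff PT_mult PT_div PT_mod PT_Suc PT_min PT_if PT_of_bool PT_power
  PB_conj PB_disj PB_imp PB_not PB_iff PB_le PB_less PB_eq PB_dvd PB_if
  bd_min bd_Suc bd_add bd_mult bd_diff bd_div bd_mod bd_pol pol_intros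
lemmas PT_loops = PT_sum PB_ex PB_all
lemmas drops = PT_drop1 PB_drop1 bd_drop1

lemma pol_vv: "pol vv"
proof (rule pol_mono)
  show "pol (\<lambda>I. sz I ^ 1 + n0)" by (intro pol_add pol_sz pol_const)
qed (simp add: vv_def sz_def)

lemma PT_vv: "PT (\<lambda>I e. vv I)"
  unfolding vv_def by (intro PT_add PT_div PT_input PT_const)

lemma PT_floor_log: "PT (\<lambda>I e. N I) \<Longrightarrow> pol N \<Longrightarrow> PT (\<lambda>I e. floor_log (N I))"
  unfolding floor_log_eq_sum by (intro PT_rules PT_loops)

lemma floor_log_le: "floor_log n \<le> n"
proof (cases "n = 0")
  case False
  have "floor_log n < 2 ^ floor_log n" by (rule less_exp)
  also have "\<dots> \<le> n" using False by (intro floor_log_exp2_le) simp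
  finally show ?thesis by simp
qed simp

lemma pol_floor_log: "pol N \<Longrightarrow> pol (\<lambda>I. floor_log (N I))"
  by (erule pol_mono) (rule floor_log_le)

lemma pol_div: "pol N \<Longrightarrow> pol (\<lambda>I. N I div K I)"
  by (erule pol_mono) simp

lemma pol_el: "pol el"
  unfolding el_def by (intro pol_floor_log pol_vv)
lemma PT_el: "PT (\<lambda>I e. el I)"
  unfolding el_def by (intro PT_floor_log PT_vv pol_vv)

lemma pol_LL: "pol LL"
  unfolding LL_def by (intro pol_intros pol_vv)
lemma PT_LL: "PT (\<lambda>I e. LL I)"
  unfolding LL_def by (intro PT_rules PT_vv)

lemma pol_al: "pol al"
  unfolding al_def by (intro pol_intros pol_el)
lemma PT_al: "PT (\<lambda>I e. al I)"
  unfolding al_def by (intro PT_rules PT_el)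

text \<open>The exponent in \<open>bb\<close> grows with the input, so closure under fixed powers
  does not apply; the direct comparison with \<open>vv\<close> does.\<close>

lemma pol_bb: "pol bb"
  by (rule pol_mono[OF pol_vv bb_le])
lemma PT_bb: "PT (\<lambda>I e. bb I)"
  unfolding bb_def by (intro PT_power PT_el PT_floor_log pol_el bd_pol pol_floor_log)

lemma pol_TT: "pol TT"
  unfolding TT_def by (intro pol_intros pol_el pol_bb)
lemma PT_TT: "PT (\<lambda>I e. TT I)"
  unfolding TT_def by (intro PT_rules PT_el PT_bb)

lemma pol_UU: "pol UU"
  unfolding UU_def by (intro pol_intros pol_div pol_vv)
lemma PT_UU: "PT (\<lambda>I e. UU I)"
  unfolding UU_def by (intro PT_rules PT_el PT_vv)

lemma pol_ZZ: "pol ZZ"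
  unfolding ZZ_def by (intro pol_intros pol_vv)
lemma PT_ZZ: "PT (\<lambda>I e. ZZ I)"
  unfolding ZZ_def by (intro PT_rules PT_vv)
lemma ZZ_pos: "0 < ZZ I"
  using n0 by (simp add: ZZ_def vv_def)

lemma pol_RR: "pol RR"
  unfolding RR_def by (intro pol_div pol_vv)
lemma PT_RR: "PT (\<lambda>I e. RR I)"
  unfolding RR_def by (intro PT_rules PT_vv PT_bb PT_el)

lemma pol_nn: "pol nn"
  unfolding nn_def by (intro pol_div pol_vv)
lemma PT_nn: "PT (\<lambda>I e. nn I)"
  unfolding nn_def by (intro PT_rules PT_vv PT_el)

lemma pol_hh: "pol hh"
  unfolding hh_def by (intro pol_intros pol_vv pol_nn)
lemma PT_hh: "PT (\<lambda>I e. hh I)"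
  unfolding hh_def by (intro PT_rules PT_vv PT_nn)

lemma PT_NN: "PT (\<lambda>I e. NN I)"
  unfolding NN_def by (intro PT_rules PT_hh pol_hh)
lemma PT_mm: "PT (\<lambda>I e. mm I)"
  unfolding mm_def by (intro PT_power PT_const PT_div PT_floor_log PT_hh pol_hh bd_pol pol_div)

lemma pol_sd: "pol sd"
  unfolding sd_def by (intro pol_div pol_intros pol_LL)
lemma PT_sd: "PT (\<lambda>I e. sd I)"
  unfolding sd_def by (intro PT_rules PT_LL PT_al)

lemma pol_MM: "pol MM"
  unfolding MM_def sparse_params.M_def by (intro pol_intros pol_LL)
lemma PT_MM: "PT (\<lambda>I e. MM I)"
  unfolding MM_def sparse_params.M_def by (intro PT_rules PT_LL)

lemmas params = PT_vv PT_el PT_LL PT_al PT_TT PT_UU PT_ZZ PT_RR PT_nn PT_hh PT_NN PT_mm PT_sd PT_MM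
  pol_vv pol_el pol_LL pol_al pol_TT pol_UU pol_ZZ pol_RR pol_nn pol_hh pol_sd pol_MM

lemmas rules = params PT_rules PT_loops

lemma PT_dg: "PT b \<Longrightarrow> PT i \<Longrightarrow> bd i \<Longrightarrow> PT x \<Longrightarrow> PT (\<lambda>I e. dg (b I e) (i I e) (x I e))"
  unfolding dg_def by (intro PT_rules)

section \<open>Clauses and sets of clauses in polynomial time\<close>

lemma PB_lit:
  assumes "PT D" "PT x" shows "PB (\<lambda>I e. x I e \<in> lit I (D I e))"
  unfolding lit_def sparse_params.lits_def mem_Collect_eq
  by (intro PT_dg rules assms drops)

lemma lit_sub: "lit I D \<subseteq> {..<LL I}"
  unfolding lit_def by (rule sparse_params.lits_sub)

lemma PB_lit_sub:
  assumes "PT D" "PT E" shows "PB (\<lambda>I e. lit I (D I e) \<subseteq> lit I (E I e))"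
proof (rule PB_cong)
  show "PB (\<lambda>I e. \<forall>x<LL I. x \<in> lit I (D I e) \<longrightarrow> x \<in> lit I (E I e))"
    by (intro PB_lit rules assms drops)
qed (use lit_sub in blast)

lemma PB_lit_eq:
  assumes "PT D" "PT E" shows "PB (\<lambda>I e. lit I (D I e) = lit I (E I e))"
  unfolding set_eq_subset by (intro PB_conj PB_lit_sub assms)

lemma PB_lit_diff:
  assumes "PT D" "PT E" "PT F" shows "PB (\<lambda>I e. lit I (D I e) = lit I (E I e) - lit I (F I e))"
proof (rule PB_cong)
  show "PB (\<lambda>I e. \<forall>x<LL I. x \<in> lit I (D I e) \<longleftrightarrow> x \<in> lit I (E I e) \<and> x \<notin> lit I (F I e))"
    by (intro PB_lit rules assms drops)
qed (use lit_sub in blast)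

lemma PT_card_lit:
  assumes "PT D" shows "PT (\<lambda>I e. card (lit I (D I e)))"
proof (rule PT_cong)
  show "PT (\<lambda>I e. \<Sum>x<LL I. of_bool (x \<in> lit I (D I e)))"
    by (intro PB_lit rules assms drops)
  show "(\<Sum>x<LL I. of_bool (x \<in> lit I (D I e))) = card (lit I (D I e))" for I e
    unfolding card_eq_sum[symmetric] using lit_sub by (intro arg_cong[of _ _ card]) auto
qed

lemma PB_canon:
  assumes "PT D" shows "PB (\<lambda>I e. sparse_params.canon k (LL I) (D I e))"
  unfolding sparse_params.canon_def lit_def[symmetric] MM_def[symmetric]
  by (intro PB_lit_eq rules assms drops)

lemma pol_I1: "pol (\<lambda>I. I 1)"
proof -
  obtain c where "\<forall>I\<in>V. \<forall>i. I i \<le> sz I ^ c" using entries unfolding sz_def by blast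
  then show ?thesis by (intro pol_mono[OF pol_sz[of c]]) blast
qed

lemma PT_clause_pos:
  assumes "PT j" shows "PT (\<lambda>I e. clause_pos I (min (j I e) (I 1)))"
proof (rule PT_cong)
  obtain c where c: "\<And>I i. I \<in> V \<Longrightarrow> I i \<le> sz I ^ c" using entries unfolding sz_def by blast
  have I1: "PT (\<lambda>I e. I 1)" by (intro PT_input PT_const)
  \<comment> \<open>As for powers, the number of rounds may depend on the input only; from round
    \<open>j\<close> on, the position stays put.\<close>
  show "PT (\<lambda>I e. rec_nat 2 (\<lambda>i p. if i < j I e then p + 1 + I p else p) (I 1))"
  proof (rule PT_rec[OF I1 pol_I1 PT_const])
    show "PT (\<lambda>I e. if min (e 1) (I 1) < j I (drop1 (drop1 e)) then e 0 + 1 + I (e 0) else e 0)"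
      by (intro PT_if PB_less PT_min PT_var I1 PT_drop1[OF PT_drop1[OF assms]] PT_add PT_const PT_input)
    fix ls :: "nat \<Rightarrow> nat" and d :: nat and b
    show "\<exists>u. pol u \<and> (\<forall>s n. fits ls b s \<longrightarrow> n \<le> s 0 1 \<longrightarrow>
       rec_nat 2 (\<lambda>i p. if i < j (s 0) (\<lambda>i. s ST (ls i)) then p + 1 + s 0 p else p) n < 2 ^ u (s 0))"
    proof (intro exI[of _ "\<lambda>I. 2 + I 1 * (1 + sz I ^ c)"] conjI allI impI)
      show "pol (\<lambda>I. 2 + I 1 * (1 + sz I ^ c))" by (intro pol_intros pol_I1 pol_sz)
      fix s :: memory and n assume s: "fits ls b s" "n \<le> s 0 1"
      have V: "s 0 \<in> V" using s by (simp add: fits_def)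
      have "rec_nat 2 (\<lambda>i p. if i < j (s 0) (\<lambda>i. s ST (ls i)) then p + 1 + s 0 p else p) n \<le> 2 + n * (1 + sz (s 0) ^ c)"
      proof (induction n)
        case (Suc n)
        then show ?case using c[OF V, of "rec_nat 2 (\<lambda>i p. if i < j (s 0) (\<lambda>i. s ST (ls i)) then p + 1 + s 0 p else p) n"]
          by simp
      qed simp
      also have "\<dots> \<le> 2 + s 0 1 * (1 + sz (s 0) ^ c)" using s(2) by (intro add_left_mono mult_le_mono1)
      also have "\<dots> < 2 ^ (2 + s 0 1 * (1 + sz (s 0) ^ c))" by (rule less_exp)
      finally show "rec_nat 2 (\<lambda>i p. if i < j (s 0) (\<lambda>i. s ST (ls i)) then p + 1 + s 0 p else p) n < 2 ^ (2 + s 0 1 * (1 + sz (s 0) ^ c))" .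
    qed
  qed
  fix I e
  have "rec_nat 2 (\<lambda>i p. if i < j I e then p + 1 + I p else p) n = clause_pos I (min (j I e) n)" for n
    by (induction n) (auto simp: clause_pos_def min_def le_Suc_eq not_less_eq_eq)
  then show "rec_nat 2 (\<lambda>i p. if i < j I e then p + 1 + I p else p) (I 1) = clause_pos I (min (j I e) (I 1))" .
qed

lemma PB_lit_clit:
  assumes "PT D" "PT j" shows "PB (\<lambda>I e. lit I (D I e) = clit I (min (j I e) (I 1)))"
proof (rule PB_cong)
  show "PB (\<lambda>I e. \<forall>x<LL I. x \<in> lit I (D I e) \<longleftrightarrow>
      (\<exists>i<k. i < I (clause_pos I (min (j I e) (I 1))) \<and> I (clause_pos I (min (j I e) (I 1)) + Suc i) = x))"
    by (intro PB_lit PT_clause_pos PT_input rules assms drops)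
  show "(\<forall>x<LL I. x \<in> lit I (D I e) \<longleftrightarrow>
      (\<exists>i<k. i < I (clause_pos I (min (j I e) (I 1))) \<and> I (clause_pos I (min (j I e) (I 1)) + Suc i) = x)) \<longleftrightarrow>
      lit I (D I e) = clit I (min (j I e) (I 1))" for I e
    unfolding clit_def set_eq_iff mem_Collect_eq using lit_sub[of I "D I e"] by blast
qed

text \<open>A set of clause codes is represented by a bit mask in a single memory cell. The mask has
  \<open>MM I\<close> relevant bits, polynomially many because \<open>k\<close> is fixed.\<close>

definition PS :: "((nat \<Rightarrow> nat) \<Rightarrow> (nat \<Rightarrow> nat) \<Rightarrow> nat set) \<Rightarrow> bool" where
  "PS X \<longleftrightarrow> (\<exists>x. PT x \<and> (\<forall>I\<in>V. \<forall>e. X I e = {D. D < MM I \<and> odd (x I e div 2 ^ D)}))"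

lemma PS_I: "PT x \<Longrightarrow> (\<And>I e. I \<in> V \<Longrightarrow> X I e = {D. D < MM I \<and> odd (x I e div 2 ^ D)}) \<Longrightarrow> PS X"
  unfolding PS_def by blast

lemma PS_E:
  assumes "PS X"
  obtains x where "PT x" "\<And>I e. I \<in> V \<Longrightarrow> X I e = {D. D < MM I \<and> odd (x I e div 2 ^ D)}"
  using assms unfolding PS_def by blast

lemma PS_less: "PS X \<Longrightarrow> I \<in> V \<Longrightarrow> D \<in> X I e \<Longrightarrow> D < MM I"
  by (erule PS_E) auto

lemma PS_drop1: assumes "PS X" shows "PS (\<lambda>I e. X I (drop1 e))"
proof -
  obtain x where "PT x" "\<And>I e. I \<in> V \<Longrightarrow> X I e = {D. D < MM I \<and> odd (x I e div 2 ^ D)}" using assms unfolding PS_def by blast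
  then show ?thesis by (intro PS_I[of "\<lambda>I e. x I (drop1 e)"] PT_drop1)
qed

lemma PB_mem: assumes "PS X" "PT f" "bd f" shows "PB (\<lambda>I e. f I e \<in> X I e)"
proof -
  obtain x where x: "PT x" "\<And>I e. I \<in> V \<Longrightarrow> X I e = {D. D < MM I \<and> odd (x I e div 2 ^ D)}" using assms(1) unfolding PS_def by blast
  have "PB (\<lambda>I e. f I e < MM I \<and> odd (x I e div 2 ^ f I e))"
    by (intro PB_odd rules x assms)
  then show ?thesis by (rule PB_cong) (simp add: x(2))
qed

lemma PS_Collect:
  assumes "PB (\<lambda>I e. P I (min (e 0) (MM I)) (drop1 e))"
  shows "PS (\<lambda>I e. {D. D < MM I \<and> P I D e})"
proof (rule PS_I)
  show "PT (\<lambda>I e. \<Sum>D<MM I. of_bool (P I D e) * 2 ^ D)"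
    by (intro rules assms)
qed (auto simp only: odd_sum_power_div)

text \<open>Each step builds a fresh mask of at most \<open>MM I\<close> bits, which gives the size
  bound demanded by \<open>PT_rec\<close>. In the premise on \<open>P\<close>, variable 0 is the
  code under test, variable 1 the current mask and variable 2 the number of the step.\<close>

lemma PS_rec:
  assumes N: "PT (\<lambda>I e. N I)" "pol N" and X: "PS X"
    and P: "PB (\<lambda>I e. P I (min (drop1 (drop1 e) 0) (N I)) {D. D < MM I \<and> odd (drop1 e 0 div 2 ^ D)}
      (min (e 0) (MM I)) (drop1 (drop1 (drop1 e))))"
  shows "PS (\<lambda>I e. rec_nat (X I e) (\<lambda>i Y. {D. D < MM I \<and> P I i Y D e}) (N I))"
proof -
  obtain x where x: "PT x" "\<And>I e. I \<in> V \<Longrightarrow> X I e = {D. D < MM I \<and> odd (x I e div 2 ^ D)}" using X unfolding PS_def by blast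
  define g where "g = (\<lambda>I i (y::nat) e. \<Sum>D<MM I. of_bool (P I i {D. D < MM I \<and> odd (y div 2 ^ D)} D e) * 2 ^ D :: nat)"
  show ?thesis
  proof (rule PS_I)
    show "PT (\<lambda>I e. rec_nat (x I e) (\<lambda>i y. g I i y e) (N I))"
    proof (rule PT_rec[OF N x(1)])
      have "PT (\<lambda>I e. g I (min (drop1 e 0) (N I)) (e 0) (drop1 (drop1 e)))"
        unfolding g_def by (intro rules P)
      then show "PT (\<lambda>I e. g I (min (e 1) (N I)) (e 0) (drop1 (drop1 e)))"
        by (simp add: drop1_def)
      fix ls :: "nat \<Rightarrow> nat" and d b assume ls: "\<And>i. ls i < d" and b: "pol b"
      obtain t where t: "pol t" "\<And>s. fits ls b s \<Longrightarrow> x (s 0) (\<lambda>i. s ST (ls i)) < 2 ^ t (s 0)"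
        using PT_bound[of x ls d b, OF x(1) ls b] by blast
      show "\<exists>u. pol u \<and> (\<forall>s j. fits ls b s \<longrightarrow> j \<le> N (s 0) \<longrightarrow>
         rec_nat (x (s 0) (\<lambda>i. s ST (ls i))) (\<lambda>i y. g (s 0) i y (\<lambda>i. s ST (ls i))) j < 2 ^ u (s 0))"
      proof (intro exI[of _ "\<lambda>I. t I + MM I"] conjI allI impI)
        show "pol (\<lambda>I. t I + MM I)" by (intro pol_add t pol_MM)
        fix s j assume s: "fits ls b s"
        have "g (s 0) i y e < 2 ^ (t (s 0) + MM (s 0))" for i y e
        proof -
          have "g (s 0) i y e \<le> (\<Sum>D<MM (s 0). 2 ^ D)" unfolding g_def by (rule sum_mono) simp
          also have "\<dots> < 2 ^ MM (s 0)" by (rule sum_less_power) simp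
          finally show ?thesis by (rule less_two_power_mono) simp
        qed
        moreover have "x (s 0) (\<lambda>i. s ST (ls i)) < 2 ^ (t (s 0) + MM (s 0))"
          by (rule less_two_power_mono[OF t(2)[OF s]]) simp
        ultimately show "rec_nat (x (s 0) (\<lambda>i. s ST (ls i))) (\<lambda>i y. g (s 0) i y (\<lambda>i. s ST (ls i))) j < 2 ^ (t (s 0) + MM (s 0))"
          by (cases j) simp_all
      qed
    qed
    fix I e assume I: "I \<in> V"
    have "rec_nat (X I e) (\<lambda>i Y. {D. D < MM I \<and> P I i Y D e}) n =
        {D. D < MM I \<and> odd (rec_nat (x I e) (\<lambda>i y. g I i y e) n div 2 ^ D)}" for n
    proof (induction n)
      case 0 show ?case by (simp add: x(2)[OF I])
    next
      case (Suc n)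
      have "{D. D < MM I \<and> odd (g I n y e div 2 ^ D)} = {D. D < MM I \<and> P I n {D. D < MM I \<and> odd (y div 2 ^ D)} D e}" for y
        unfolding g_def odd_sum_power_div by auto
      then show ?case by (simp only: old.nat.simps Suc.IH)
    qed
    then show "rec_nat (X I e) (\<lambda>i Y. {D. D < MM I \<and> P I i Y D e}) (N I) =
        {D. D < MM I \<and> odd (rec_nat (x I e) (\<lambda>i y. g I i y e) (N I) div 2 ^ D)}" .
  qed
qed

lemma PS_var: "PS (\<lambda>I e. {D. D < MM I \<and> odd (e n div 2 ^ D)})"
  by (rule PS_I[OF PT_var]) simp

lemma PB_mins:
  assumes "PS Y" "PT D" "bd D" shows "PB (\<lambda>I e. D I e \<in> mins I (Y I e))"
proof (rule PB_cong)
  show "PB (\<lambda>I e. D I e \<in> Y I e \<and> (\<forall>E<MM I. E \<in> Y I e \<longrightarrow> lit I E \<subseteq> lit I (D I e) \<longrightarrow> lit I (D I e) \<subseteq> lit I E))"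
    by (intro PB_mem[OF assms] PB_mem[OF PS_drop1[OF assms(1)]] PB_lit_sub rules assms drops PS_drop1)
  show "(D I e \<in> Y I e \<and> (\<forall>E<MM I. E \<in> Y I e \<longrightarrow> lit I E \<subseteq> lit I (D I e) \<longrightarrow> lit I (D I e) \<subseteq> lit I E)) =
      (D I e \<in> mins I (Y I e))" if "I \<in> V" for I e
    unfolding mins_def sparse_params.cact_def lit_def using PS_less[OF assms(1) that] by blast
qed

lemma mins_less: "PS Y \<Longrightarrow> I \<in> V \<Longrightarrow> D \<in> mins I (Y I e) \<Longrightarrow> D < MM I"
  using PS_less sparse_params.cact_sub unfolding mins_def by blast

lemma PT_cdeg:
  assumes "PS Y" "PT c" "PT H" shows "PT (\<lambda>I e. sparse_params.cdeg k (LL I) (Y I e) (c I e) (H I e))"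
proof (rule PT_cong)
  show "PT (\<lambda>I e. \<Sum>C<MM I. of_bool (C \<in> mins I (Y I e) \<and> card (lit I C) = c I e \<and> lit I (H I e) \<subseteq> lit I C))"
    by (intro PB_mins PB_lit_sub PT_card_lit rules assms drops PS_drop1)
  show "(\<Sum>C<MM I. of_bool (C \<in> mins I (Y I e) \<and> card (lit I C) = c I e \<and> lit I (H I e) \<subseteq> lit I C)) =
      sparse_params.cdeg k (LL I) (Y I e) (c I e) (H I e)" if "I \<in> V" for I e
    unfolding card_eq_sum[symmetric] sparse_params.cdeg_def mins_def[symmetric] lit_def[symmetric]
    using mins_less[OF assms(1) that] by (intro arg_cong[of _ _ card]) auto
qed

lemma pol_W: "pol (\<lambda>I. sparse_params.W k (LL I))"
  unfolding sparse_params.W_def MM_def[symmetric] by (intro pol_intros pol_MM)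
lemma PT_W: "PT (\<lambda>I e. sparse_params.W k (LL I))"
  unfolding sparse_params.W_def MM_def[symmetric] by (intro rules)

lemma PT_w: assumes "PT w"
  shows "PT (\<lambda>I e. sparse_params.wc k (LL I) (w I e))" "PT (\<lambda>I e. sparse_params.ws k (LL I) (w I e))"
    "PT (\<lambda>I e. sparse_params.wH k (LL I) (w I e))"
  unfolding sparse_params.wc_def sparse_params.ws_def sparse_params.wH_def MM_def[symmetric]
  by (intro rules assms)+

lemma PB_cflower:
  assumes "PS Y" "PT w" "bd w" shows "PB (\<lambda>I e. sparse_params.cflower k (LL I) (al I) (Y I e) (w I e))"
proof -
  have b: "bd (\<lambda>I e. sparse_params.ws k (LL I) (w I e))"
    unfolding sparse_params.ws_def by (intro bd_mod bd_div assms)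
  show ?thesis
    unfolding sparse_params.cflower_def sparse_params.thr_def lit_def[symmetric]
    by (intro PT_w PB_canon PT_card_lit PT_cdeg b rules assms)
qed

lemma PT_fw:
  assumes "PS Y" shows "PT (\<lambda>I e. sparse_params.fw k (LL I) (al I) (Y I e))"
  unfolding sparse_params.fw_def card_eq_sum
  by (intro PB_cflower PT_W pol_W rules assms drops PS_drop1)

lemma PB_step:
  assumes "PS Y" "PB b" "PT D" "bd D"
  shows "PB (\<lambda>I e. D I e \<in> sparse_params.step k (LL I) (al I) (Y I e) (b I e))"
  unfolding sparse_params.step_def mem_Collect_eq lit_def[symmetric] mins_def[symmetric] MM_def[symmetric]
  by (intro PB_mem[OF assms(1,3,4)] PT_fw PT_W PB_canon PB_mins PT_card_lit PB_lit_sub PB_lit_diff PT_w rules assms drops PS_drop1)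

lemma PB_pet:
  assumes "PT \<sigma>" "PT t" shows "PB (\<lambda>I e. pet I (\<sigma> I e) (t I e))"
  unfolding pet_def by (intro PT_dg rules assms drops)

lemma PS_Y0: "PS (\<lambda>I e. Y0 I)"
proof -
  have I1: "PT (\<lambda>I e. I 1)" by (intro PT_input PT_const)
  have "PB (\<lambda>I e. lit I (min (drop1 e 0) (MM I)) = clit I (min (e 0) (I 1)))"
    by (intro PB_lit_clit PT_var rules drops)
  then have "PB (\<lambda>I e. \<exists>j<I 1. lit I (min (e 0) (MM I)) = clit I j)"
    by (intro PB_ex I1 pol_I1)
  note ex = this
  show ?thesis unfolding Y0_def by (intro PS_Collect PB_conj PB_canon ex PT_min PT_var PT_MM)
qed

lemma PS_YY:
  assumes "PT \<sigma>" shows "PS (\<lambda>I e. YY I (\<sigma> I e))"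
proof -
  have "PS (\<lambda>I e. rec_nat (Y0 I) (\<lambda>t Y. {D. D < MM I \<and> D \<in> sparse_params.step k (LL I) (al I) Y (pet I (\<sigma> I e) t)}) (MM I))"
    by (intro PS_rec PS_Y0 PB_step PB_pet PS_drop1[OF PS_var] rules assms drops)
  moreover have "{D. D < MM I \<and> D \<in> sparse_params.step k (LL I) (al I) Y b} = sparse_params.step k (LL I) (al I) Y b" for I Y b
    unfolding sparse_params.step_def MM_def by auto
  ultimately show ?thesis unfolding YY_def sparse_params.run_def by simp
qed

lemma PB_falsified:
  assumes "PT off" "PT y" "PT D" shows "PB (\<lambda>I e. falsified I (off I e) (y I e) (D I e))"
  unfolding falsified_def by (intro PB_lit PB_odd rules assms drops)

lemma PT_rank:
  assumes "PS Y" "PT D" shows "PT (\<lambda>I e. rank I (Y I e) (D I e))"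
  unfolding rank_def card_eq_sum by (intro PB_mins rules assms drops PS_drop1)

lemma PT_viol:
  assumes "PS Y" "PT off" "PT y" "PT c" shows "PT (\<lambda>I e. viol I (Y I e) (off I e) (y I e) (c I e))"
  unfolding viol_def by (intro PB_mins PT_rank PB_falsified rules assms drops PS_drop1)

lemma PT_adv: "PT i \<Longrightarrow> PT (\<lambda>I e. adv I (i I e))"
  unfolding adv_def by (intro rules)
lemma PT_asg: "PT i \<Longrightarrow> PT (\<lambda>I e. asg I (i I e))"
  unfolding asg_def by (intro rules)
lemma PT_path: "PT i \<Longrightarrow> PT (\<lambda>I e. path I (i I e))"
  unfolding path_def by (intro PT_adv rules)
lemma PT_claim: "PT i \<Longrightarrow> PT (\<lambda>I e. claim I (i I e))"
  unfolding claim_def by (intro PT_adv rules)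

lemma PT_msg:
  assumes "PT i" "PT t" shows "PT (\<lambda>I e. msgA I (i I e) (t I e))" "PT (\<lambda>I e. msgB I (i I e) (t I e))"
  unfolding msgA_def msgB_def encA_def encB_def
  by (intro PT_viol PS_YY PT_path PT_asg rules assms drops)+

lemma PB_checkA:
  assumes "PT i" "PT J" shows "PB (\<lambda>I e. checkA (ZZ I) (TT I) (msgA I (i I e)) (J I e))"
  unfolding checkA_def by (intro PT_dg PT_msg rules assms drops)

lemma PB_checkB:
  assumes "PT i" "PT J" "PT \<mu>" shows "PB (\<lambda>I e. checkB (ZZ I) (TT I) (msgB I (i I e)) (\<mu> I e) (J I e))"
  unfolding checkB_def prime_iff_bounded[OF dg_less[OF ZZ_pos]]
  by (intro PT_dg PT_msg rules assms drops)

lemma PB_RX: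
  assumes "PT i" "PT j" shows "PB (\<lambda>I e. RX I (i I e) (j I e))"
  unfolding RX_def by (intro PB_checkA PT_dg rules assms drops)

lemma PB_RY:
  assumes "PT i" "PT j" shows "PB (\<lambda>I e. RY I (i I e) (j I e))"
  unfolding RY_def by (intro PB_checkB PT_claim PT_dg rules assms drops)

lemma PT_out:
  assumes "PT q" shows "PT (\<lambda>I e. out I (q I e))"
  unfolding out_def symbol_def symX_def symY_def
  by (intro PB_RX PB_RY PT_adv rules assms)

lemma PT_threshold: "PT (\<lambda>I e. nn I ^ RR I)"
  by (intro rules)

end

section \<open>Choice of the parameters\<close>

lemma floor_log_at_top: "filterlim floor_log at_top sequentially"
  unfolding filterlim_at_top
proof
  fix Z
  show "\<forall>\<^sub>F n in sequentially. Z \<le> floor_log n"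
    using eventually_ge_at_top[of "2 ^ Z"]
  proof eventually_elim
    case (elim n)
    then show ?case using floor_log_le_iff[of "2 ^ Z" n] by simp
  qed
qed

lemma quadratic_le_exp: "8 \<le> x \<Longrightarrow> 1 + (x + 1) * (x + 8) \<le> (2::nat) ^ x"
proof (induction x rule: nat_induct_at_least)
  case (Suc x)
  have "8 * x \<le> x * x" using Suc by (intro mult_le_mono1)
  then have "1 + (Suc x + 1) * (Suc x + 8) \<le> 2 * (1 + (x + 1) * (x + 8))" using Suc by (simp add: algebra_simps)
  then show ?case using Suc by simp
qed simp

text \<open>Here \<open>l\<close> stands for log v. The condition
  \<open>9 * k \<le> floor_log l\<close> lets the slack \<open>l ^ floor_log l\<close> absorb
  \<open>\<alpha> ^ (3 * k) = l ^ (9 * k)\<close>; the conditions ending in \<open>2 ^ l\<close>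
  compare with v itself.\<close>

definition large :: "nat \<Rightarrow> nat \<Rightarrow> bool" where
  "large k l \<longleftrightarrow> 2 * k + 2 \<le> l \<and> 4 * k\<^sup>2 * (l + 4) \<le> l\<^sup>2 \<and> 9 * k \<le> floor_log l \<and> 4 * (k + 1) \<le> l\<^sup>2 \<and>
     2 * l ^ (floor_log l + 8) \<le> 2 ^ l \<and> 24 * l\<^sup>2 \<le> 2 ^ l \<and> 32 \<le> l \<and> 2 * (l + 2) \<le> 2 ^ l"

lemma eventually_large: "\<forall>\<^sub>F l in sequentially. large k l"
proof -
  have 1: "\<forall>\<^sub>F l in sequentially. 4 * k\<^sup>2 * (l + 4) \<le> l\<^sup>2"
  proof -
    have "\<forall>\<^sub>F l in sequentially. 4 * real k ^ 2 * (real l + 4) \<le> real l ^ 2" by real_asymp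
    then show ?thesis
    proof eventually_elim
      case (elim l)
      then have "real (4 * k\<^sup>2 * (l + 4)) \<le> real (l\<^sup>2)" by simp
      then show ?case by (simp only: of_nat_le_iff)
    qed
  qed
  have 2: "\<forall>\<^sub>F l in sequentially. 24 * l\<^sup>2 \<le> 2 ^ l"
  proof -
    have "\<forall>\<^sub>F l in sequentially. 24 * real l ^ 2 \<le> 2 ^ l" by real_asymp
    then show ?thesis
    proof eventually_elim
      case (elim l)
      then have "real (24 * l\<^sup>2) \<le> real (2 ^ l)" by simp
      then show ?case by (simp only: of_nat_le_iff)
    qed
  qed
  have 3: "\<forall>\<^sub>F l in sequentially. 9 * k + 8 \<le> floor_log l"
    using floor_log_at_top unfolding filterlim_at_top by blast
  show ?thesis
    using 1 2 3 eventually_ge_at_top[of "32 + 4 * k + 4"]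
  proof eventually_elim
    case (elim l)
    have l: "32 \<le> l" "4 * k + 4 \<le> l" "2 * k + 2 \<le> l" using elim by auto
    have "l \<le> l\<^sup>2" using l by (simp add: power2_eq_square)
    moreover have "2 * (l + 2) \<le> 24 * l" using l by simp
    ultimately have "2 * (l + 2) \<le> 2 ^ l" using elim by linarith
    moreover have "4 * (k + 1) \<le> l\<^sup>2" by (rule le_trans[OF _ \<open>l \<le> l\<^sup>2\<close>]) (use l in simp)
    ultimately have a: "4 * (k + 1) \<le> l\<^sup>2" "2 * (l + 2) \<le> 2 ^ l" by auto
    \<comment> \<open>In terms of \<open>x\<close>, the power \<open>l ^ (x + 8)\<close> is at most
      2 to a quadratic polynomial in \<open>x\<close>, whereas \<open>2 ^ l\<close> is at least
      \<open>2 ^ (2 ^ x)\<close>.\<close>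
    define x where "x = floor_log l"
    have x: "8 \<le> x" using elim by (simp add: x_def)
    have "l < 2 ^ (x + 1)" using floor_log_exp2_gt[of l] by (simp add: x_def)
    then have "l ^ (x + 8) \<le> (2 ^ (x + 1)) ^ (x + 8)" by (intro power_mono) auto
    also have "(2 ^ (x + 1)) ^ (x + 8) = (2::nat) ^ ((x + 1) * (x + 8))" by (simp only: power_mult)
    finally have "2 * l ^ (x + 8) \<le> 2 ^ (1 + (x + 1) * (x + 8))" unfolding power_add[of 2 1] by simp
    also have "\<dots> \<le> 2 ^ (2 ^ x)" by (intro power_increasing quadratic_le_exp x) auto
    also have "(2::nat) ^ x \<le> l" unfolding x_def using l by (intro floor_log_exp2_le) simp
    then have "(2::nat) ^ (2 ^ x) \<le> 2 ^ l" by (intro power_increasing) auto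
    finally have "2 * l ^ (x + 8) \<le> 2 ^ l" .
    then show ?case using elim a l by (simp add: large_def x_def)
  qed
qed

context reduction
begin

text \<open>All quantities are compared through exponents of 2 by means of
  \<open>2 ^ l \<le> v < 2 ^ (l + 1)\<close>; the spare powers of \<open>l\<close> in the parameters
  beat the constants.\<close>

lemma roomyI:
  assumes "large k (el I)" "1 \<le> k" "1 \<le> n0"
  shows "roomy I" "bb I \<le> vv I" "2 * (bb I * el I ^ 8) \<le> vv I" "hh I \<le> 3 * vv I" "floor_log (hh I) \<le> el I + 2" "1 \<le> nn I"
    "el I \<le> floor_log (hh I)"
proof -
  define v l b where "v = vv I" and "l = el I" and "b = bb I"
  have lg: "2 * k + 2 \<le> l" "4 * k\<^sup>2 * (l + 4) \<le> l\<^sup>2" "9 * k \<le> floor_log l" "4 * (k + 1) \<le> l\<^sup>2"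
     "2 * l ^ (floor_log l + 8) \<le> 2 ^ l" "24 * l\<^sup>2 \<le> 2 ^ l" "32 \<le> l" "2 * (l + 2) \<le> 2 ^ l"
    using assms(1) by (auto simp: large_def l_def)
  have v0: "0 < v" using assms(3) by (simp add: v_def vv_def)
  have v1: "2 ^ l \<le> v" unfolding l_def el_def v_def[symmetric] by (rule floor_log_exp2_le[OF v0])
  have v2: "v < 2 ^ (l + 1)" using floor_log_exp2_gt[of v] by (simp add: l_def el_def v_def)
  have b: "b = l ^ floor_log l" by (simp add: b_def bb_def l_def)
  have b0: "0 < b" unfolding b using lg(7) by simp
  have bl: "2 * (b * l ^ 8) \<le> v" using lg(5) v1 by (simp add: b power_add)
  have p: "l * l ^ 7 = l ^ 8" "l ^ 5 * l ^ 3 = l ^ 8" "l ^ 3 = l * l\<^sup>2" "l ^ 5 = l ^ 3 * l\<^sup>2" by (simp_all add: power_numeral_reduce)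
  have l1: "1 \<le> l" using lg(7) by simp
  have pw1: "1 \<le> l ^ j" for j using l1 by (simp add: Suc_leI)
  show "2 * (bb I * el I ^ 8) \<le> vv I" using bl by (simp add: b_def l_def v_def)
  have "b * 1 \<le> b * l ^ 8" by (intro mult_le_mono2 pw1)
  then have bv: "b \<le> v" using bl by linarith
  then show "bb I \<le> vv I" by (simp add: b_def v_def)
  have nn: "nn I = v div l" by (simp add: nn_def v_def l_def)
  have "l < 2 ^ l" by (rule less_exp)
  then have lv: "l \<le> v" using v1 by linarith
  then show nn1: "1 \<le> nn I" unfolding nn using l1 by (simp add: Suc_le_eq div_greater_zero_iff)
  have hh: "hh I = v + 2 * (v div l)" by (simp add: hh_def nn v_def)
  show h3: "hh I \<le> 3 * vv I" unfolding hh v_def[symmetric] using div_le_dividend[of v l] by linarith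
  have hpos: "v \<le> hh I" unfolding hh by simp
  have "hh I < 2 ^ (l + 3)" using h3 v2 unfolding v_def[symmetric] by (simp add: power_add)
  have "2 ^ floor_log (hh I) < (2::nat) ^ (l + 3)"
    by (rule le_less_trans[OF floor_log_exp2_le \<open>hh I < 2 ^ (l + 3)\<close>]) (use hpos v0 in simp)
  then have fl: "floor_log (hh I) \<le> l + 2" by simp
  then show "floor_log (hh I) \<le> el I + 2" by (simp add: l_def)
  show "el I \<le> floor_log (hh I)" unfolding el_def using hpos by (intro floor_log_le_iff) (simp add: v_def)
  have flp: "0 < floor_log (hh I)"
  proof -
    have "floor_log v \<le> floor_log (hh I)" using hpos by (rule floor_log_le_iff)
    then show ?thesis using l1 by (simp add: l_def el_def v_def)
  qed
  have c1: "2 * k + 2 \<le> al I"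
  proof -
    have "l * 1 \<le> l * l ^ 2" by (intro mult_le_mono2 pw1)
    then show ?thesis unfolding al_def l_def[symmetric] p(3) using lg(1) by linarith
  qed
  \<comment> \<open>A path has \<open>sd I\<close>, about \<open>4 * k * v / l ^ 3\<close>, digits
    of at most \<open>k * (l + 4)\<close> bits each: of order \<open>k ^ 2 * v / l ^ 2\<close> bits,
    where \<open>v / l\<close> are available.\<close>
  have c2: "Suc (MM I) ^ sd I \<le> 2 ^ nn I"
  proof -
    define s where "s = sd I"
    have "s = k * (4 * v) div l ^ 3" by (simp add: s_def sd_def LL_def al_def v_def l_def)
    then have s: "s * l ^ 3 \<le> k * (4 * v)" by (simp add: div_times_less_eq_dividend)
    have "Suc (MM I) \<le> (2 ^ (l + 4)) ^ k"
    proof -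
      have "Suc (MM I) = (4 * v + 1) ^ k + 1" by (simp add: MM_def sparse_params.M_def LL_def v_def)
      also have "\<dots> \<le> (4 * v + 2) ^ k"
      proof -
        have "(4 * v + 1) ^ k < (4 * v + 2) ^ k" using assms(2) by (intro power_strict_mono) auto
        then show ?thesis by simp
      qed
      also have "\<dots> \<le> (2 ^ (l + 4)) ^ k" using v2 by (intro power_mono) (auto simp: power_add)
      finally show ?thesis .
    qed
    then have "Suc (MM I) ^ s \<le> ((2 ^ (l + 4)) ^ k) ^ s" by (intro power_mono) auto
    also have "\<dots> = 2 ^ ((l + 4) * k * s)" by (simp add: power_mult)
    also have "\<dots> \<le> 2 ^ (v div l)"
    proof (rule power_increasing)
      have "(l + 4) * k * s * l * l\<^sup>2 = (l + 4) * k * (s * l ^ 3)" by (simp add: p(3))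
      also have "\<dots> \<le> (l + 4) * k * (k * (4 * v))" using s by (intro mult_le_mono2)
      also have "\<dots> = 4 * k\<^sup>2 * (l + 4) * v" by (simp add: power2_eq_square)
      also have "\<dots> \<le> l\<^sup>2 * v" using lg(2) by (intro mult_le_mono1)
      finally have "((l + 4) * k * s * l) * l\<^sup>2 \<le> v * l\<^sup>2" by (simp only: mult.commute)
      then have "(l + 4) * k * s * l \<le> v" using l1 by (simp only: mult_le_cancel2) simp
      then show "(l + 4) * k * s \<le> v div l" using l1 by (simp add: less_eq_div_iff_mult_less_eq)
    qed simp
    finally show ?thesis by (simp add: s_def nn)
  qed
  have TU: "TT I = b * l ^ 5" "UU I = v div l ^ 3 + 1" by (simp_all add: TT_def UU_def b_def l_def v_def)
  \<comment> \<open>The grid holds at least \<open>v * l ^ 2 * b\<close> clauses;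
    \<open>l ^ 2\<close> covers the constant \<open>4 * (k + 1)\<close> and \<open>b\<close> covers
    \<open>l ^ (9 * k)\<close>.\<close>
  have c3: "(k + 1) * (LL I * al I ^ (3 * k)) \<le> UU I * TT I"
  proof -
    have "v div l ^ 3 * l ^ 3 + v mod l ^ 3 = v" by (rule div_mult_mod_eq)
    moreover have "v mod l ^ 3 < l ^ 3" using l1 by simp
    ultimately have U: "v \<le> UU I * l ^ 3" unfolding TU by simp
    have "(k + 1) * (LL I * al I ^ (3 * k)) = v * (4 * (k + 1) * l ^ (9 * k))"
      by (simp add: LL_def al_def v_def l_def power_mult[symmetric] algebra_simps)
    also have "\<dots> \<le> v * (l\<^sup>2 * l ^ floor_log l)"
      using lg(3,4) l1 by (intro mult_le_mono2 mult_le_mono power_increasing)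
    also have "\<dots> \<le> (UU I * l ^ 3) * (l\<^sup>2 * b)" unfolding b using U by (intro mult_le_mono1)
    also have "\<dots> = UU I * TT I" unfolding TU(1) p(4) by (simp only: mult_ac)
    finally show ?thesis .
  qed
  have Z: "ZZ I = v\<^sup>2" by (simp add: ZZ_def v_def)
  have v32: "32 \<le> v" using lv lg(7) by linarith
  have c4: "UU I * TT I < ZZ I"
  proof -
    have "v div l ^ 3 \<le> v div 2"
    proof (rule div_le_mono2)
      have "2 * 1 \<le> l * l\<^sup>2" using lg(7) by (intro mult_le_mono pw1) simp
      then show "2 \<le> l ^ 3" by (simp add: p(3))
    qed simp
    then have "UU I \<le> v" unfolding TU using v32 by linarith
    have "b * l ^ 5 * 1 \<le> b * l ^ 5 * l ^ 3" by (intro mult_le_mono2 pw1)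
    also have "\<dots> = b * l ^ 8" by (simp only: mult.assoc p(2))
    finally have "TT I < v" unfolding TU using bl v0 by linarith
    then have "UU I * TT I < v * v" using \<open>UU I \<le> v\<close> v0
      by (meson le_less_trans mult_le_mono1 mult_less_cancel1)
    then show ?thesis by (simp add: Z power2_eq_square)
  qed
  have c4': "2 \<le> ZZ I" using power_mono[of 2 v 2] v32 by (simp add: Z)
  have Zle: "ZZ I \<le> 2 ^ (2 * (l + 1))"
  proof -
    have "v\<^sup>2 \<le> (2 ^ (l + 1))\<^sup>2" using v2 by (intro power_mono) auto
    then show ?thesis by (simp only: Z power_mult[symmetric] mult.commute)
  qed
  \<comment> \<open>The claim has about \<open>2 * v / l ^ 3\<close> digits of
    \<open>2 * (l + 1)\<close> bits each, of order \<open>v / l ^ 2\<close> bits in total.\<close>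
  have c5: "ZZ I ^ (2 * UU I + 1) \<le> 2 ^ nn I"
  proof -
    have "ZZ I ^ (2 * UU I + 1) \<le> (2 ^ (2 * (l + 1))) ^ (2 * UU I + 1)" using Zle by (intro power_mono) auto
    also have "\<dots> = 2 ^ (2 * (l + 1) * (2 * UU I + 1))" by (simp only: power_mult)
    also have "\<dots> \<le> 2 ^ (v div l)"
    proof (rule power_increasing)
      define x where "x = v div l ^ 3"
      have x: "x * l ^ 3 \<le> v" by (simp add: x_def div_times_less_eq_dividend)
      have "2 * (l + 1) \<le> 4 * l" using l1 by simp
      then have "2 * (l + 1) * (2 * UU I + 1) * l \<le> 4 * l * (2 * UU I + 1) * l" by (intro mult_le_mono1)
      also have "\<dots> = 8 * (l\<^sup>2 * x) + 12 * l\<^sup>2" unfolding TU x_def[symmetric] by (simp add: algebra_simps power2_eq_square)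
      finally have A: "2 * (l + 1) * (2 * UU I + 1) * l \<le> 8 * (l\<^sup>2 * x) + 12 * l\<^sup>2" .
      have "16 * (l\<^sup>2 * x) \<le> l * (l\<^sup>2 * x)" using lg(7) by (intro mult_le_mono1) simp
      also have "\<dots> \<le> v" using x by (simp add: p(3) mult_ac)
      finally have "8 * (l\<^sup>2 * x) * 2 \<le> v" by simp
      moreover have "12 * l\<^sup>2 * 2 \<le> v" using lg(6) v1 by simp
      ultimately have "2 * (l + 1) * (2 * UU I + 1) * l \<le> v" using A by linarith
      then show "2 * (l + 1) * (2 * UU I + 1) \<le> v div l" using l1 by (simp only: less_eq_div_iff_mult_less_eq)
    qed simp
    finally show ?thesis by (simp add: nn)
  qed
  \<comment> \<open>There are about \<open>v ^ 2 / (2 * l)\<close> primes below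
    \<open>v ^ 2\<close>, and only \<open>2 * v / l\<close> have to be found.\<close>
  have c6: "2 * nn I \<le> gg I"
  proof (rule ccontr)
    assume "\<not> 2 * nn I \<le> gg I"
    then have g: "gg I \<le> 2 * (v div l)" by (simp add: nn)
    have "v\<^sup>2 - 2 \<le> 2 * (l + 1) * gg I"
      unfolding gg_def Z by (rule many_primes[OF v2]) (use v32 in simp)
    also have "\<dots> \<le> 2 * (l + 1) * (2 * (v div l))" using g by (intro mult_le_mono2)
    also have "\<dots> \<le> 2 * (2 * l) * (2 * (v div l))" using l1 by (intro mult_le_mono1) simp
    also have "\<dots> = 8 * (v div l * l)" by simp
    also have "\<dots> \<le> 8 * v" by (simp add: div_times_less_eq_dividend)
    finally have "v * v \<le> 8 * v + 2" by (simp add: power2_eq_square)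
    moreover have "32 * v \<le> v * v" using v32 by (intro mult_le_mono1)
    ultimately show False using v32 by linarith
  qed
  define R where "R = RR I"
  have R: "R * (b * l ^ 8) \<le> v" by (simp add: R_def RR_def b_def l_def v_def div_times_less_eq_dividend)
  \<comment> \<open>The rounds use \<open>RR I * TT I\<close>, about \<open>v / l ^ 3\<close>,
    residues of \<open>2 * (l + 1)\<close> bits, of order \<open>v / l ^ 2\<close> bits; the string
    length offers at least about \<open>v / (l + 2)\<close>.\<close>
  have c7: "(ZZ I ^ Suc (TT I)) ^ R + 1 \<le> mm I"
  proof -
    have "(ZZ I ^ Suc (TT I)) ^ R = ZZ I ^ (Suc (TT I) * R)" by (simp only: power_mult)
    also have "\<dots> \<le> (2 ^ (2 * (l + 1))) ^ (Suc (TT I) * R)" using Zle by (intro power_mono) auto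
    also have "\<dots> = 2 ^ (2 * (l + 1) * (Suc (TT I) * R))" by (simp only: power_mult)
    finally have "(ZZ I ^ Suc (TT I)) ^ R + 1 \<le> 2 ^ (2 * (l + 1) * (Suc (TT I) * R)) + 1" by simp
    also have "\<dots> \<le> 2 ^ (2 * (l + 1) * (Suc (TT I) * R) + 1)" by simp
    also have "\<dots> \<le> 2 ^ (hh I div floor_log (hh I))"
    proof (rule power_increasing)
      let ?e = "2 * (l + 1) * (Suc (TT I) * R)"
      have "Suc (TT I) \<le> 2 * (b * l ^ 5)" unfolding TU using b0 pw1[of 5] by simp
      then have "?e * (l + 2) \<le> (2 * (2 * l)) * ((2 * (b * l ^ 5)) * R) * (2 * l)"
        using lg(7) by (intro mult_le_mono) auto
      also have "\<dots> = 16 * (R * (b * (l ^ 5 * l * l)))" by simp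
      finally have "?e * (l + 2) * 2 \<le> 32 * (R * (b * (l ^ 5 * l * l)))" by simp
      also have "\<dots> \<le> l * (R * (b * (l ^ 5 * l * l)))" using lg(7) by (intro mult_le_mono1)
      also have "\<dots> = R * (b * l ^ 8)" by (simp add: power_numeral_reduce)
      finally have "?e * (l + 2) * 2 \<le> v" using R by linarith
      moreover have "2 * (l + 2) \<le> v" using lg(8) v1 by linarith
      ultimately have "(?e + 1) * (l + 2) \<le> v" by (simp add: algebra_simps)
      then have "(?e + 1) * floor_log (hh I) \<le> hh I" using fl hpos
        by (meson le_trans mult_le_mono2)
      then show "?e + 1 \<le> hh I div floor_log (hh I)" using flp by (simp only: less_eq_div_iff_mult_less_eq)
    qed simp
    finally show ?thesis by (simp add: mm_def)
  qed
  have m2: "2 \<le> mm I"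
  proof -
    have "1 \<le> (ZZ I ^ Suc (TT I)) ^ R" using c4' by (simp add: Suc_le_eq)
    then show ?thesis using c7 by linarith
  qed
  have c9: "2 ^ (2 * nn I) * mm I + 2 * mm I + 2 * NN I \<le> 2 * NN I * mm I"
  proof -
    have N: "NN I = 2 ^ v * 2 ^ (2 * nn I)" by (simp add: NN_def hh_def v_def power_add)
    have "(2::nat) ^ 5 \<le> 2 ^ v" using v32 by (intro power_increasing) auto
    then have "8 * 2 ^ (2 * nn I) \<le> NN I" unfolding N by (intro mult_le_mono1) simp
    moreover have "1 \<le> (2::nat) ^ (2 * nn I)" by simp
    ultimately have W: "8 * 2 ^ (2 * nn I) \<le> NN I" "8 \<le> NN I" by linarith+
    have "8 * 2 ^ (2 * nn I) * mm I \<le> NN I * mm I" "8 * mm I \<le> NN I * mm I" "NN I * 2 \<le> NN I * mm I"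
      by (intro mult_le_mono1 mult_le_mono2 W m2)+
    then show ?thesis by linarith
  qed
  show "roomy I" unfolding roomy_def
    using assms(3) c1 c2 c3 c4 c4' c5 c6 c7 c9 by (simp only: R_def simp_thms)
qed

end

text \<open>In the application \<open>h = log N\<close> and the right-hand side is the number of
  rounds. With X = log h and Y = log X the divisor is at most \<open>2 powr (Y * (Y + 8))\<close>.
  The constant 5 makes \<open>(Y + 5)^2\<close> exceed \<open>Y * (Y + 8) + 3\<close>; the 3 is a
  factor 8 that pays for \<open>h \<le> 3 * v\<close> and for rounding the quotient down.\<close>

lemma iterated_log_gap:
  fixes v h l :: nat
  assumes "2 ^ l \<le> v" "2 * (l ^ floor_log l * l ^ 8) \<le> v" "v \<le> h" "h \<le> 3 * v" "2 \<le> l"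
  shows "real h powr (1 - (log 2 (log 2 (real h)) + 5)\<^sup>2 / log 2 (real h)) < real (v div (l ^ floor_log l * l ^ 8))"
proof -
  define B where "B = l ^ floor_log l * l ^ 8"
  define X where "X = log 2 (real h)"
  define Y where "Y = log 2 X"
  have B: "B = l ^ (floor_log l + 8)" by (simp add: B_def power_add)
  have B0: "0 < B" using assms(5) by (simp add: B)
  have lX: "real l \<le> X" unfolding X_def by (rule le_log2_of_power) (use assms(1,3) in simp)
  then have X2: "2 \<le> X" using assms(5) by linarith
  have "real (2 ^ floor_log l) \<le> real l" using assms(5) by (subst of_nat_le_iff) (intro floor_log_exp2_le, simp)
  then have "real (2 ^ floor_log l) \<le> X" using lX by linarith
  then have "2 powr real (floor_log l) \<le> X" by (simp add: powr_realpow)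
  then have lY: "real (floor_log l) \<le> Y" unfolding Y_def using X2 by (simp add: le_log_iff)
  have h0: "0 < real h" "1 < real h"
  proof -
    have "(2::nat) ^ 1 \<le> 2 ^ l" using assms(5) by (intro power_increasing) auto
    then have "2 \<le> h" using assms(1,3) by simp
    then show "1 < real h" by simp
    then show "0 < real h" by linarith
  qed
  have hX: "real h = 2 powr X" unfolding X_def using h0 by simp
  have XY: "X = 2 powr Y" unfolding Y_def using X2 by simp
  have "real B = real l powr real (floor_log l + 8)" unfolding B of_nat_power
    by (rule powr_realpow[symmetric]) (use assms(5) in simp)
  also have "\<dots> \<le> X powr real (floor_log l + 8)" using lX by (intro powr_mono2) auto
  also have "\<dots> \<le> X powr (Y + 8)" using X2 lY by (intro powr_mono) auto
  also have "\<dots> = 2 powr (Y * (Y + 8))" unfolding XY powr_powr by simp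
  finally have B1: "real B \<le> 2 powr (Y * (Y + 8))" .
  have "0 \<le> Y" using lY by linarith
  then have "Y * (Y + 8) + 3 \<le> (Y + 5)\<^sup>2" by (simp add: power2_eq_square algebra_simps)
  then have "2 powr (Y * (Y + 8) + 3) \<le> 2 powr ((Y + 5)\<^sup>2)" by (intro powr_mono) auto
  then have B2: "8 * real B \<le> 2 powr ((Y + 5)\<^sup>2)" using B1 by (simp add: powr_add)
  have "real h powr (1 - (Y + 5)\<^sup>2 / X) = 2 powr (X * (1 - (Y + 5)\<^sup>2 / X))" unfolding hX powr_powr ..
  also have "X * (1 - (Y + 5)\<^sup>2 / X) = X - (Y + 5)\<^sup>2" using X2 by (simp add: field_simps)
  also have "2 powr (X - (Y + 5)\<^sup>2) = real h / 2 powr ((Y + 5)\<^sup>2)" by (simp only: powr_diff hX)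
  also have "\<dots> \<le> real h / (8 * real B)" using B2 B0 by (intro divide_left_mono) auto
  also have "\<dots> \<le> (3 * real v) / (8 * real B)"
  proof (rule divide_right_mono)
    show "real h \<le> 3 * real v" using assms(4) by linarith
  qed simp
  \<comment> \<open>Since \<open>v \<ge> 2 * B\<close>, the missing five eighths of
    \<open>v / B\<close> amount to more than 1.\<close>
  also have "\<dots> < real v / real B - 1"
  proof -
    have "2 * real B \<le> real v" using assms(2) unfolding B_def[symmetric] by linarith
    then show ?thesis using B0 by (simp add: field_simps)
  qed
  also have "\<dots> < real (v div B)"
  proof -
    have "v div B * B + v mod B = v" by (rule div_mult_mod_eq)
    moreover have "v mod B < B" using B0 by simp
    ultimately have "v < v div B * B + B" by linarith
    then have "real v < real (v div B * B + B)" by (simp only: of_nat_less_iff)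
    then have "real v < (real (v div B) + 1) * real B" by (simp add: algebra_simps)
    then show ?thesis using B0 by (simp add: field_simps)
  qed
  finally show ?thesis unfolding B_def X_def Y_def .
qed

section \<open>The program\<close>

lemma sum_powers_le: "(\<Sum>i\<le>k. a ^ i) \<le> (k + 1) * (a + 1) ^ k" for a :: nat
proof -
  have "(\<Sum>i\<le>k. a ^ i) \<le> (\<Sum>i\<le>k. (a + 1) ^ k)"
  proof (rule sum_mono)
    fix i assume "i \<in> {..k}"
    then have "a ^ i \<le> (a + 1) ^ i" "(a + 1) ^ i \<le> (a + 1) ^ k" by (auto intro!: power_mono power_increasing)
    then show "a ^ i \<le> (a + 1) ^ k" by linarith
  qed
  then show ?thesis by simp
qed

text \<open>Distinct clauses are distinct lists of at most \<open>k\<close> literals out of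
  \<open>2 * n\<close>, so their number is polynomial in \<open>n\<close>.\<close>

lemma kcnf_size:
  assumes "kcnf k n F" "1 \<le> k"
  shows "length (encode_cnf n F) \<le> (n + 2) ^ (4 * k + 1)" "input n F i \<le> (n + 2) ^ (4 * k + 1)"
proof -
  let ?A = "{..<n} \<times> (UNIV :: bool set)"
  have F: "distinct F" "\<And>c. c \<in> set F \<Longrightarrow> length c \<le> k" "\<And>c x b. c \<in> set F \<Longrightarrow> (x, b) \<in> set c \<Longrightarrow> x < n"
    using assms(1) by (auto simp: kcnf_def)
  have "length F = card (set F)" using F(1) by (simp add: distinct_card)
  also have "\<dots> \<le> card {xs. set xs \<subseteq> ?A \<and> length xs \<le> k}"
    using F by (intro card_mono finite_lists_length_le) auto
  also have "\<dots> = (\<Sum>i\<le>k. (2 * n) ^ i)"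
    by (subst card_lists_length_le) (auto simp: card_cartesian_product mult.commute)
  also have "\<dots> \<le> (k + 1) * (2 * n + 1) ^ k" by (rule sum_powers_le)
  finally have lF: "length F \<le> (k + 1) * (2 * n + 1) ^ k" .
  have k1: "k + 1 \<le> (n + 2) ^ k"
  proof -
    have "k + 1 \<le> 2 ^ k" unfolding Suc_eq_plus1[symmetric] by (rule Suc_leI[OF less_exp])
    also have "\<dots> \<le> (n + 2) ^ k" by (intro power_mono) auto
    finally show ?thesis .
  qed
  have n2: "2 * n + 1 \<le> (n + 2) ^ 2" by (simp add: power2_eq_square)
  have x2: "2 \<le> (n + 2) ^ (4 * k)" "(n + 2) ^ 2 \<le> (n + 2) ^ (4 * k)"
  proof -
    show "(n + 2) ^ 2 \<le> (n + 2) ^ (4 * k)" using assms(2) by (intro power_increasing) auto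
    then show "2 \<le> (n + 2) ^ (4 * k)" using n2 by (simp add: power2_eq_square)
  qed
  have x3: "(n + 2) ^ (4 * k) * 2 \<le> (n + 2) ^ (4 * k + 1)" by simp
  have "length (concat (map block F)) = (\<Sum>c\<leftarrow>F. Suc (length c))"
    by (simp add: length_concat block_def o_def)
  also have "\<dots> \<le> (\<Sum>c\<leftarrow>F. Suc k)" by (rule sum_list_mono) (use F(2) in auto)
  also have "\<dots> = length F * (k + 1)" by (simp add: sum_list_triv)
  also have "\<dots> \<le> ((k + 1) * (2 * n + 1) ^ k) * (k + 1)" using lF by (intro mult_le_mono1)
  \<comment> \<open>Both factors \<open>k + 1\<close> cost an exponent \<open>k\<close>, and the
    power of \<open>2 * n + 1\<close> costs \<open>2 * k\<close>: together
    \<open>4 * k\<close>.\<close>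
  also have "\<dots> \<le> ((n + 2) ^ k * ((n + 2) ^ 2) ^ k) * (n + 2) ^ k"
    by (intro mult_le_mono power_mono k1 n2) auto
  also have "\<dots> = (n + 2) ^ (4 * k)"
    unfolding power_mult[symmetric] power_add[symmetric] by (rule arg_cong[of _ _ "power (n + 2)"]) simp
  finally have lc: "length (concat (map block F)) \<le> (n + 2) ^ (4 * k)" .
  then show *: "length (encode_cnf n F) \<le> (n + 2) ^ (4 * k + 1)"
    unfolding encode_cnf_blocks using x2 x3 by simp
  have "y \<le> (n + 2) ^ (4 * k + 1)" if "y \<in> set (encode_cnf n F)" for y
  proof -
    have "n \<le> (n + 2) ^ 2" "k + 1 \<le> (n + 2) ^ (4 * k + 1)"
      using k1 power_increasing[of k "4 * k + 1" "n + 2"] by (auto simp: power2_eq_square)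
    moreover have "length F \<le> length (concat (map block F))"
    proof -
      have "length F * 1 = (\<Sum>c\<leftarrow>F. 1)" by (simp add: sum_list_triv)
      also have "\<dots> \<le> (\<Sum>c\<leftarrow>F. Suc (length c))" by (rule sum_list_mono) auto
      finally show ?thesis by (simp add: length_concat block_def o_def)
    qed
    moreover consider "y = n" | "y = length F" | c where "c \<in> set F" "y = length c" | x b c where "c \<in> set F" "(x, b) \<in> set c" "y = litcode (x, b)"
      using \<open>y \<in> set (encode_cnf n F)\<close> unfolding encode_cnf_blocks block_def by auto
    then have "y = n \<or> y = length F \<or> y \<le> k \<or> y \<le> 2 * n + 1"
    proof cases
      case 3 then show ?thesis using F(2) by blast
    next
      case 4
      then have "x < n" using F(3) by blast
      then show ?thesis using 4(3) by (simp add: litcode_def of_bool_def)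
    qed auto
    ultimately show ?thesis using lc n2 x2(2) x3 by linarith
  qed
  then show "input n F i \<le> (n + 2) ^ (4 * k + 1)"
    unfolding input_def input_memory_def by auto
qed

text \<open>\<open>ST\<close> is the work space and \<open>OUT\<close> receives the instance. Both
  are foreign to \<open>p\<close>, which therefore starts as if from a fresh input memory and leaves
  the threshold stored in \<open>ST\<close> intact.\<close>

locale reduction_program = reduction_ram +
  fixes OUT :: nat and p :: prog
  assumes fresh: "ST \<noteq> 1" "ST \<notin> arrays_of p" "OUT \<noteq> 0" "OUT \<noteq> 1" "OUT \<noteq> ST" "OUT \<notin> arrays_of p"
begin

definition total :: "(nat \<Rightarrow> nat) \<Rightarrow> nat" where
  "total I = 2 + 2 * NN I * mm I"

abbreviation cell :: "nat \<Rightarrow> expr" where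
  "cell i \<equiv> Cell ST (Const i)"

definition incr :: prog where
  "incr = Store ST (Const 0) (Add (cell 0) (Const 1))"

definition guard :: expr where
  "guard = Sub (cell 1) (cell 0)"

lemma total_less: "total I < 2 ^ (2 * hh I + 3)"
proof -
  have "mm I \<le> 2 ^ hh I" unfolding mm_def by (intro power_increasing) auto
  then have "NN I * mm I \<le> 2 ^ hh I * 2 ^ hh I" unfolding NN_def by (intro mult_le_mono2)
  also have "\<dots> = 2 ^ (2 * hh I)" by (simp add: power_add[symmetric] mult_2)
  finally have "total I \<le> 2 + 2 * 2 ^ (2 * hh I)" by (simp add: total_def)
  also have "\<dots> < 2 ^ (2 * hh I + 3)"
  proof -
    have "1 \<le> (2::nat) ^ (2 * hh I)" by (rule one_le_power) simp
    moreover have "(2::nat) ^ (2 * hh I + 3) = 8 * 2 ^ (2 * hh I)" by (simp add: power_add)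
    ultimately show ?thesis by linarith
  qed
  finally show ?thesis .
qed

lemma PT_total: "PT (\<lambda>I e. total I)"
  unfolding total_def by (intro rules)

lemma guard_cost:
  assumes "s ST 0 = j" "s ST 1 = n" "j \<le> n" "n < 2 ^ b" "bits 0 + bits 1 \<le> C"
  shows "(val guard s \<noteq> 0 \<longleftrightarrow> j < n) \<and> cost guard s \<le> C + 3 * (b + 1)"
proof -
  have "bits (n - j) \<le> b + 1" by (rule bits_le) (use assms in linarith)
  moreover have "bits j \<le> b + 1" by (rule bits_le) (use assms in linarith)
  moreover have "bits n \<le> b + 1" by (rule bits_le) (use assms in linarith)
  ultimately have "bits (n - j) \<le> b + 1" "bits j \<le> b + 1" "bits n \<le> b + 1" by auto
  then show ?thesis using assms by (auto simp: guard_def)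
qed

lemma runs_incr:
  assumes "s ST 0 = j" "Suc j < 2 ^ b" "bits 0 + bits 1 \<le> C"
  shows "runs incr s (2 * C + 2 * (b + 1)) (s(ST := (s ST)(0 := Suc j)))"
proof -
  have "bits (Suc j) \<le> b + 1" by (rule bits_le) (use assms in linarith)
  moreover have "bits j \<le> b + 1" by (rule bits_le) (use assms in linarith)
  ultimately have "bits (Suc j) \<le> b + 1" "bits j \<le> b + 1" by auto
  then show ?thesis
    using runs_Store[of "Const 0" s "Add (cell 0) (Const 1)" "2 * C + 2 * (b + 1)" ST] assms
    by (simp add: incr_def)
qed

text \<open>Every symbol is computed from the formula in array 0, so the instance is completed in
  \<open>OUT\<close> before it is copied over the formula. Then \<open>p\<close> is run and its
  answer compared with the threshold \<open>nn I ^ RR I\<close>, which was computed beforehand. The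
  bound on \<open>L\<close> limits the cost of this comparison.\<close>

lemma program_exists:
  "\<exists>q u. pol u \<and> (\<forall>n F L tp. input n F \<in> V \<longrightarrow> length (encode_cnf n F) \<le> total (input n F) \<longrightarrow>
     L < 2 ^ (hh (input n F) + 1) \<longrightarrow>
     computes p (map (out (input n F)) [0..<total (input n F)]) L tp \<longrightarrow>
     (\<exists>t. computes q (encode_cnf n F) (of_bool (nn (input n F) ^ RR (input n F) < L)) t \<and>
        t \<le> (total (input n F) + 1) * u (input n F) + tp))"
proof -
  define b where "b = (\<lambda>I. 2 * hh I + 4)"
  have polb: "pol b" unfolding b_def by (intro pol_intros pol_hh)
  let ?l = "\<lambda>_::nat. 0::nat"
  obtain pT where "\<And>b. pol b \<Longrightarrow> \<exists>t. pol t \<and> (\<forall>s. fits ?l b s \<longrightarrow> outcome (\<lambda>I e. total I) pT ?l 1 s (t (s 0)))"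
    by (rule PT_E[OF PT_total, of ?l 1]) auto
  from this[OF polb] obtain tT where tT: "pol tT" "\<And>s. fits ?l b s \<Longrightarrow> outcome (\<lambda>I e. total I) pT ?l 1 s (tT (s 0))"
    by blast
  obtain pH where "\<And>b. pol b \<Longrightarrow> \<exists>t. pol t \<and> (\<forall>s. fits ?l b s \<longrightarrow> outcome (\<lambda>I e. nn I ^ RR I) pH ?l 2 s (t (s 0)))"
    by (rule PT_E[OF PT_threshold, of ?l 2]) auto
  from this[OF polb] obtain tH where tH: "pol tH" "\<And>s. fits ?l b s \<Longrightarrow> outcome (\<lambda>I e. nn I ^ RR I) pH ?l 2 s (tH (s 0))"
    by blast
  obtain pO where "\<And>b. pol b \<Longrightarrow> \<exists>t. pol t \<and> (\<forall>s. fits ?l b s \<longrightarrow> outcome (\<lambda>I e. out I (e 0)) pO ?l 3 s (t (s 0)))"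
    by (rule PT_E[OF PT_out[OF PT_var[of 0]], of ?l 3]) auto
  from this[OF polb] obtain tO where tO: "pol tO" "\<And>s. fits ?l b s \<Longrightarrow> outcome (\<lambda>I e. out I (e 0)) pO ?l 3 s (tO (s 0))"
    by blast
  define C where "C = bits 0 + bits 1 + bits 2 + bits 3"
  have C: "bits 0 + bits 1 \<le> C" "bits 0 \<le> C" "bits 1 \<le> C" "bits 2 \<le> C" "bits 3 \<le> C" by (simp_all add: C_def)
  define S where "S = (\<lambda>I. C + tT I + tH I + tO I + b I + hh I + 2)"
  define bodyB where "bodyB = Seq pO (Seq (Store OUT (cell 0) (cell 3)) incr)"
  define bodyC where "bodyC = Seq (Store 0 (cell 0) (Cell OUT (cell 0))) incr"
  \<comment> \<open>With truncated subtraction, \<open>1 - (H + 1 - L)\<close> is 1 if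
    \<open>H < L\<close> and 0 otherwise.\<close>
  define fin where "fin = Store 1 (Const 0) (Sub (Const 1) (Sub (Add (cell 2) (Const 1)) (Cell 1 (Const 0))))"
  define q where "q = Seq pT (Seq pH (Seq (While guard bodyB) (Seq (Store ST (Const 0) (Const 0))
     (Seq (While guard bodyC) (Seq p fin)))))"
  show ?thesis
  proof (intro exI[of _ q] exI[of _ "\<lambda>I. 100 * S I"] conjI allI impI)
    show "pol (\<lambda>I. 100 * S I)" unfolding S_def by (intro pol_intros tT tH tO polb pol_hh)
    fix n F L tp
    define I where "I = input n F"
    assume "input n F \<in> V" "length (encode_cnf n F) \<le> total (input n F)" "L < 2 ^ (hh (input n F) + 1)"
      "computes p (map (out (input n F)) [0..<total (input n F)]) L tp"
    then have V: "I \<in> V" and len: "length (encode_cnf n F) \<le> total I" and L: "L < 2 ^ (hh I + 1)"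
      and p: "computes p (map (out I) [0..<total I]) L tp" unfolding I_def by auto
    define N where "N = total I"
    define H where "H = nn I ^ RR I"
    have Nb: "N < 2 ^ (b I - 1)" "Suc N < 2 ^ b I"
    proof -
      have "b I - 1 = 2 * hh I + 3" by (simp add: b_def)
      then show *: "N < 2 ^ (b I - 1)" using total_less[of I] by (simp only: N_def)
      have "b I = Suc (b I - 1)" by (simp add: b_def)
      then have "(2::nat) ^ b I = 2 * 2 ^ (b I - 1)" by (metis power_Suc)
      then show "Suc N < 2 ^ b I" using * by linarith
    qed
    define s0 where "s0 = input_memory (encode_cnf n F)"
    have s0: "s0 0 = I" "\<And>a i. a \<noteq> 0 \<Longrightarrow> s0 a i = 0" by (auto simp: s0_def I_def input_def input_memory_def)
    have "fits ?l b s0" using V s0 ST by (simp add: fits_def)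
    from tT(2)[OF this] obtain s1 where s1: "runs pT s0 (tT I) s1" "s1 ST 1 = N"
      "\<And>j. j < 1 \<Longrightarrow> s1 ST j = s0 ST j" "\<And>a. a \<noteq> ST \<Longrightarrow> s1 a = s0 a"
      by (elim outcomeE) (simp add: s0 N_def)
    have s1': "s1 0 = I" "s1 ST 0 = 0" using s1(3)[of 0] s1(4)[of 0] s0 ST by auto
    have "fits ?l b s1" using V s1' by (simp add: fits_def)
    from tH(2)[OF this] obtain s2 where s2: "runs pH s1 (tH I) s2" "s2 ST 2 = H" "H < 2 ^ tH I"
      "\<And>j. j < 2 \<Longrightarrow> s2 ST j = s1 ST j" "\<And>a. a \<noteq> ST \<Longrightarrow> s2 a = s1 a"
      by (elim outcomeE) (simp add: s1' H_def)
    define InvB where "InvB = (\<lambda>j s. s ST 0 = j \<and> s ST 1 = N \<and> s ST 2 = H \<and>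
      (\<forall>a. a \<noteq> ST \<longrightarrow> a \<noteq> OUT \<longrightarrow> s a = s0 a) \<and> (\<forall>i. s OUT i = (if i < j then out I i else 0)))"
    define K where "K = 10 * S I"
    have B: "\<exists>s'. runs bodyB s K s' \<and> InvB (Suc j) s'" if j: "j < N" and s: "InvB j s" for j s
    proof -
      have sI: "s 0 = I" using s ST fresh s0 by (auto simp: InvB_def)
      have jb: "j < 2 ^ b I" "Suc j < 2 ^ b I" using j Nb by auto
      have "fits ?l b s" using V sI s jb by (simp add: fits_def InvB_def)
      from tO(2)[OF this] obtain r1 where r1: "runs pO s (tO I) r1" "r1 ST 3 = out I j" "out I j < 2 ^ tO I"
        "\<And>j. j < 3 \<Longrightarrow> r1 ST j = s ST j" "\<And>a. a \<noteq> ST \<Longrightarrow> r1 a = s a"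
        using s by (elim outcomeE) (simp add: sI InvB_def)
      define r2 where "r2 = r1(OUT := (r1 OUT)(j := out I j))"
      have r10: "r1 ST 0 = j" using r1(4)[of 0] s by (simp add: InvB_def)
      have "runs (Store OUT (cell 0) (cell 3)) r1 (2 * C + (b I + 1) + (tO I + 1)) r2"
        using runs_Store[of "cell 0" r1 "cell 3" "2 * C + (b I + 1) + (tO I + 1)" OUT] bits_le[OF jb(1)] bits_le[OF r1(3)] C
        by (simp add: r10 r1(2) r2_def)
      moreover have r20: "r2 ST 0 = j" using r10 fresh by (simp add: r2_def)
      have "runs incr r2 (2 * C + 2 * (b I + 1)) (r2(ST := (r2 ST)(0 := Suc j)))"
        by (rule runs_incr[of r2 j "b I" C, OF r20 jb(2) C(1)])
      ultimately have "runs bodyB s K (r2(ST := (r2 ST)(0 := Suc j)))"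
        unfolding bodyB_def using r1(1) by (auto intro!: runs_Seq simp: K_def S_def)
      moreover have "InvB (Suc j) (r2(ST := (r2 ST)(0 := Suc j)))"
        using s r1(4)[of 1] r1(4)[of 2] r1(5) fresh by (auto simp: InvB_def r2_def)
      ultimately show ?thesis by blast
    qed
    have gB: "(val guard s \<noteq> 0 \<longleftrightarrow> j < N) \<and> cost guard s \<le> K" if "j \<le> N" "InvB j s" for j s
    proof -
      have "(val guard s \<noteq> 0 \<longleftrightarrow> j < N) \<and> cost guard s \<le> C + 3 * (b I + 1)"
        by (rule guard_cost) (use that Nb C in \<open>auto simp: InvB_def\<close>)
      then show ?thesis by (auto simp: K_def S_def)
    qed
    have "InvB 0 s2" using s2(2) s2(4)[of 0] s2(4)[of 1] s2(5) s1 s1' s0 fresh by (auto simp: InvB_def)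
    from runs_for[of N InvB bodyB K guard, OF B gB this] obtain s3 where
      s3: "runs (While guard bodyB) s2 (N * (2 * K) + K) s3" "InvB N s3" by blast
    define s4 where "s4 = s3(ST := (s3 ST)(0 := 0))"
    have r4: "runs (Store ST (Const 0) (Const 0)) s3 (2 * C) s4"
      using runs_Store[of "Const 0" s3 "Const 0" "2 * C" ST] C by (simp add: s4_def)
    define InvC where "InvC = (\<lambda>j s. s ST 0 = j \<and> s ST 1 = N \<and> s ST 2 = H \<and>
      (\<forall>a. a \<noteq> ST \<longrightarrow> a \<noteq> OUT \<longrightarrow> a \<noteq> 0 \<longrightarrow> s a = s0 a) \<and> (\<forall>i. s OUT i = (if i < N then out I i else 0)) \<and>
      (\<forall>i. s 0 i = (if i < j then out I i else I i)))"
    have CC: "\<exists>s'. runs bodyC s K s' \<and> InvC (Suc j) s'" if j: "j < N" and s: "InvC j s" for j s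
    proof -
      have jb: "j < 2 ^ b I" "Suc j < 2 ^ b I" using j Nb by auto
      have "out I j < 2 ^ tO I"
      proof -
        \<comment> \<open>Array 0 is already partly overwritten here, so the size of the symbol is
          obtained from another memory that still contains the formula.\<close>
        define r where "r = s0(ST := (s0 ST)(0 := j))"
        have "r 0 = I" "r ST 0 = j" using s0 ST by (auto simp: r_def)
        then have "fits ?l b r" using V jb by (simp add: fits_def)
        from tO(2)[OF this] show ?thesis using \<open>r 0 = I\<close> \<open>r ST 0 = j\<close> by (simp add: outcome_def)
      qed
      note bo = bits_le[OF this]
      have sj: "s ST 0 = j" "s OUT j = out I j" using s j by (auto simp: InvC_def)
      define r2 where "r2 = s(0 := (s 0)(j := out I j))"
      have "runs (Store 0 (cell 0) (Cell OUT (cell 0))) s (2 * C + 2 * (b I + 1) + (tO I + 1)) r2"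
        using runs_Store[of "cell 0" s "Cell OUT (cell 0)" "2 * C + 2 * (b I + 1) + (tO I + 1)" 0] bits_le[OF jb(1)] bo C
        by (simp add: sj r2_def)
      moreover have r20: "r2 ST 0 = j" using sj ST by (simp add: r2_def)
      have "runs incr r2 (2 * C + 2 * (b I + 1)) (r2(ST := (r2 ST)(0 := Suc j)))"
        by (rule runs_incr[of r2 j "b I" C, OF r20 jb(2) C(1)])
      ultimately have "runs bodyC s K (r2(ST := (r2 ST)(0 := Suc j)))"
        unfolding bodyC_def by (auto intro!: runs_Seq simp: K_def S_def)
      moreover have "InvC (Suc j) (r2(ST := (r2 ST)(0 := Suc j)))"
        using s fresh ST by (auto simp: InvC_def r2_def)
      ultimately show ?thesis by blast
    qed
    have gC: "(val guard s \<noteq> 0 \<longleftrightarrow> j < N) \<and> cost guard s \<le> K" if "j \<le> N" "InvC j s" for j s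
    proof -
      have "(val guard s \<noteq> 0 \<longleftrightarrow> j < N) \<and> cost guard s \<le> C + 3 * (b I + 1)"
        by (rule guard_cost) (use that Nb C in \<open>auto simp: InvC_def\<close>)
      then show ?thesis by (auto simp: K_def S_def)
    qed
    have "InvC 0 s4" using s3(2) s0 fresh ST by (auto simp: InvB_def InvC_def s4_def)
    from runs_for[of N InvC bodyC K guard, OF CC gC this] obtain s5 where
      s5: "runs (While guard bodyC) s4 (N * (2 * K) + K) s5" "InvC N s5" by blast
    obtain s' where s': "exec p (input_memory (map (out I) [0..<N])) tp s'" "s' 1 0 = L"
      using p unfolding computes_def N_def by blast
    \<comment> \<open>The formula is not longer than the instance, so no remainder of it survives
      behind the copied symbols.\<close>
    have s50: "s5 0 = input_memory (map (out I) [0..<N]) 0"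
    proof
      fix i
      have "I i = 0" if "\<not> i < N" using that len by (simp add: I_def input_def input_memory_def N_def)
      then show "s5 0 i = input_memory (map (out I) [0..<N]) 0 i"
        using s5(2) by (simp add: InvC_def input_memory_def)
    qed
    have "\<forall>a\<in>arrays_of p \<union> {0, 1}. s5 a = input_memory (map (out I) [0..<N]) a"
    proof
      fix a assume a: "a \<in> arrays_of p \<union> {0, 1}"
      show "s5 a = input_memory (map (out I) [0..<N]) a"
      proof (cases "a = 0")
        case False
        then have "s5 a = s0 a" using a s5(2) fresh by (auto simp: InvC_def)
        also have "\<dots> = input_memory (map (out I) [0..<N]) a"
          using s0(2)[OF False] False by (auto simp: input_memory_def)
        finally show ?thesis .
      qed (simp add: s50)
    qed
    then obtain s6 where s6: "exec p s5 tp s6" "\<forall>a\<in>arrays_of p \<union> {0, 1}. s6 a = s' a"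
      "\<forall>a. a \<notin> arrays_of p \<union> {0, 1} \<longrightarrow> s6 a = s5 a"
      using exec_frame[OF s'(1), of "arrays_of p \<union> {0, 1}" s5] by blast
    have s6': "s6 1 0 = L" "s6 ST 2 = H"
    proof -
      show "s6 1 0 = L" using s6(2) s'(2) by simp
      have "ST \<notin> arrays_of p \<union> {0, 1}" using fresh ST by auto
      then show "s6 ST 2 = H" using s6(3) s5(2) by (simp add: InvC_def)
    qed
    define s7 where "s7 = s6(1 := (s6 1)(0 := 1 - (H + 1 - L)))"
    have "runs fin s6 (10 * S I) s7"
    proof -
      have "bits H \<le> tH I + 1" "bits L \<le> hh I + 1 + 1" using bits_le[OF s2(3)] bits_le[OF L] by auto
      moreover have "bits (H + 1) \<le> tH I + 1 + 1"
      proof (rule bits_le)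
        show "H + 1 < 2 ^ (tH I + 1)" using s2(3) one_le_power[of "2::nat" "tH I"] by simp
      qed
      moreover have "bits (H + 1 - L) \<le> tH I + 1 + 1"
      proof (rule bits_le)
        show "H + 1 - L < 2 ^ (tH I + 1)" using s2(3) one_le_power[of "2::nat" "tH I"] by simp
      qed
      moreover have "bits (1 - (H + 1 - L)) \<le> C" using C by (cases "H + 1 - L = 0") auto
      ultimately have c: "cost (Const 0) s6 + cost (Sub (Const 1) (Sub (Add (cell 2) (Const 1)) (Cell 1 (Const 0)))) s6 \<le> 10 * S I"
        using C by (simp add: s6' S_def del: One_nat_def)
      show ?thesis
        using runs_Store[OF c, of 1] unfolding fin_def s7_def by (simp add: s6' del: One_nat_def)
    qed
    note fin = this
    have p6: "runs p s5 tp s6" unfolding runs_def using s6(1) by blast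
    have "runs q s0 ((N + 1) * (100 * S I) + tp) s7"
      unfolding q_def
    proof (rule runs_Seq[OF s1(1) runs_Seq[OF s2(1) runs_Seq[OF s3(1) runs_Seq[OF r4 runs_Seq[OF s5(1)
        runs_Seq[OF p6 fin order_refl] order_refl] order_refl] order_refl] order_refl]])
      have "tT I \<le> S I" "tH I \<le> S I" "C \<le> S I" by (simp_all add: S_def)
      moreover have "N * (2 * K) = 20 * (N * S I)" "(N + 1) * (100 * S I) = 100 * (N * S I) + 100 * S I"
        by (simp_all add: K_def algebra_simps)
      ultimately show "tT I + (tH I + (N * (2 * K) + K + (2 * C + (N * (2 * K) + K + (tp + 10 * S I))))) \<le> (N + 1) * (100 * S I) + tp"
        unfolding K_def by linarith
    qed
    then obtain t where t: "t \<le> (N + 1) * (100 * S I) + tp" "exec q s0 t s7" unfolding runs_def by blast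
    have "s7 1 0 = of_bool (H < L)" unfolding s7_def by (auto simp: of_bool_def)
    then have "computes q (encode_cnf n F) (of_bool (H < L)) t"
      unfolding computes_def using t(2) s0_def by blast
    then show "\<exists>t. computes q (encode_cnf n F) (of_bool (nn (input n F) ^ RR (input n F) < L)) t \<and>
        t \<le> (total (input n F) + 1) * (100 * S (input n F)) + tp"
      using t(1) unfolding N_def H_def I_def by blast
  qed
qed

end

section \<open>Hardness\<close>

text \<open>With \<open>N = 2 ^ h\<close> this is the correction in \<open>iterated_log_gap\<close>:
  the square of about log log h, divided by log h.\<close>

definition gap_exponent :: "nat \<Rightarrow> real" where
  "gap_exponent N = (log 2 (log 2 (log 2 (real N))) + 5)\<^sup>2 / log 2 (log 2 (real N))"

text \<open>About \<open>N powr (1 / log log N)\<close>. For \<open>N = NN I\<close> it equals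
  \<open>mm I\<close>.\<close>

definition string_length :: "nat \<Rightarrow> nat" where
  "string_length N = 2 ^ (floor_log N div floor_log (floor_log N))"

lemma gap_exponent_smallo: "gap_exponent \<in> o(\<lambda>_. 1)"
  unfolding gap_exponent_def by real_asymp

lemma log_string_length_smallo: "(\<lambda>N. log (real N) (real (string_length N))) \<in> o(\<lambda>_. 1)"
proof (rule smalloI_tendsto)
  have ll: "filterlim (\<lambda>N. real (floor_log (floor_log N))) at_top sequentially"
    by (rule filterlim_compose[OF filterlim_real_sequentially filterlim_compose[OF floor_log_at_top floor_log_at_top]])
  have "((\<lambda>N. log (real N) (real (string_length N))) \<longlongrightarrow> 0) sequentially"
  proof (rule tendsto_sandwich[where f = "\<lambda>_. 0" and h = "\<lambda>N. 1 / real (floor_log (floor_log N))"])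
    show "((\<lambda>N. 1 / real (floor_log (floor_log N))) \<longlongrightarrow> 0) sequentially"
      by (rule real_tendsto_divide_at_top[OF tendsto_const ll])
    show "\<forall>\<^sub>F N in sequentially. 0 \<le> log (real N) (real (string_length N))"
      using eventually_gt_at_top[of 1]
    proof eventually_elim
      case (elim N)
      then show ?case by (intro zero_le_log_cancel_iff[THEN iffD2]) (auto simp: string_length_def)
    qed
    have "\<forall>\<^sub>F N in sequentially. 1 \<le> floor_log (floor_log N)"
      using filterlim_compose[OF floor_log_at_top floor_log_at_top] unfolding filterlim_at_top by blast
    then show "\<forall>\<^sub>F N in sequentially. log (real N) (real (string_length N)) \<le> 1 / real (floor_log (floor_log N))"
      using eventually_gt_at_top[of 1]
    proof eventually_elim
      case (elim N)
      define a where "a = floor_log N"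
      define b where "b = floor_log a"
      have b1: "1 \<le> b" using elim by (simp add: a_def b_def)
      have "2 ^ a \<le> N" unfolding a_def using elim by (intro floor_log_exp2_le) simp
      then have aN: "real a \<le> log 2 (real N)" by (rule le_log2_of_power)
      have l0: "0 < log 2 (real N)" using elim by simp
      have "log (real N) (real (string_length N)) = log 2 (real (string_length N)) / log 2 (real N)"
        using elim by (intro log_base_change) auto
      also have "log 2 (real (string_length N)) = real (a div b)"
        by (simp add: string_length_def a_def b_def log_nat_power)
      also have "real (a div b) / log 2 (real N) \<le> (real a / real b) / log 2 (real N)"
        using l0 by (intro divide_right_mono of_nat_div_le_of_nat) simp
      also have "\<dots> \<le> (log 2 (real N) / real b) / log 2 (real N)"
        using l0 aN b1 by (intro divide_right_mono) auto
      also have "\<dots> = 1 / real b" using l0 by simp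
      finally show ?case by (simp add: a_def b_def)
    qed
  qed simp
  then show "((\<lambda>N. log (real N) (real (string_length N)) / 1) \<longlongrightarrow> 0) sequentially" by simp
qed simp

lemma eventually_poly_le_exp:
  assumes "0 < \<delta>"
  shows "\<forall>\<^sub>F n in sequentially. (real n + 2) ^ c \<le> 2 powr (\<delta> * real n)"
proof -
  define d where "d = real c + 1"
  have d: "0 < d" by (simp add: d_def)
  have "((\<lambda>n. (real n + 2) powr d / 2 powr (\<delta> * real n)) \<longlongrightarrow> 0) sequentially"
    using assms d by real_asymp
  then have "\<forall>\<^sub>F n in sequentially. (real n + 2) powr d / 2 powr (\<delta> * real n) < 1"
    by (rule order_tendstoD) simp
  then show ?thesis
  proof eventually_elim
    case (elim n)
    have "(real n + 2) ^ c = (real n + 2) powr real c" by (simp add: powr_realpow)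
    also have "\<dots> \<le> (real n + 2) powr d" by (rule powr_mono) (auto simp: d_def)
    also have "\<dots> \<le> 2 powr (\<delta> * real n)" using elim by (simp add: field_simps)
    finally show ?case .
  qed
qed

text \<open>The optimum is at least \<open>gg I ^ RR I\<close>, hence at least
  \<open>2 ^ RR I * nn I ^ RR I\<close>, or else at most \<open>nn I ^ RR I\<close>. Dividing by a
  factor below \<open>2 ^ RR I\<close> still leaves the first case strictly above the
  threshold.\<close>

lemma (in roomy_reduction) decision:
  assumes "is_approximation c (set xs) (set ys) (real L)" "0 < c" "c < 2 ^ RR I" "1 \<le> nn I"
  shows "satisfiable F \<longleftrightarrow> nn I ^ RR I < L" "L < 2 ^ (hh I + 1)"
proof -
  have L: "real (OPT (set xs) (set ys)) / c \<le> real L" "real L \<le> real (OPT (set xs) (set ys))"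
    using assms(1) by (auto simp: is_approximation_def)
  show "satisfiable F \<longleftrightarrow> nn I ^ RR I < L"
  proof (cases "satisfiable F")
    case True
    have "c * real (nn I ^ RR I) < 2 ^ RR I * real (nn I ^ RR I)"
      using assms(3,4) by (intro mult_strict_right_mono) auto
    also have "\<dots> = real ((2 * nn I) ^ RR I)" by (simp add: power_mult_distrib)
    also have "\<dots> \<le> real (gg I ^ RR I)" using rf(7) by (subst of_nat_le_iff) (intro power_mono, auto)
    also have "\<dots> \<le> real (OPT (set xs) (set ys))" using completeness[OF True] by (subst of_nat_le_iff)
    finally have "real (nn I ^ RR I) < real (OPT (set xs) (set ys)) / c" using assms(2) by (simp add: field_simps)
    then have "real (nn I ^ RR I) < real L" using L(1) by linarith
    then show ?thesis using True by (simp only: of_nat_less_iff simp_thms)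
  next
    case False
    have "real L \<le> real (nn I ^ RR I)" using L(2) soundness[OF False] by (meson le_trans of_nat_le_iff)
    then show ?thesis using False by (simp only: of_nat_le_iff simp_thms not_less)
  qed
  have "OPT (set xs) (set ys) \<le> mm I"
  proof (rule OPT_gadget_le)
    fix i i'
    have "card {j. 0 < j \<and> j < mm I \<and> RX I i j \<and> RY I i' j} \<le> card {..<mm I}" by (rule card_mono) auto
    then show "card {j. 0 < j \<and> j < mm I \<and> RX I i j \<and> RY I i' j} \<le> mm I" by simp
  qed
  also have "\<dots> \<le> 2 ^ hh I" unfolding mm_def by (intro power_increasing) auto
  finally have "L \<le> 2 ^ hh I" using L(2) by (simp only: of_nat_le_iff)
  also have "\<dots> < 2 ^ (hh I + 1)" by simp
  finally show "L < 2 ^ (hh I + 1)" .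
qed

text \<open>With \<open>N = 2 ^ h\<close>, \<open>h \<le> (1 + \<delta>) * v\<close> and v = n / 2 +
  O(1), the time for the LCS program is at most a constant times
  \<open>2 powr ((2 - \<epsilon>) * (1 + \<delta>) * v)\<close>, while writing the instance takes
  little more than \<open>2 ^ v\<close>.\<close>

lemma kSAT_from_LCS:
  assumes \<epsilon>: "0 < \<epsilon>" "\<epsilon> \<le> 1" and k: "1 \<le> k"
    and T: "T \<in> O(\<lambda>N. real N powr (2 - \<epsilon>))"
    and p: "approximates_LCS_pair p string_length (\<lambda>N. 2 powr (log 2 (real N) powr (1 - gap_exponent N))) T"
  shows "\<exists>q T'. T' \<in> O(\<lambda>n. 2 powr ((1 - \<epsilon> / 4) * real n)) \<and> solves_kSAT q k T'"
proof -
  \<comment> \<open>This choice makes \<open>(1 + \<delta>) * (2 - \<epsilon>)\<close> and, thanks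
    to \<open>\<epsilon> \<le> 1\<close>, also \<open>1 + 3 * \<delta>\<close> at most
    \<open>2 * (1 - \<epsilon> / 4)\<close>.\<close>
  define \<delta> where "\<delta> = \<epsilon> / 8"
  have \<delta>: "0 < \<delta>" using \<epsilon> by (simp add: \<delta>_def)
  obtain C where C: "0 < C" "\<forall>\<^sub>F N in sequentially. norm (T N) \<le> C * norm (real N powr (2 - \<epsilon>))"
    using landau_o.bigE[OF T] by blast
  then obtain N1 where N1: "\<And>N. N1 \<le> N \<Longrightarrow> \<bar>T N\<bar> \<le> C * real N powr (2 - \<epsilon>)"
    unfolding eventually_sequentially by auto
  have "\<forall>\<^sub>F v in sequentially. large k (floor_log v)"
    by (rule eventually_compose_filterlim[OF eventually_large floor_log_at_top])
  moreover have "\<forall>\<^sub>F v in sequentially. 3 / \<delta> \<le> real (floor_log v)"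
    using filterlim_compose[OF filterlim_real_sequentially floor_log_at_top] unfolding filterlim_at_top by blast
  \<comment> \<open>This makes the instance at least as long as the encoded formula that it
    overwrites.\<close>
  moreover have "\<forall>\<^sub>F v in sequentially. (2 * v + 2) ^ (4 * k + 1) \<le> 2 ^ v"
  proof -
    have "filterlim (\<lambda>v::nat. 2 * v) at_top sequentially"
      by (rule filterlim_subseq) (auto simp: strict_mono_def)
    from eventually_compose_filterlim[OF eventually_poly_le_exp[of "1/2" "4 * k + 1"] this]
    have "\<forall>\<^sub>F v in sequentially. (real (2 * v) + 2) ^ (4 * k + 1) \<le> 2 powr (1 / 2 * real (2 * v))" by simp
    then show ?thesis
    proof eventually_elim
      case (elim v)
      have "real ((2 * v + 2) ^ (4 * k + 1)) = (real (2 * v) + 2) ^ (4 * k + 1)"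
        by (simp only: of_nat_power of_nat_add of_nat_numeral)
      also have "\<dots> \<le> real (2 ^ v)" using elim by (simp add: powr_realpow)
      finally show ?case by (simp only: of_nat_le_iff)
    qed
  qed
  moreover have "\<forall>\<^sub>F v in sequentially. N1 + 1 \<le> v" by (rule eventually_ge_at_top)
  ultimately have "\<forall>\<^sub>F v in sequentially. large k (floor_log v) \<and> 3 / \<delta> \<le> real (floor_log v) \<and>
      (2 * v + 2) ^ (4 * k + 1) \<le> 2 ^ v \<and> N1 + 1 \<le> v"
    by eventually_elim blast
  \<comment> \<open>As \<open>vv I \<ge> n0\<close> for every input, these conditions hold for all
    formulas, and small ones are not a separate case. The price is a constant factor
    \<open>2 powr (2 * real n0)\<close> in the time.\<close>
  then obtain n0 where n0_large: "\<And>v. n0 \<le> v \<Longrightarrow> large k (floor_log v) \<and> 3 / \<delta> \<le> real (floor_log v) \<and>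
      (2 * v + 2) ^ (4 * k + 1) \<le> 2 ^ v \<and> N1 + 1 \<le> v"
    unfolding eventually_sequentially by blast
  have n01: "1 \<le> n0" using n0_large[of n0] by simp
  obtain ST where ST: "ST \<notin> arrays_of p \<union> {0, 1}"
    using ex_new_if_finite[OF infinite_UNIV_nat, of "arrays_of p \<union> {0, 1}"] finite_arrays_of by auto
  obtain OUT where OUT: "OUT \<notin> arrays_of p \<union> {0, 1, ST}"
    using ex_new_if_finite[OF infinite_UNIV_nat, of "arrays_of p \<union> {0, 1, ST}"] finite_arrays_of by auto
  define V where "V = {input n F |n F. kcnf k n F}"
  interpret reduction k n0 .
  have vv0: "n0 \<le> vv I" for I by (simp add: vv_def)
  have lg: "large k (el I)" for I unfolding el_def using n0_large[OF vv0] by blast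
  note roomy = roomyI[OF lg k n01]
  interpret reduction_program k n0 V 2 ST OUT p
  proof unfold_locales
    show "\<exists>c. \<forall>I\<in>V. \<forall>i. I i \<le> (I 0 + 2) ^ c"
      unfolding V_def using kcnf_size(2)[OF _ k] by (intro exI[of _ "4 * k + 1"]) (auto simp: input_simps)
    show "bb I \<le> vv I" for I by (rule roomy(2))
  qed (use ST OUT n01 in auto)
  obtain q u where u: "pol u" and q: "\<And>n F L tp. input n F \<in> V \<Longrightarrow> length (encode_cnf n F) \<le> total (input n F) \<Longrightarrow>
     L < 2 ^ (hh (input n F) + 1) \<Longrightarrow>
     computes p (map (out (input n F)) [0..<total (input n F)]) L tp \<Longrightarrow>
     (\<exists>t. computes q (encode_cnf n F) (of_bool (nn (input n F) ^ RR (input n F) < L)) t \<and>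
        t \<le> (total (input n F) + 1) * u (input n F) + tp)"
    using program_exists by blast
  obtain c where c: "\<forall>I\<in>V. u I \<le> (I 0 + 2) ^ c" using u unfolding pol_def sz_def by blast
  \<comment> \<open>The size parameters depend on \<open>I 0\<close> alone, so a dummy input with
    this entry expresses the time bound as a function of \<open>n\<close>.\<close>
  define J where "J = (\<lambda>n::nat. \<lambda>_::nat. n)"
  define T' where "T' = (\<lambda>n. real ((total (J n) + 1) * (n + 2) ^ c) + T (NN (J n)))"
  have vJ: "vv (J n) = n div 2 + n0" for n by (simp add: vv_def J_def)
  have "solves_kSAT q k T'"
    unfolding solves_kSAT_def
  proof (intro allI impI)
    fix n F assume kF: "kcnf k n F"
    define I where "I = input n F"
    have IV: "I \<in> V" unfolding V_def I_def using kF by blast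
    have v: "vv I = vv (J n)" by (simp add: vv_def I_def input_simps J_def)
    have eq: "NN I = NN (J n)" "total I = total (J n)"
      by (simp_all add: total_def NN_def mm_def hh_def nn_def el_def v)
    interpret R: roomy_reduction k n0 n F I
      by unfold_locales (use kF roomy(1) in \<open>simp_all add: I_def\<close>)
    have h: "log 2 (real (NN I)) = real (hh I)" by (simp add: NN_def log_nat_power)
    define cN where "cN = 2 powr (log 2 (real (NN I)) powr (1 - gap_exponent (NN I)))"
    have len: "string_length (NN I) = mm I" by (simp add: string_length_def NN_def mm_def)
    have "1 \<le> NN I" by (simp add: NN_def)
    then obtain L tp where L: "computes p (encode_LCS (NN I) (mm I) R.xs R.ys) L tp" "real tp \<le> T (NN I)"
        "is_approximation cN (set R.xs) (set R.ys) (real L)"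
      using p R.instance_gadget unfolding approximates_LCS_pair_def len[symmetric] cN_def by blast
    have "cN < 2 powr real (RR I)"
    proof -
      have "real (hh I) powr (1 - (log 2 (log 2 (real (hh I))) + 5)\<^sup>2 / log 2 (real (hh I)))
          < real (vv I div (el I ^ floor_log (el I) * el I ^ 8))"
      proof (rule iterated_log_gap)
        show "2 ^ el I \<le> vv I" unfolding el_def using vv0[of I] n01 by (intro floor_log_exp2_le) simp
        show "2 * (el I ^ floor_log (el I) * el I ^ 8) \<le> vv I" using roomy(3)[of I] by (simp add: bb_def)
        show "2 \<le> el I" using lg[of I] by (simp add: large_def)
      qed (use roomy(4)[of I] in \<open>simp_all add: hh_def\<close>)
      then show ?thesis unfolding cN_def gap_exponent_def h RR_def bb_def by (intro powr_less_mono) auto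
    qed
    then have cN: "0 < cN" "cN < 2 ^ RR I" by (simp_all add: cN_def powr_realpow)
    note dec = R.decision[OF L(3) cN roomy(6)]
    have "length (encode_cnf n F) \<le> total I"
    proof -
      have "n + 2 \<le> 2 * vv I + 2" using n01 by (simp add: vv_def I_def input_simps)
      then have "(n + 2) ^ (4 * k + 1) \<le> (2 * vv I + 2) ^ (4 * k + 1)" by (intro power_mono) auto
      also have "\<dots> \<le> 2 ^ vv I" using n0_large[OF vv0] by blast
      also have "\<dots> \<le> NN I" unfolding NN_def hh_def by (intro power_increasing) auto
      also have "NN I \<le> total I"
      proof -
        have "NN I * 1 \<le> NN I * mm I" unfolding mm_def by (intro mult_le_mono2) simp
        then show ?thesis unfolding total_def mult.assoc mult_1_right by linarith
      qed
      finally show ?thesis using kcnf_size(1)[OF kF k] by linarith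
    qed
    moreover have "computes p (map (out I) [0..<total I]) L tp"
      using L(1) unfolding R.encode_out total_def .
    ultimately obtain t where t: "computes q (encode_cnf n F) (of_bool (nn I ^ RR I < L)) t"
      "t \<le> (total I + 1) * u I + tp"
      using q[of n F L tp] IV dec(2) unfolding I_def by blast
    have "u I \<le> (n + 2) ^ c" using c IV by (auto simp: I_def input_simps)
    then have "(total I + 1) * u I \<le> (total I + 1) * (n + 2) ^ c" by (rule mult_le_mono2)
    then have "t \<le> (total I + 1) * (n + 2) ^ c + tp" using t(2) by linarith
    then have "real t \<le> real ((total I + 1) * (n + 2) ^ c) + real tp" by (metis of_nat_add of_nat_le_iff)
    then have "real t \<le> T' n" using L(2) unfolding T'_def eq by linarith
    then show "\<exists>t. computes q (encode_cnf n F) (of_bool (satisfiable F)) t \<and> real t \<le> T' n"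
      using t(1) unfolding dec(1)[symmetric] by blast
  qed
  moreover have "T' \<in> O(\<lambda>n. 2 powr ((1 - \<epsilon> / 4) * real n))"
  proof (rule bigoI[where c = "(5 + C) * 2 powr (2 * real n0)"])
    have "\<forall>\<^sub>F n in sequentially. (real n + 2) ^ c \<le> 2 powr (\<delta> / 2 * real n)"
      using \<delta> by (intro eventually_poly_le_exp) simp
    then show "\<forall>\<^sub>F n in sequentially. norm (T' n) \<le> (5 + C) * 2 powr (2 * real n0) * norm (2 powr ((1 - \<epsilon> / 4) * real n))"
    proof eventually_elim
      case (elim n)
      define v l h e where "v = vv (J n)" and "l = el (J n)" and "h = hh (J n)" and "e = h div floor_log h"
      have vn: "real n / 2 \<le> real v" "real v \<le> real n / 2 + real n0" "n0 \<le> v"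
        using n01 unfolding v_def vJ by (auto simp: of_nat_div_le_of_nat)
      have l: "3 / \<delta> \<le> real l" unfolding l_def el_def using n0_large[OF vv0] by blast
      then have l0: "0 < real l" using \<delta> by (meson divide_pos_pos less_le_trans zero_less_numeral)
      have l3: "3 / real l \<le> \<delta>" using l l0 \<delta> by (simp add: field_simps)
      have vl: "3 * (real v / real l) \<le> \<delta> * real v" using mult_right_mono[OF l3, of "real v"] by simp
      have h: "h = v + 2 * (v div l)" by (simp add: h_def hh_def nn_def v_def l_def)
      have "real (v div l) \<le> real v / real l" by (rule of_nat_div_le_of_nat)
      moreover have "0 \<le> real v / real l" by simp
      moreover have "real h = real v + 2 * real (v div l)" unfolding h by simp
      ultimately have "real h \<le> real v + \<delta> * real v" using vl by linarith
      then have hle: "real h \<le> (1 + \<delta>) * real v" by (simp add: distrib_right)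
      have "l \<le> floor_log h" unfolding l_def h_def by (rule roomy(7))
      then have "e \<le> h div l" unfolding e_def using l0 by (intro div_le_mono2) auto
      then have "real e \<le> real (h div l)" by simp
      also have "\<dots> \<le> real h / real l" by (rule of_nat_div_le_of_nat)
      also have "\<dots> \<le> (3 * real v) / real l"
        using roomy(4)[of "J n"] l0 by (intro divide_right_mono) (auto simp: h_def v_def)
      finally have ele: "real e \<le> \<delta> * real v" using vl by simp
      have "real (total (J n) + 1) = 3 + 2 * (2 ^ h * 2 ^ e)"
        by (simp add: total_def NN_def mm_def h_def e_def)
      also have "\<dots> = 3 + 2 * 2 powr (real h + real e)" by (simp add: powr_realpow powr_add)
      also have "\<dots> \<le> 5 * 2 powr (real h + real e)" using ge_one_powr_ge_zero[of 2 "real h + real e"] by simp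
      also have "\<dots> \<le> 5 * 2 powr ((1 + 2 * \<delta>) * real v)"
        using hle ele by (intro mult_left_mono powr_mono) (auto simp: algebra_simps)
      finally have tot: "real (total (J n) + 1) \<le> 5 * 2 powr ((1 + 2 * \<delta>) * real v)" .
      have "(real n + 2) ^ c \<le> 2 powr (\<delta> / 2 * real n)" by (rule elim)
      also have "\<dots> \<le> 2 powr (\<delta> * real v)" using mult_left_mono[OF vn(1), of \<delta>] \<delta> by (intro powr_mono) auto
      finally have "real (total (J n) + 1) * (real n + 2) ^ c \<le> (5 * 2 powr ((1 + 2 * \<delta>) * real v)) * 2 powr (\<delta> * real v)"
        using tot by (intro mult_mono) auto
      also have "\<dots> = 5 * 2 powr ((1 + 3 * \<delta>) * real v)" by (simp add: powr_add[symmetric] algebra_simps)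
      also have "\<dots> \<le> 5 * 2 powr (2 * (1 - \<epsilon> / 4) * real v)"
        using \<epsilon> by (intro mult_left_mono powr_mono mult_right_mono) (auto simp: \<delta>_def)
      also have "real (total (J n) + 1) * (real n + 2) ^ c = real ((total (J n) + 1) * (n + 2) ^ c)"
        by (simp only: of_nat_mult of_nat_power of_nat_add of_nat_numeral)
      finally have A: "real ((total (J n) + 1) * (n + 2) ^ c) \<le> 5 * 2 powr (2 * (1 - \<epsilon> / 4) * real v)" .
      have "N1 \<le> NN (J n)"
      proof -
        have "N1 \<le> v" using n0_large[OF vn(3)] by simp
        also have "v \<le> h" by (simp add: h)
        also have "h \<le> 2 ^ h" by (rule less_imp_le[OF less_exp])
        finally show ?thesis by (simp add: NN_def h_def)
      qed
      then have "\<bar>T (NN (J n))\<bar> \<le> C * real (NN (J n)) powr (2 - \<epsilon>)" by (rule N1)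
      also have "real (NN (J n)) = 2 powr real h" by (simp add: NN_def h_def powr_realpow)
      also have "(2 powr real h) powr (2 - \<epsilon>) = 2 powr (real h * (2 - \<epsilon>))" by (rule powr_powr)
      also have "C * \<dots> \<le> C * 2 powr (2 * (1 - \<epsilon> / 4) * real v)"
      proof (intro mult_left_mono powr_mono)
        have "real h * (2 - \<epsilon>) \<le> ((1 + \<delta>) * real v) * (2 - \<epsilon>)" using hle \<epsilon> by (intro mult_right_mono) auto
        also have "\<dots> = ((1 + \<delta>) * (2 - \<epsilon>)) * real v" by simp
        also have "\<dots> \<le> (2 * (1 - \<epsilon> / 4)) * real v"
        proof (rule mult_right_mono)
          have "0 \<le> \<epsilon> * \<epsilon>" by simp
          then show "(1 + \<delta>) * (2 - \<epsilon>) \<le> 2 * (1 - \<epsilon> / 4)" using \<epsilon> unfolding \<delta>_def by (simp add: algebra_simps)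
        qed simp
        finally show "real h * (2 - \<epsilon>) \<le> 2 * (1 - \<epsilon> / 4) * real v" .
      qed (use C in auto)
      finally have B: "\<bar>T (NN (J n))\<bar> \<le> C * 2 powr (2 * (1 - \<epsilon> / 4) * real v)" .
      have "2 * (1 - \<epsilon> / 4) * real v \<le> 2 * (1 - \<epsilon> / 4) * (real n / 2 + real n0)"
        using vn(2) \<epsilon> by (intro mult_left_mono) auto
      also have "\<dots> \<le> 2 * real n0 + (1 - \<epsilon> / 4) * real n"
        using \<epsilon> by (simp add: algebra_simps)
      finally have "2 powr (2 * (1 - \<epsilon> / 4) * real v) \<le> 2 powr (2 * real n0) * 2 powr ((1 - \<epsilon> / 4) * real n)"
        unfolding powr_add[symmetric] by (intro powr_mono) auto
      then have "(5 + C) * 2 powr (2 * (1 - \<epsilon> / 4) * real v) \<le>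
          (5 + C) * (2 powr (2 * real n0) * 2 powr ((1 - \<epsilon> / 4) * real n))"
        using C(1) by (intro mult_left_mono) auto
      moreover have "\<bar>T' n\<bar> \<le> (5 + C) * 2 powr (2 * (1 - \<epsilon> / 4) * real v)"
        unfolding T'_def using A B by (simp only: distrib_right)
      ultimately show ?case by (simp add: mult.assoc)
    qed
  qed
  ultimately show ?thesis by blast
qed

theorem theorem4:
  assumes SETH
  shows "\<exists>(f :: nat \<Rightarrow> real) (g :: nat \<Rightarrow> real) (m :: nat \<Rightarrow> nat).
           f \<in> o(\<lambda>_. 1) \<and> g \<in> o(\<lambda>_. 1) \<and>
           (\<forall>\<^sub>F N in sequentially. real (m N) = real N powr g N) \<and>
           (\<forall>\<epsilon>::real. \<epsilon> > 0 \<longrightarrow>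
              \<not> (\<exists>(p :: prog) (T :: nat \<Rightarrow> real).
                   T \<in> O(\<lambda>N. real N powr (2 - \<epsilon>)) \<and>
                   approximates_LCS_pair p m (\<lambda>N. 2 powr (log 2 (real N) powr (1 - f N))) T))"
proof (rule exI[of _ gap_exponent], rule exI[of _ "\<lambda>N. log (real N) (real (string_length N))"],
    rule exI[of _ string_length], intro conjI allI impI)
  show "gap_exponent \<in> o(\<lambda>_. 1)" by (rule gap_exponent_smallo)
  show "(\<lambda>N. log (real N) (real (string_length N))) \<in> o(\<lambda>_. 1)" by (rule log_string_length_smallo)
  show "\<forall>\<^sub>F N in sequentially. real (string_length N) = real N powr log (real N) (real (string_length N))"
    using eventually_gt_at_top[of 1]
  proof eventually_elim
    case (elim N)
    then show ?case by (intro powr_log_cancel[symmetric]) (auto simp: string_length_def)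
  qed
  fix \<epsilon> :: real assume \<epsilon>: "\<epsilon> > 0"
  \<comment> \<open>A larger \<open>\<epsilon>\<close> is a stronger assumption on the LCS program,
    so it may be lowered to the range covered by \<open>kSAT_from_LCS\<close>.\<close>
  define \<epsilon>' where "\<epsilon>' = min \<epsilon> 1"
  have \<epsilon>': "0 < \<epsilon>'" "\<epsilon>' \<le> 1" "\<epsilon>' \<le> \<epsilon>" using \<epsilon> by (auto simp: \<epsilon>'_def)
  show "\<not> (\<exists>p T. T \<in> O(\<lambda>N. real N powr (2 - \<epsilon>)) \<and>
     approximates_LCS_pair p string_length (\<lambda>N. 2 powr (log 2 (real N) powr (1 - gap_exponent N))) T)"
  proof (intro notI, elim exE conjE)
    fix p T assume T: "T \<in> O(\<lambda>N. real N powr (2 - \<epsilon>))"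
      and p: "approximates_LCS_pair p string_length (\<lambda>N. 2 powr (log 2 (real N) powr (1 - gap_exponent N))) T"
    have "(\<lambda>N. real N powr (2 - \<epsilon>)) \<in> O(\<lambda>N. real N powr (2 - \<epsilon>'))"
    proof (rule bigoI[where c = 1])
      show "\<forall>\<^sub>F N in sequentially. norm (real N powr (2 - \<epsilon>)) \<le> 1 * norm (real N powr (2 - \<epsilon>'))"
        using eventually_ge_at_top[of 1]
      proof eventually_elim
        case (elim N)
        then show ?case using \<epsilon>' by (simp add: powr_mono)
      qed
    qed
    with T have "T \<in> O(\<lambda>N. real N powr (2 - \<epsilon>'))" by (rule landau_o.big_trans)
    note reduce = kSAT_from_LCS[OF \<epsilon>'(1,2) _ this p]
    have "0 < \<epsilon>' / 4" using \<epsilon>' by simp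
    then obtain k where "3 \<le> k" "\<not> (\<exists>q T'. T' \<in> O(\<lambda>n. 2 powr ((1 - \<epsilon>' / 4) * real n)) \<and> solves_kSAT q k T')"
      using assms unfolding SETH_def by blast
    then show False using reduce[of k] by simp
  qed
qed

end
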